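(* Let $H$ be a non-vertex-balanced graph with $v_H=|V(H)|$ vertices, let $\mathcal H$ be the multigraph obtained from $H$ by the collapsing process, with vertices $y_1,\dots,y_{k}$, $k=|V(\mathcal H)|$, and $h=|E(\mathcal H)|$ edges (counted with multiplicity). Let $\mathcal H(n,p)$ be the random multigraph with vertex set the disjoint union of parts $V_1,\dots,V_k$, each of size $n/v_H$, where for $u\in V_i$, $w\in V_j$ there are as many potential edges between $u$ and $w$ as there are edges between $y_i$ and $y_j$ in $\mathcal H$, each retained independently with probability $p$. Let $\Phi(G)$ denote the number of $\mathcal H$-factors of such a multigraph $G$ in which each copy of $\mathcal H$ has its vertex $y_i$ in $V_i$ for all $i$. If $p=\omega(n^{-1/m(H)})$, then there is a function $g(n)=O(n)$ such that \[\Pr\left(\Phi(\mathcal H(n,p))\ge \left(n^{k-1}p^{h}\right)^{n/v_H}e^{-g(n)}\right)\ge 1-n^{-\omega(1)}.\]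
   Context: $H$ is non-vertex-balanced if some $v$ has $m(v,H)<m(H)$, where $d(F)=|E(F)|/(|V(F)|-1)$, $m(H)$ is the maximum density over subgraphs with at least two vertices and $m(v,H)$ the maximum over those containing $v$. The collapsing process: starting from $H_0=H$, while $H_i$ contains a subgraph $F$ of density $m(H)$, replace the vertices of $F$ by one new vertex, delete the edges of $F$ and keep all other edges with endpoints in $F$ redirected to the new vertex (possibly creating parallel edges); the final multigraph is $\mathcal H$ (it contains no subgraph of density $\ge m(H)$). $v_H$ divides $n$. An $\mathcal H$-factor is a collection of vertex-disjoint copies of $\mathcal H$ covering all vertices. *)

theory Defs
  imports "HOL-Probability.Probability" "HOL-Library.Landau_Symbols"
begin

text \<open>Undirected multigraphs: edges are named, and \<open>ends e\<close> is the set of end-vertices of \<open>e\<close>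
  (two of them, or one if \<open>e\<close> is a loop).\<close>

record ('v, 'e) mgraph =
  verts :: "'v set"
  edges :: "'e set"
  ends :: "'e \<Rightarrow> 'v set"

definition simple_graph :: "('v, 'e) mgraph \<Rightarrow> bool" where
  "simple_graph G \<longleftrightarrow> finite (verts G) \<and> inj_on (ends G) (edges G) \<and>
     (\<forall>e \<in> edges G. ends G e \<subseteq> verts G \<and> card (ends G e) = 2)"

text \<open>The functions \<open>ends\<close> of a graph and of its subgraphs agree everywhere, so that a subgraph
  is determined by its vertex set and its edge set, and subgraphs can be counted as records.\<close>

definition subgraph :: "('v, 'e) mgraph \<Rightarrow> ('v, 'e) mgraph \<Rightarrow> bool" where
  "subgraph F G \<longleftrightarrow> verts F \<subseteq> verts G \<and> edges F \<subseteq> edges G \<and> ends F = ends G \<and>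
     (\<forall>e \<in> edges F. ends F e \<subseteq> verts F)"

definition density :: "('v, 'e) mgraph \<Rightarrow> real" where
  "density F = real (card (edges F)) / (real (card (verts F)) - 1)"

definition max_density :: "('v, 'e) mgraph \<Rightarrow> real" where
  "max_density G = Max {density F | F. subgraph F G \<and> 2 \<le> card (verts F)}"

definition max_density_at :: "'v \<Rightarrow> ('v, 'e) mgraph \<Rightarrow> real" where
  "max_density_at v G =
     Max {density F | F. subgraph F G \<and> 2 \<le> card (verts F) \<and> v \<in> verts F}"

text \<open>On a graph with a single vertex both maxima are over the empty set, hence equal: such a
  graph does not satisfy the following predicate.\<close>

definition non_vertex_balanced :: "('v, 'e) mgraph \<Rightarrow> bool" where
  "non_vertex_balanced H \<longleftrightarrow> (\<exists>v \<in> verts H. max_density_at v H < max_density H)"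

definition collapse :: "('v, 'e) mgraph \<Rightarrow> 'v \<Rightarrow> ('v, 'e) mgraph \<Rightarrow> ('v, 'e) mgraph" where
  "collapse F z G =
     \<lparr> verts = insert z (verts G - verts F),
       edges = edges G - edges F,
       ends = (\<lambda>e. (\<lambda>x. if x \<in> verts F then z else x) ` ends G e) \<rparr>"

text \<open>The new vertex \<open>z\<close> only has to differ from the vertices that are kept; being allowed to reuse
  the name of a vertex of \<open>F\<close>, the process does not run out of names on a finite type.\<close>

definition collapse_step :: "real \<Rightarrow> ('v, 'e) mgraph \<Rightarrow> ('v, 'e) mgraph \<Rightarrow> bool" where
  "collapse_step d G G' \<longleftrightarrow>
     (\<exists>F z. subgraph F G \<and> 2 \<le> card (verts F) \<and> density F = d \<and>
        z \<notin> verts G - verts F \<and> G' = collapse F z G)"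

text \<open>\<open>K\<close> is the outcome of some run of the collapsing process on \<open>H\<close>.\<close>

definition collapses_to :: "('v, 'e) mgraph \<Rightarrow> ('v, 'e) mgraph \<Rightarrow> bool" where
  "collapses_to H K \<longleftrightarrow>
     (collapse_step (max_density H))\<^sup>*\<^sup>* H K \<and>
     \<not> (\<exists>F. subgraph F K \<and> 2 \<le> card (verts F) \<and> density F = max_density H)"

text \<open>The parts of the random multigraph are indexed by the vertices of \<open>K\<close>; each has size \<open>N\<close>.\<close>

definition vpart :: "nat \<Rightarrow> 'v \<Rightarrow> ('v \<times> nat) set" where
  "vpart N y = {y} \<times> {..<N}"

text \<open>A potential edge is a pair \<open>(e, s)\<close> with \<open>e\<close> an edge of \<open>K\<close> and \<open>s\<close> the set of its
  end-vertices, one in the part of each end of \<open>e\<close>. So for distinct \<open>y\<close>, \<open>y'\<close>, every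
  \<open>u \<in> vpart N y\<close> and \<open>w \<in> vpart N y'\<close> are joined by one potential edge \<open>(e, {u, w})\<close> for each
  edge \<open>e\<close> of \<open>K\<close> between \<open>y\<close> and \<open>y'\<close>.\<close>

definition potential_edges :: "('v, 'e) mgraph \<Rightarrow> nat \<Rightarrow> ('e \<times> ('v \<times> nat) set) set" where
  "potential_edges K N =
     {(e, s). e \<in> edges K \<and> s \<subseteq> (\<Union>y \<in> verts K. vpart N y) \<and> bij_betw fst s (ends K e)}"

definition random_mgraph ::
    "('v, 'e) mgraph \<Rightarrow> nat \<Rightarrow> real \<Rightarrow> ('v \<times> nat, 'e \<times> ('v \<times> nat) set) mgraph pmf" where
  "random_mgraph K N p =
     map_pmf
       (\<lambda>r. \<lparr> verts = (\<Union>y \<in> verts K. vpart N y), edges = {x \<in> potential_edges K N. r x}, ends = snd \<rparr>)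
       (Pi_pmf (potential_edges K N) False (\<lambda>_. bernoulli_pmf p))"

definition mgraph_iso ::
    "('v \<Rightarrow> 'w) \<Rightarrow> ('e \<Rightarrow> 'f) \<Rightarrow> ('v, 'e) mgraph \<Rightarrow> ('w, 'f) mgraph \<Rightarrow> bool" where
  "mgraph_iso \<phi> \<psi> K F \<longleftrightarrow>
     bij_betw \<phi> (verts K) (verts F) \<and> bij_betw \<psi> (edges K) (edges F) \<and>
     (\<forall>e \<in> edges K. ends F (\<psi> e) = \<phi> ` ends K e)"

definition partite_copy ::
    "('v, 'e) mgraph \<Rightarrow> ('v \<Rightarrow> 'w set) \<Rightarrow> ('w, 'f) mgraph \<Rightarrow> ('w, 'f) mgraph \<Rightarrow> bool" where
  "partite_copy K V G F \<longleftrightarrow>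
     subgraph F G \<and> (\<exists>\<phi> \<psi>. mgraph_iso \<phi> \<psi> K F \<and> (\<forall>y \<in> verts K. \<phi> y \<in> V y))"

definition partite_factor ::
    "('v, 'e) mgraph \<Rightarrow> ('v \<Rightarrow> 'w set) \<Rightarrow> ('w, 'f) mgraph \<Rightarrow> ('w, 'f) mgraph set \<Rightarrow> bool" where
  "partite_factor K V G \<C> \<longleftrightarrow>
     (\<forall>F \<in> \<C>. partite_copy K V G F) \<and> disjoint_family_on verts \<C> \<and> (\<Union>F \<in> \<C>. verts F) = verts G"

definition num_factors ::
    "('v, 'e) mgraph \<Rightarrow> ('v \<Rightarrow> 'w set) \<Rightarrow> ('w, 'f) mgraph \<Rightarrow> nat" where
  "num_factors K V G = card {\<C>. partite_factor K V G \<C>}"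

end

theory Submission
  imports Defs "HOL-Real_Asymp.Real_Asymp"
begin

text \<open>Every subgraph on at least two vertices of the collapsed multigraph has density less than
  \<open>m(H)\<close>, so \<open>p\<close> exceeds the relevant threshold by a power of \<open>n\<close>. Spend half of the probability
  \<open>p\<close> on each of two independent rounds.

  In the first round, Janson's inequality and a union bound show that all families of parts of
  size more than \<open>N / ln N\<close>, where \<open>N = n / v_H\<close>, span at least an eighth of the expected number of
  copies. Choosing disjoint copies greedily until parts of size \<open>N / ln N\<close> are left, one obtains
  the required number of partial factors up to a factor \<open>exp (O n)\<close>.

  In the second round, a fixed family of leftover parts has a factor with superpolynomially high
  probability. Indeed, a uniformly random factor of the complete multigraph is spread, and by the
  minimal fragment argument a random set of polynomially larger density than the spread requires
  contains, after boundedly many rounds, a factor with polynomially small failure probability;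
  \<open>ln N\<close> repetitions make it superpolynomially small. By Markov's inequality, then, half of the
  partial factors of the first round can be completed.\<close>

section \<open>Random subsets and Janson's inequality\<close>

text \<open>Two obstacles shape the argument. For parts of size \<open>r\<close> the Janson exponent
  has order \<open>r^2 q^\<delta>\<close>, so a lower tail bound for all exponentially many families
  at once is available only while the parts are large, and greedy removal has to stop early.
  Stopping at \<open>N / ln N\<close> is cheap: the count loses a power of \<open>m!\<close>, and
  \<open>m! \<le> N^m = exp (O N)\<close>. Completing the leftover fails with probability
  \<open>exp (- c (ln N)^2)\<close>, far too much for a union bound over leftover families;
  completions are therefore averaged with the greedy weights. This is legitimate because those
  weights depend on the first round only.

  The room in both rounds is the gap between \<open>m(H)\<close> and a bound \<open>\<delta>\<close>
  on the densities in the collapsed multigraph: \<open>p^\<delta>\<close> is polynomially larger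
  than \<open>1 / n\<close>. Expectations are finite sums over subsets, so that independence becomes
  an identity proved by induction on the ground set.\<close>

definition rexp :: "'a set \<Rightarrow> real \<Rightarrow> ('a set \<Rightarrow> real) \<Rightarrow> real" where
  "rexp X q f = (\<Sum>W\<in>Pow X. q ^ card W * (1 - q) ^ card (X - W) * f W)"

lemma rexp_empty [simp]: "rexp {} q f = f {}"
  by (simp add: rexp_def)

text \<open>Conditioning on the membership of one element; the independence statements below follow
  from it by induction.\<close>

lemma rexp_insert:
  assumes "finite X" "x \<notin> X"
  shows "rexp (insert x X) q f = q * rexp X q (\<lambda>W. f (insert x W)) + (1 - q) * rexp X q f"
proof -
  have inj: "inj_on (insert x) (Pow X)" using assms by (auto simp: inj_on_def)
  have d: "Pow X \<inter> insert x ` Pow X = {}" using assms by auto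
  have "rexp (insert x X) q f =
     (\<Sum>W\<in>Pow X. q ^ card W * (1 - q) ^ card (insert x X - W) * f W)
   + (\<Sum>W\<in>insert x ` Pow X. q ^ card W * (1 - q) ^ card (insert x X - W) * f W)"
    unfolding rexp_def Pow_insert using assms d by (subst sum.union_disjoint) auto
  also have "(\<Sum>W\<in>Pow X. q ^ card W * (1 - q) ^ card (insert x X - W) * f W)
      = (1 - q) * rexp X q f"
    unfolding rexp_def sum_distrib_left
  proof (rule sum.cong)
    fix W assume W: "W \<in> Pow X"
    then have "insert x X - W = insert x (X - W)" "x \<notin> X - W" using assms by auto
    then have "card (insert x X - W) = Suc (card (X - W))" using assms by simp
    then show "q ^ card W * (1 - q) ^ card (insert x X - W) * f W =
      (1 - q) * (q ^ card W * (1 - q) ^ card (X - W) * f W)" by simp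
  qed simp
  also have "(\<Sum>W\<in>insert x ` Pow X. q ^ card W * (1 - q) ^ card (insert x X - W) * f W)
     = q * rexp X q (\<lambda>W. f (insert x W))"
    unfolding rexp_def sum_distrib_left sum.reindex[OF inj] o_def
  proof (rule sum.cong)
    fix W assume W: "W \<in> Pow X"
    then have "insert x X - insert x W = X - W" "x \<notin> W" "finite W"
      using assms by (auto dest: finite_subset)
    then show "q ^ card (insert x W) * (1 - q) ^ card (insert x X - insert x W) * f (insert x W) =
      q * (q ^ card W * (1 - q) ^ card (X - W) * f (insert x W))" by simp
  qed simp
  finally show ?thesis by simp
qed

lemma rexp_cong: "(\<And>W. W \<subseteq> X \<Longrightarrow> f W = g W) \<Longrightarrow> rexp X q f = rexp X q g"
  unfolding rexp_def by (intro sum.cong) auto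

lemma rexp_add: "rexp X q (\<lambda>W. f W + g W) = rexp X q f + rexp X q g"
  unfolding rexp_def by (simp add: ring_distribs sum.distrib)

lemma rexp_cmult: "rexp X q (\<lambda>W. c * f W) = c * rexp X q f"
  unfolding rexp_def by (simp add: sum_distrib_left mult_ac)

lemma rexp_diff: "rexp X q (\<lambda>W. f W - g W) = rexp X q f - rexp X q g"
  using rexp_add[of X q f "\<lambda>W. (-1) * g W"] rexp_cmult[of X q "-1" g] by simp

lemma rexp_sum: "rexp X q (\<lambda>W. \<Sum>i\<in>I. f i W) = (\<Sum>i\<in>I. rexp X q (f i))"
  unfolding rexp_def sum_distrib_left by (rule sum.swap)

lemma rexp_mono:
  assumes "0 \<le> q" "q \<le> 1" "\<And>W. W \<subseteq> X \<Longrightarrow> f W \<le> g W"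
  shows "rexp X q f \<le> rexp X q g"
  unfolding rexp_def using assms by (intro sum_mono mult_left_mono) auto

lemma rexp_const: "finite X \<Longrightarrow> rexp X q (\<lambda>_. c) = c"
  by (induction X rule: finite_induct) (auto simp: rexp_insert algebra_simps)

lemma rexp_nonneg:
  assumes "0 \<le> q" "q \<le> 1" "\<And>W. W \<subseteq> X \<Longrightarrow> 0 \<le> f W"
  shows "0 \<le> rexp X q f"
  unfolding rexp_def using assms by (intro sum_nonneg mult_nonneg_nonneg) auto

text \<open>Two-round exposure: both independent sets miss an element with probability
  \<open>(1 - a) * (1 - b)\<close>, so their union is a random set of density
  \<open>a + b - a * b\<close>.\<close>

lemma rexp_union:
  assumes "finite X"
  shows "rexp X a (\<lambda>W. rexp X b (\<lambda>W'. f (W \<union> W'))) = rexp X (a + b - a * b) f"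
  using assms
proof (induction X arbitrary: f rule: finite_induct)
  case (insert x X)
  have "rexp X a (\<lambda>W. rexp X b (\<lambda>W'. f (insert x (W \<union> W')))) = rexp X (a + b - a * b) (\<lambda>W. f (insert x W))"
    using insert.IH[of "\<lambda>W. f (insert x W)"] by simp
  then show ?case using insert.hyps insert.IH[of f]
    by (simp add: rexp_insert rexp_add rexp_cmult) (simp add: algebra_simps)
qed simp

text \<open>Coupling: the denser set is the sparser one together with an independent set of density
  \<open>c\<close>, where \<open>a + c - a * c = b\<close>. Solving for \<open>c\<close> divides by
  \<open>1 - a\<close>, whence the separate case.\<close>

lemma rexp_mono_prob:
  assumes "finite X" "0 \<le> a" "a \<le> b" "b \<le> 1"
    and "\<And>W W'. W \<subseteq> W' \<Longrightarrow> W' \<subseteq> X \<Longrightarrow> f W \<le> f W'"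
  shows "rexp X a f \<le> rexp X b f"
proof (cases "a = 1")
  case True
  then show ?thesis using assms by simp
next
  case False
  define c where "c = (b - a) / (1 - a)"
  have "c * (1 - a) = b - a" using False by (simp add: c_def)
  then have "a + c - a * c = b" by (simp add: algebra_simps)
  then have c: "0 \<le> c" "c \<le> 1" "a + c - a * c = b"
    using assms False by (auto simp: c_def divide_simps)
  have "rexp X a f = rexp X a (\<lambda>W. rexp X c (\<lambda>W'. f W))"
    using assms by (simp add: rexp_const)
  also have "\<dots> \<le> rexp X a (\<lambda>W. rexp X c (\<lambda>W'. f (W \<union> W')))"
    using assms c by (intro rexp_mono) auto
  also have "\<dots> = rexp X b f" using rexp_union[OF assms(1)] c by simp
  finally show ?thesis .
qed

text \<open>Conditioned on \<open>A \<subseteq> W\<close>, the rest of \<open>W\<close> remains an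
  unconditioned random set, so \<open>W \<union> A\<close> samples the conditional law. The next
  lemma but one is the counterpart for avoiding \<open>A\<close>, once the case analysis below is
  mirrored.\<close>

lemma rexp_superset:
  assumes "finite X" "A \<subseteq> X"
  shows "rexp X q (\<lambda>W. if A \<subseteq> W then g W else 0) = q ^ card A * rexp X q (\<lambda>W. g (W \<union> A))"
  using assms
proof (induction X arbitrary: A g rule: finite_induct)
  case (insert x X)
  show ?case
  proof (cases "x \<in> A")
    case True
    define B where "B = A - {x}"
    have A: "A = insert x B" "x \<notin> B" "B \<subseteq> X" "finite B"
      using True insert.prems insert.hyps by (auto simp: B_def intro: finite_subset)
    have "rexp X q (\<lambda>W. if A \<subseteq> insert x W then g (insert x W) else 0)
       = rexp X q (\<lambda>W. if B \<subseteq> W then g (insert x W) else 0)"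
      using A insert.hyps by (intro rexp_cong) auto
    moreover have "rexp X q (\<lambda>W. if A \<subseteq> W then g W else 0) = rexp X q (\<lambda>_. 0)"
      using A insert.hyps by (intro rexp_cong) auto
    ultimately show ?thesis
      using A insert.hyps insert.IH[of B "\<lambda>W. g (insert x W)"]
      by (simp add: rexp_insert rexp_const algebra_simps)
  next
    case False
    then have A: "A \<subseteq> X" using insert.prems by auto
    have "rexp X q (\<lambda>W. if A \<subseteq> insert x W then g (insert x W) else 0)
       = rexp X q (\<lambda>W. if A \<subseteq> W then g (insert x W) else 0)"
      using False A insert.hyps by (intro rexp_cong) auto
    then show ?thesis
      using A insert.hyps insert.IH[of A "\<lambda>W. g (insert x W)"] insert.IH[of A g]
      by (simp add: rexp_insert rexp_const algebra_simps)
  qed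
qed auto

lemma rexp_disjoint:
  assumes "finite X" "A \<subseteq> X"
  shows "rexp X q (\<lambda>W. if W \<inter> A = {} then g W else 0) = (1 - q) ^ card A * rexp X q (\<lambda>W. g (W - A))"
  using assms
proof (induction X arbitrary: A g rule: finite_induct)
  case (insert x X)
  show ?case
  proof (cases "x \<in> A")
    case True
    define B where "B = A - {x}"
    have A: "A = insert x B" "x \<notin> B" "B \<subseteq> X" "finite B"
      using True insert.prems insert.hyps by (auto simp: B_def intro: finite_subset)
    have 1: "rexp X q (\<lambda>W. if W \<inter> A = {} then g W else 0)
       = rexp X q (\<lambda>W. if W \<inter> B = {} then g W else 0)"
      using A insert.hyps by (intro rexp_cong) auto
    have 2: "rexp X q (\<lambda>W. if insert x W \<inter> A = {} then g (insert x W) else 0) = rexp X q (\<lambda>_. 0)"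
      using A insert.hyps by (intro rexp_cong) auto
    have 3: "rexp X q (\<lambda>W. g (insert x W - A)) = rexp X q (\<lambda>W. g (W - B))"
       "rexp X q (\<lambda>W. g (W - A)) = rexp X q (\<lambda>W. g (W - B))"
      using A insert.hyps by (auto intro!: rexp_cong arg_cong[where f = g])
    show ?thesis
      unfolding rexp_insert[OF insert.hyps] 1 2 3 insert.IH[OF A(3)] using A insert.hyps
      by (simp add: rexp_const algebra_simps)
  next
    case False
    then have A: "A \<subseteq> X" using insert.prems by auto
    have 1: "rexp X q (\<lambda>W. if insert x W \<inter> A = {} then g (insert x W) else 0)
       = rexp X q (\<lambda>W. if W \<inter> A = {} then g (insert x W) else 0)"
      using False A insert.hyps by (intro rexp_cong) auto
    have 2: "rexp X q (\<lambda>W. g (insert x W - A)) = rexp X q (\<lambda>W. g (insert x (W - A)))"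
      using False by (auto intro!: rexp_cong arg_cong[where f = g])
    show ?thesis
      unfolding rexp_insert[OF insert.hyps] 1 2 insert.IH[OF A] 
      by (simp add: algebra_simps)
  qed
qed auto

section \<open>Janson's lower tail inequality\<close>

lemma prod_one_minus_ge:
  fixes a :: "'i \<Rightarrow> real"
  assumes "finite I" "\<And>i. i \<in> I \<Longrightarrow> 0 \<le> a i \<and> a i \<le> 1"
  shows "1 - sum a I \<le> (\<Prod>i\<in>I. 1 - a i)"
  using assms
proof (induction I rule: finite_induct)
  case (insert i I)
  have P: "0 \<le> (\<Prod>j\<in>I. 1 - a j)" "(\<Prod>j\<in>I. 1 - a j) \<le> 1"
    using insert.prems by (auto intro!: prod_nonneg prod_le_1)
  have "a i * (\<Prod>j\<in>I. 1 - a j) \<le> a i" using P insert.prems by (simp add: mult_left_le)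
  moreover have "1 - sum a I \<le> (\<Prod>j\<in>I. 1 - a j)" using insert by auto
  ultimately show ?case using insert.hyps by (simp add: algebra_simps)
qed simp

text \<open>The usual appeal to Harris' inequality reduces, for cylinder events, to
  conditioning on \<^term>\<open>A i \<subseteq> W\<close>, which amounts to replacing \<^term>\<open>W\<close> by \<^term>\<open>W \<union> A i\<close>.\<close>

lemma janson_laplace:
  assumes X: "finite X" and I: "finite I" "\<And>i. i \<in> I \<Longrightarrow> A i \<subseteq> X"
    and q: "0 \<le> q" "q \<le> 1" and \<rho>: "0 \<le> \<rho>" "\<rho> \<le> 1"
  shows "rexp X q (\<lambda>W. \<Prod>i\<in>I. 1 - \<rho> * of_bool (A i \<subseteq> W)) \<le>
     exp (- \<rho> * (\<Sum>i\<in>I. q ^ card (A i)) +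
       \<rho>\<^sup>2 * (\<Sum>i\<in>I. \<Sum>j\<in>I. if A i \<inter> A j \<noteq> {} then q ^ card (A i \<union> A j) else 0))"
  using I
proof (induction I rule: finite_induct)
  case empty
  then show ?case using X by (simp add: rexp_const)
next
  case (insert i I)
  define g where "g J W = (\<Prod>j\<in>J. 1 - \<rho> * of_bool (A j \<subseteq> W))" for J W
  have gle: "g J W \<le> g J W'" if "W' \<subseteq> W" for J W W'
    unfolding g_def using that \<rho> by (intro prod_mono) (auto simp: of_bool_def)
  have g01: "0 \<le> g J W" "g J W \<le> 1" for J W
    unfolding g_def using \<rho> by (auto intro!: prod_nonneg prod_le_1)
  \<comment> \<open>Only the sets in \<open>N\<close> are correlated with the event
    \<open>A i \<subseteq> W\<close>; the factors of those in \<open>F\<close> are independent of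
    it.\<close>
  define N where "N = {j \<in> I. A i \<inter> A j \<noteq> {}}"
  define F where "F = {j \<in> I. A i \<inter> A j = {}}"
  have NF: "I = N \<union> F" "N \<inter> F = {}" "finite N" "finite F" using insert.hyps by (auto simp: N_def F_def)
  have gI: "g I W = g N W * g F W" for W
    unfolding g_def using NF by (simp add: prod.union_disjoint)
  have Ai: "A i \<subseteq> X" and AI: "\<And>j. j \<in> I \<Longrightarrow> A j \<subseteq> X" using insert.prems by auto
  define S where "S = (\<Sum>j\<in>I. if A i \<inter> A j \<noteq> {} then q ^ card (A i \<union> A j) else 0)"
  have S0: "0 \<le> S" unfolding S_def using q by (intro sum_nonneg) auto
  have S: "S = (\<Sum>j\<in>N. q ^ card (A i \<union> A j))"
    unfolding S_def N_def using insert.hyps by (subst sum.inter_filter) auto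
  define D where "D = q ^ card (A i) - \<rho> * S"
  have EFnn: "0 \<le> rexp X q (g F)" using q g01 by (intro rexp_nonneg) auto
  have ub: "rexp X q (\<lambda>W. if B \<subseteq> W then g F W else 0) \<le> q ^ card B * rexp X q (g F)" if "B \<subseteq> X" for B
    unfolding rexp_superset[OF X that] using q gle by (intro mult_left_mono rexp_mono) auto
  have F_ind: "rexp X q (\<lambda>W. if A i \<subseteq> W then g F W else 0) = q ^ card (A i) * rexp X q (g F)"
    unfolding rexp_superset[OF X Ai]
  proof -
    have "g F (W \<union> A i) = g F W" for W
      unfolding g_def by (intro prod.cong) (auto simp: F_def of_bool_def)
    then show "q ^ card (A i) * rexp X q (\<lambda>W. g F (W \<union> A i)) = q ^ card (A i) * rexp X q (g F)" by simp
  qed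
  \<comment> \<open>Given \<open>A i \<subseteq> W\<close>, the product over \<open>N\<close> is at
    least 1 minus \<open>\<rho>\<close> times the number of its events that occur. Forcing the
    elements of \<open>A i \<union> A j\<close> into \<open>W\<close> can only decrease the product
    over \<open>F\<close>, which bounds the correction terms.\<close>
  have low: "D * rexp X q (g F) \<le> rexp X q (\<lambda>W. if A i \<subseteq> W then g I W else 0)"
  proof -
    have "D * rexp X q (g F) = q ^ card (A i) * rexp X q (g F) - \<rho> * (\<Sum>j\<in>N. q ^ card (A i \<union> A j) * rexp X q (g F))"
      unfolding D_def S sum_distrib_right[symmetric] by (simp add: algebra_simps)
    also have "\<dots> \<le> rexp X q (\<lambda>W. if A i \<subseteq> W then g F W else 0)
       - \<rho> * (\<Sum>j\<in>N. rexp X q (\<lambda>W. if A i \<union> A j \<subseteq> W then g F W else 0))"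
      unfolding F_ind using \<rho> Ai AI
      by (intro diff_left_mono mult_left_mono sum_mono ub) (auto simp: N_def)
    also have "\<dots> = rexp X q (\<lambda>W. (if A i \<subseteq> W then g F W else 0)
        - \<rho> * (\<Sum>j\<in>N. if A i \<union> A j \<subseteq> W then g F W else 0))"
      by (simp add: rexp_diff rexp_cmult rexp_sum)
    also have "\<dots> \<le> rexp X q (\<lambda>W. if A i \<subseteq> W then g I W else 0)"
    proof (rule rexp_mono)
      fix W
      show "(if A i \<subseteq> W then g F W else 0) - \<rho> * (\<Sum>j\<in>N. if A i \<union> A j \<subseteq> W then g F W else 0)
        \<le> (if A i \<subseteq> W then g I W else 0)"
      proof (cases "A i \<subseteq> W")
        case True
        have "1 - (\<Sum>j\<in>N. \<rho> * of_bool (A j \<subseteq> W)) \<le> g N W"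
          unfolding g_def using NF \<rho> by (intro prod_one_minus_ge) auto
        then have "(1 - (\<Sum>j\<in>N. \<rho> * of_bool (A j \<subseteq> W))) * g F W \<le> g I W"
          unfolding gI using g01 by (intro mult_right_mono) auto
        moreover have "\<rho> * (\<Sum>j\<in>N. if A i \<union> A j \<subseteq> W then g F W else 0) = (\<Sum>j\<in>N. \<rho> * of_bool (A j \<subseteq> W)) * g F W"
          unfolding sum_distrib_left sum_distrib_right using True by (intro sum.cong) auto
        ultimately show ?thesis using True by (simp add: algebra_simps)
      next
        case False
        then show ?thesis by (auto simp: sum.neutral)
      qed
    qed (use q in auto)
    finally show ?thesis .
  qed
  define e where "e = 1 - \<rho> * D"
  have EIF: "rexp X q (g I) \<le> rexp X q (g F)"
    unfolding gI using q g01 by (intro rexp_mono) (auto intro: mult_left_le_one_le)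
  have EInn: "0 \<le> rexp X q (g I)" using q g01 by (intro rexp_nonneg) auto
  have "g (insert i I) W = g I W - \<rho> * (if A i \<subseteq> W then g I W else 0)" for W
    unfolding g_def using insert.hyps by (auto simp: algebra_simps)
  then have "rexp X q (g (insert i I)) = rexp X q (\<lambda>W. g I W - \<rho> * (if A i \<subseteq> W then g I W else 0))"
    by (intro rexp_cong) auto
  then have eq: "rexp X q (g (insert i I)) = rexp X q (g I) - \<rho> * rexp X q (\<lambda>W. if A i \<subseteq> W then g I W else 0)"
    by (simp only: rexp_diff rexp_cmult)
  \<comment> \<open>For negative \<open>D\<close> the claimed factor exceeds 1, so dropping the
    nonnegative subtracted term of \<open>eq\<close> is enough.\<close>
  have step: "rexp X q (g (insert i I)) \<le> exp (- \<rho> * D) * rexp X q (g I)"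
  proof (cases "D \<ge> 0")
    case True
    have "D * rexp X q (g I) \<le> rexp X q (\<lambda>W. if A i \<subseteq> W then g I W else 0)"
      using low mult_left_mono[OF EIF True] by linarith
    then have "rexp X q (g (insert i I)) \<le> (1 + (- \<rho> * D)) * rexp X q (g I)"
      unfolding eq using mult_left_mono[OF _ \<rho>(1)] by (fastforce simp: algebra_simps)
    also have "\<dots> \<le> exp (- \<rho> * D) * rexp X q (g I)"
      using EInn by (intro mult_right_mono exp_ge_add_one_self)
    finally show ?thesis .
  next
    case False
    have "0 \<le> rexp X q (\<lambda>W. if A i \<subseteq> W then g I W else 0)" using q g01 by (intro rexp_nonneg) auto
    then have "rexp X q (g (insert i I)) \<le> 1 * rexp X q (g I)" unfolding eq using \<rho> by simp
    also have "\<dots> \<le> exp (- \<rho> * D) * rexp X q (g I)"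
      using False \<rho> EInn by (intro mult_right_mono) (auto simp: mult_le_0_iff)
    finally show ?thesis .
  qed
  let ?\<Delta> = "\<lambda>I. \<Sum>i\<in>I. \<Sum>j\<in>I. if A i \<inter> A j \<noteq> {} then q ^ card (A i \<union> A j) else 0"
  let ?m = "\<lambda>I. \<Sum>i\<in>I. q ^ card (A i)"
  have IH: "rexp X q (g I) \<le> exp (- \<rho> * ?m I + \<rho>\<^sup>2 * ?\<Delta> I)"
    using insert.IH insert.prems unfolding g_def by auto
  have "?\<Delta> I + S \<le> ?\<Delta> (insert i I)"
  proof -
    have a: "?\<Delta> I \<le> (\<Sum>i'\<in>I. \<Sum>j\<in>insert i I. if A i' \<inter> A j \<noteq> {} then q ^ card (A i' \<union> A j) else 0)"
      using insert.hyps q by (intro sum_mono sum_mono2) auto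
    have b: "S \<le> (\<Sum>j\<in>insert i I. if A i \<inter> A j \<noteq> {} then q ^ card (A i \<union> A j) else 0)"
      unfolding S_def using insert.hyps q by (intro sum_mono2) auto
    show ?thesis using a b insert.hyps by (subst sum.insert) auto
  qed
  then have Dl: "\<rho>\<^sup>2 * (?\<Delta> I + S) \<le> \<rho>\<^sup>2 * ?\<Delta> (insert i I)" by (intro mult_left_mono) auto
  have "rexp X q (g (insert i I)) \<le> exp (- \<rho> * D) * exp (- \<rho> * ?m I + \<rho>\<^sup>2 * ?\<Delta> I)"
    using step IH by (meson exp_ge_zero mult_left_mono order_trans)
  also have "\<dots> = exp (- \<rho> * ?m (insert i I) + \<rho>\<^sup>2 * (?\<Delta> I + S))"
    unfolding exp_add[symmetric] using insert.hyps by (simp add: D_def algebra_simps power2_eq_square)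
  also have "\<dots> \<le> exp (- \<rho> * ?m (insert i I) + \<rho>\<^sup>2 * ?\<Delta> (insert i I))"
    using Dl by simp
  finally show ?case unfolding g_def .
qed

lemma exp_le_one_minus:
  fixes \<rho> :: real
  assumes "0 \<le> \<rho>" "\<rho> \<le> 1 / 2"
  shows "exp (- 2 * \<rho>) \<le> 1 - \<rho>"
proof -
  have "1 + 2 * \<rho> \<le> exp (2 * \<rho>)" by (rule exp_ge_add_one_self)
  moreover have "1 \<le> (1 - \<rho>) * (1 + 2 * \<rho>)" using assms mult_left_mono[of \<rho> "1 / 2" \<rho>] by (simp add: algebra_simps)
  ultimately have "1 \<le> (1 - \<rho>) * exp (2 * \<rho>)"
    using assms mult_left_mono[of "1 + 2 * \<rho>" "exp (2 * \<rho>)" "1 - \<rho>"] by linarith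
  then show ?thesis by (simp add: exp_minus field_simps)
qed

text \<open>Exponential Markov: if fewer than \<open>\<mu> / 8\<close> sets occur, the product of
  the previous bound is at least \<open>exp (- \<rho> * \<mu> / 4)\<close>. The choice
  \<open>\<rho> = 1 / (2 * D * \<mu>)\<close> minimises
  \<open>- \<rho> \<mu> + \<rho>^2 D \<mu>^2\<close> with value \<open>- 1 / (4 D)\<close>; the
  Markov factor uses up half of this. The hypothesis \<open>1 \<le> D * \<mu>\<close> keeps
  \<open>\<rho>\<close> below \<open>1 / 2\<close>.\<close>

lemma janson_lower_tail:
  assumes X: "finite X" and I: "finite I" "\<And>i. i \<in> I \<Longrightarrow> A i \<subseteq> X"
    and q: "0 \<le> q" "q \<le> 1" and D: "0 < D"
    and mu: "\<mu> = (\<Sum>i\<in>I. q ^ card (A i))" "1 \<le> D * \<mu>"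
    and Delta: "(\<Sum>i\<in>I. \<Sum>j\<in>I. if A i \<inter> A j \<noteq> {} then q ^ card (A i \<union> A j) else 0) \<le> D * \<mu>\<^sup>2"
  shows "rexp X q (\<lambda>W. of_bool (real (card {i \<in> I. A i \<subseteq> W}) < \<mu> / 8)) \<le> exp (- 1 / (8 * D))"
proof -
  have mu0: "\<mu> > 0" using mu D by (metis zero_less_mult_pos zero_less_one order_less_le_trans)
  define \<rho> where "\<rho> = 1 / (2 * D * \<mu>)"
  have \<rho>: "0 \<le> \<rho>" "\<rho> \<le> 1 / 2" using mu D mu0 by (auto simp: \<rho>_def field_simps)
  let ?Y = "\<lambda>W. real (card {i \<in> I. A i \<subseteq> W})"
  have P: "(\<Prod>i\<in>I. 1 - \<rho> * of_bool (A i \<subseteq> W)) = (1 - \<rho>) ^ card {i \<in> I. A i \<subseteq> W}" for W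
  proof -
    have "(\<Prod>i\<in>I. 1 - \<rho> * of_bool (A i \<subseteq> W)) = (\<Prod>i\<in>I. if A i \<subseteq> W then 1 - \<rho> else 1)"
      by (intro prod.cong) auto
    also have "\<dots> = (\<Prod>i\<in>{i \<in> I. A i \<subseteq> W}. 1 - \<rho>)" using I(1) by (rule prod.inter_filter[symmetric])
    finally show ?thesis by simp
  qed
  have pt: "of_bool (?Y W < \<mu> / 8) \<le> exp (\<rho> * \<mu> / 4) * (\<Prod>i\<in>I. 1 - \<rho> * of_bool (A i \<subseteq> W))" for W
  proof (cases "?Y W < \<mu> / 8")
    case True
    have "exp (- (\<rho> * \<mu> / 4)) \<le> exp (- 2 * \<rho> * ?Y W)" 
      using True \<rho> mult_left_mono[of "?Y W" "\<mu> / 8" \<rho>] by (simp add: algebra_simps)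
    also have "\<dots> = exp (- 2 * \<rho>) ^ card {i \<in> I. A i \<subseteq> W}" by (simp add: exp_of_nat_mult[symmetric] mult_ac)
    also have "\<dots> \<le> (1 - \<rho>) ^ card {i \<in> I. A i \<subseteq> W}"
      using exp_le_one_minus[OF \<rho>] by (intro power_mono) auto
    finally have "exp (\<rho> * \<mu> / 4) * exp (- (\<rho> * \<mu> / 4)) \<le> exp (\<rho> * \<mu> / 4) * (1 - \<rho>) ^ card {i \<in> I. A i \<subseteq> W}"
      by (intro mult_left_mono) auto
    then show ?thesis using True unfolding P by (simp add: exp_minus field_simps)
  next
    case False
    then show ?thesis unfolding P using \<rho> by simp
  qed
  have "rexp X q (\<lambda>W. of_bool (?Y W < \<mu> / 8)) \<le>
     exp (\<rho> * \<mu> / 4) * rexp X q (\<lambda>W. \<Prod>i\<in>I. 1 - \<rho> * of_bool (A i \<subseteq> W))"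
    unfolding rexp_cmult[symmetric] using pt q by (intro rexp_mono) auto
  also have "\<dots> \<le> exp (\<rho> * \<mu> / 4) * exp (- \<rho> * \<mu> + \<rho>\<^sup>2 * (D * \<mu>\<^sup>2))"
  proof (intro mult_left_mono)
    have "rexp X q (\<lambda>W. \<Prod>i\<in>I. 1 - \<rho> * of_bool (A i \<subseteq> W)) \<le> exp (- \<rho> * \<mu> + \<rho>\<^sup>2 * 
      (\<Sum>i\<in>I. \<Sum>j\<in>I. if A i \<inter> A j \<noteq> {} then q ^ card (A i \<union> A j) else 0))"
      unfolding mu(1) using janson_laplace[OF X I q, where \<rho> = \<rho>] \<rho> by simp
    also have "\<dots> \<le> exp (- \<rho> * \<mu> + \<rho>\<^sup>2 * (D * \<mu>\<^sup>2))"
      using Delta by (simp add: mult_left_mono)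
    finally show "rexp X q (\<lambda>W. \<Prod>i\<in>I. 1 - \<rho> * of_bool (A i \<subseteq> W)) \<le> \<dots>" .
  qed simp
  also have "\<dots> = exp (\<rho> * \<mu> / 4 + (- \<rho> * \<mu> + \<rho>\<^sup>2 * (D * \<mu>\<^sup>2)))" by (simp only: exp_add)
  also have "\<rho> * \<mu> / 4 + (- \<rho> * \<mu> + \<rho>\<^sup>2 * (D * \<mu>\<^sup>2)) = - 1 / (8 * D)"
    using D mu0 by (simp add: \<rho>_def field_simps power2_eq_square)
  finally show ?thesis .
qed

section \<open>Spread families\<close>

lemma fact_ge_power: "(real t / exp 1) ^ t \<le> fact t"
proof -
  have "real t ^ t /\<^sub>R fact t \<le> (\<Sum>n. real t ^ n /\<^sub>R fact n)"
    using summable_exp_generic[of "real t"]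
    by (intro sum_le_suminf[where I = "{t}", simplified]) auto
  then have "real t ^ t / fact t \<le> exp (real t)" by (simp add: exp_def divide_inverse_commute)
  also have "exp (real t) = exp 1 ^ t" by (simp add: exp_of_nat_mult[symmetric])
  finally show ?thesis by (simp add: power_divide field_simps)
qed

text \<open>The usual bound \<open>(e n / t)^t\<close> for the binomial coefficient, multiplied out
  so that \<open>t = 0\<close> is no exception.\<close>

lemma binomial_le_pow_exp: "real (n choose t) * (real t / exp 1) ^ t \<le> real n ^ t"
proof -
  have "real (n choose t) * (real t / exp 1) ^ t \<le> real (n choose t) * fact t"
    by (intro mult_left_mono fact_ge_power) auto
  also have "\<dots> = real ((n choose t) * fact t)" by simp
  also have "\<dots> \<le> real (n ^ t)" using binomial_fact_pow[of n t] of_nat_le_iff by blast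
  finally show ?thesis by simp
qed

text \<open>The minimal fragment of Park and Pham: among the members inside
  \<open>W \<union> f i\<close>, the one with fewest elements outside \<open>W\<close> is taken, and
  \<open>W\<close> is removed from it. Indexing the family lets members occur with
  multiplicity.\<close>

definition frag :: "'i set \<Rightarrow> ('i \<Rightarrow> 'a set) \<Rightarrow> 'a set \<Rightarrow> 'i \<Rightarrow> 'a set" where
  "frag I f W i = f (ARG_MIN (\<lambda>j. card (f j - W)) j. j \<in> I \<and> f j \<subseteq> W \<union> f i) - W"

lemma frag:
  assumes "i \<in> I"
  shows "frag I f W i \<subseteq> f i" "frag I f W i \<inter> W = {}" "\<exists>j\<in>I. f j \<subseteq> W \<union> frag I f W i"
    "\<And>j. j \<in> I \<Longrightarrow> f j \<subseteq> W \<union> f i \<Longrightarrow> card (frag I f W i) \<le> card (f j - W)"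
proof -
  define j where "j = (ARG_MIN (\<lambda>j. card (f j - W)) j. j \<in> I \<and> f j \<subseteq> W \<union> f i)"
  have j: "j \<in> I \<and> f j \<subseteq> W \<union> f i"
    unfolding j_def by (rule arg_min_natI[of _ i]) (use assms in auto)
  show "frag I f W i \<subseteq> f i" "frag I f W i \<inter> W = {}"
    using j unfolding frag_def j_def by auto
  show "\<exists>j\<in>I. f j \<subseteq> W \<union> frag I f W i"
    using j unfolding frag_def j_def by (intro bexI[of _ j]) (auto simp: j_def)
  fix j' assume "j' \<in> I" "f j' \<subseteq> W \<union> f i"
  then show "card (frag I f W i) \<le> card (f j' - W)"
    unfolding frag_def by (intro arg_min_nat_le) auto
qed

text \<open>The Park--Pham encoding: a minimal fragment \<^term>\<open>T\<close> of \<^term>\<open>W\<close> is contained in every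
  member of the family that lies in \<^term>\<open>Z = W \<union> T\<close>, so that given \<^term>\<open>Z\<close> there are at most
  as many choices of \<^term>\<open>T\<close> as there are subsets of one fixed such member.\<close>

lemma frag_expectation:
  fixes f :: "'i \<Rightarrow> 'a set"
  assumes X: "finite X" and I: "finite I" "\<And>i. i \<in> I \<Longrightarrow> f i \<subseteq> X"
    and l: "\<And>i. i \<in> I \<Longrightarrow> card (f i) \<le> l"
    and spread: "\<And>U. U \<subseteq> X \<Longrightarrow> real (card {i\<in>I. U \<subseteq> f i}) \<le> M * s ^ card U"
    and M: "0 \<le> M" and s: "0 \<le> s" and q: "0 < q" "q \<le> 1"
  shows "rexp X q (\<lambda>W. real (card {i\<in>I. card (frag I f W i) = t})) \<le> M * real (l choose t) * (s / q) ^ t"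
proof -
  define TT where "TT = {T. T \<subseteq> X \<and> card T = t}"
  have TT: "finite TT" unfolding TT_def using X by auto
  \<comment> \<open>The choice depends on \<open>Z\<close> alone. If no member lies in
    \<open>Z\<close> the value is arbitrary, and the first factor of \<open>b\<close> ensures that
    only subsets of members are ever counted.\<close>
  define c where "c Z = f (SOME j. j \<in> I \<and> f j \<subseteq> Z)" for Z
  have cI: "\<exists>j\<in>I. c Z = f j \<and> f j \<subseteq> Z" if "j \<in> I" "f j \<subseteq> Z" for j Z
    using someI[of "\<lambda>j. j \<in> I \<and> f j \<subseteq> Z" j] that unfolding c_def by blast
  define b where "b Z T = (of_bool (\<exists>j\<in>I. c Z = f j) * of_bool (T \<subseteq> c Z) :: real)" for Z T
  have pt: "real (card {i\<in>I. card (frag I f W i) = t}) \<le>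
     (\<Sum>T\<in>TT. real (card {i\<in>I. T \<subseteq> f i}) * (if W \<inter> T = {} then b (W \<union> T) T else 0))"
    if W: "W \<subseteq> X" for W
  proof -
    have "{i\<in>I. card (frag I f W i) = t} \<subseteq> (\<Union>T\<in>TT. {i\<in>I. frag I f W i = T})"
    proof
      fix i assume "i \<in> {i\<in>I. card (frag I f W i) = t}"
      then have "i \<in> I" "frag I f W i \<subseteq> X" "card (frag I f W i) = t"
        using frag(1)[of i I f W] I(2)[of i] by auto
      then show "i \<in> (\<Union>T\<in>TT. {i\<in>I. frag I f W i = T})" unfolding TT_def by auto
    qed
    then have "card {i\<in>I. card (frag I f W i) = t} \<le> card (\<Union>T\<in>TT. {i\<in>I. frag I f W i = T})"
      using I TT by (intro card_mono) auto
    also have "\<dots> \<le> (\<Sum>T\<in>TT. card {i\<in>I. frag I f W i = T})"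
      by (rule card_UN_le[OF TT])
    finally have "real (card {i\<in>I. card (frag I f W i) = t}) \<le> (\<Sum>T\<in>TT. real (card {i\<in>I. frag I f W i = T}))"
      unfolding of_nat_sum[symmetric] of_nat_le_iff .
    also have "\<dots> \<le> (\<Sum>T\<in>TT. real (card {i\<in>I. T \<subseteq> f i}) * (if W \<inter> T = {} then b (W \<union> T) T else 0))"
    proof (rule sum_mono)
      fix T assume T: "T \<in> TT"
      show "real (card {i\<in>I. frag I f W i = T}) \<le>
         real (card {i\<in>I. T \<subseteq> f i}) * (if W \<inter> T = {} then b (W \<union> T) T else 0)"
      proof (cases "\<exists>i\<in>I. frag I f W i = T")
        case True
        then obtain i where i: "i \<in> I" "frag I f W i = T" by auto
        note fr = frag[OF i(1), where f = f and W = W, unfolded i(2)]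
        have fT: "finite T" using T X unfolding TT_def by (auto intro: finite_subset)
        obtain j0 where "j0 \<in> I" "f j0 \<subseteq> W \<union> T" using fr(3) by auto
        then obtain j where j: "j \<in> I" "c (W \<union> T) = f j" "f j \<subseteq> W \<union> T" using cI by blast
        have "card T \<le> card (f j - W)" using fr(4)[of j] fr(1) j by auto
        moreover have "f j - W \<subseteq> T" using j by auto
        ultimately have "f j - W = T" using fT by (metis card_seteq)
        then have "b (W \<union> T) T = 1" using j unfolding b_def by auto
        moreover have "card {i\<in>I. frag I f W i = T} \<le> card {i\<in>I. T \<subseteq> f i}"
          using I frag(1)[of _ I f W] by (intro card_mono) fastforce+
        ultimately show ?thesis using fr(2) by (auto simp: Int_commute)
      next
        case False
        then have e: "{i\<in>I. frag I f W i = T} = {}" by auto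
        show ?thesis unfolding e by (simp add: b_def)
      qed
    qed
    finally show ?thesis .
  qed
  have "rexp X q (\<lambda>W. real (card {i\<in>I. card (frag I f W i) = t})) \<le>
    rexp X q (\<lambda>W. \<Sum>T\<in>TT. real (card {i\<in>I. T \<subseteq> f i}) * (if W \<inter> T = {} then b (W \<union> T) T else 0))"
    using pt q by (intro rexp_mono) auto
  also have "\<dots> = (\<Sum>T\<in>TT. real (card {i\<in>I. T \<subseteq> f i}) * rexp X q (\<lambda>W. if W \<inter> T = {} then b (W \<union> T) T else 0))"
    by (simp add: rexp_sum rexp_cmult)
  also have "\<dots> \<le> (\<Sum>T\<in>TT. (M * s ^ t) * ((1 / q ^ t) * rexp X q (\<lambda>W. if T \<subseteq> W then b W T else 0)))"
  proof (intro sum_mono mult_mono)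
    fix T assume T: "T \<in> TT"
    then have TX: "T \<subseteq> X" "card T = t" unfolding TT_def by auto
    show "real (card {i\<in>I. T \<subseteq> f i}) \<le> M * s ^ t" using spread TX by auto
    show "0 \<le> M * s ^ t" using M s by simp
    show "0 \<le> rexp X q (\<lambda>W. if W \<inter> T = {} then b (W \<union> T) T else 0)"
      using q by (intro rexp_nonneg) (auto simp: b_def)
    \<comment> \<open>Disjointness from \<open>T\<close> has weight \<open>(1 - q) ^ t\<close>,
      while containing \<open>T\<close> has weight \<open>q ^ t\<close>. Trading the first for the
      second, as the encoding by \<open>Z\<close> requires, costs the factor
      \<open>1 / q ^ t\<close>.\<close>
    have "rexp X q (\<lambda>W. if W \<inter> T = {} then b (W \<union> T) T else 0)
        = (1 - q) ^ t * rexp X q (\<lambda>W. b (W \<union> T) T)"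
      unfolding rexp_disjoint[OF X TX(1)] using TX by simp
    also have "\<dots> \<le> 1 * rexp X q (\<lambda>W. b (W \<union> T) T)"
      using q by (intro mult_right_mono power_le_one rexp_nonneg) (auto simp: b_def)
    also have "\<dots> = (1 / q ^ t) * (q ^ t * rexp X q (\<lambda>W. b (W \<union> T) T))" using q by simp
    also have "q ^ t * rexp X q (\<lambda>W. b (W \<union> T) T) = rexp X q (\<lambda>W. if T \<subseteq> W then b W T else 0)"
      unfolding rexp_superset[OF X TX(1)] using TX by simp
    finally show "rexp X q (\<lambda>W. if W \<inter> T = {} then b (W \<union> T) T else 0)
      \<le> (1 / q ^ t) * rexp X q (\<lambda>W. if T \<subseteq> W then b W T else 0)" .
  qed
  also have "\<dots> = (M * (s / q) ^ t) * rexp X q (\<lambda>W. \<Sum>T\<in>TT. if T \<subseteq> W then b W T else 0)"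
    by (simp add: rexp_sum sum_distrib_left power_divide)
  also have "\<dots> \<le> (M * (s / q) ^ t) * rexp X q (\<lambda>W. real (l choose t))"
  proof (intro mult_left_mono rexp_mono)
    fix W assume "W \<subseteq> X"
    show "(\<Sum>T\<in>TT. if T \<subseteq> W then b W T else 0) \<le> real (l choose t)"
    proof (cases "\<exists>j\<in>I. c W = f j")
      case True
      then obtain j where j: "j \<in> I" "c W = f j" by auto
      have fj: "finite (f j)" using I j X by (auto intro: finite_subset)
      have "(\<Sum>T\<in>TT. if T \<subseteq> W then b W T else 0) \<le> (\<Sum>T\<in>TT. if T \<subseteq> f j then 1 else 0)"
        using j by (intro sum_mono) (auto simp: b_def)
      also have "\<dots> = real (card {T \<in> TT. T \<subseteq> f j})"
        using TT by (simp add: sum.If_cases Int_def)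
      also have "{T \<in> TT. T \<subseteq> f j} = {T. T \<subseteq> f j \<and> card T = t}"
        using I j unfolding TT_def by blast
      also have "card \<dots> = card (f j) choose t" using fj by (rule n_subsets)
      also have "\<dots> \<le> l choose t" using l j by (intro binomial_right_mono) auto
      finally show ?thesis by simp
    next
      case False
      then show ?thesis by (simp add: b_def sum.neutral)
    qed
  qed (use q M s in auto)
  also have "\<dots> = M * real (l choose t) * (s / q) ^ t" using X by (simp add: rexp_const)
  finally show ?thesis .
qed

text \<open>For \<open>t > \<gamma> * L\<close> the binomial coefficient is at most
  \<open>(e L / t)^t < (e / \<gamma>)^t\<close>, so fragments of size \<open>t\<close> contribute at
  most \<open>M * x ^ t\<close>, and the geometric series sums to at most \<open>2 * x * M\<close>.
  The size bound \<open>L\<close> is real because it is multiplied by \<open>\<gamma>\<close> in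
  every round.\<close>

lemma frag_tail:
  fixes f :: "'i \<Rightarrow> 'a set"
  assumes X: "finite X" and I: "finite I" "\<And>i. i \<in> I \<Longrightarrow> f i \<subseteq> X"
    and l: "\<And>i. i \<in> I \<Longrightarrow> real (card (f i)) \<le> L"
    and spread: "\<And>U. U \<subseteq> X \<Longrightarrow> real (card {i\<in>I. U \<subseteq> f i}) \<le> M * s ^ card U"
    and M: "0 \<le> M" and s: "0 \<le> s" and q: "0 < q" "q \<le> 1"
    and \<gamma>: "0 < \<gamma>" and x: "x = exp 1 * (s / q) / \<gamma>" "x \<le> 1 / 2"
  shows "rexp X q (\<lambda>W. real (card {i\<in>I. real (card (frag I f W i)) > \<gamma> * L})) \<le> 2 * x * M"
proof (cases "L \<ge> 0")
  case False
  then have "I = {}" using l by fastforce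
  then show ?thesis using X M s q \<gamma> x by (simp add: rexp_const)
next
  case L: True
  define l where "l = nat \<lfloor>L\<rfloor>"
  have l_ge: "card (f i) \<le> l" if "i \<in> I" for i using l[OF that] unfolding l_def by linarith
  have lL: "real l \<le> L" using L by (simp add: l_def)
  have x0: "0 \<le> x" using x s q \<gamma> by simp
  define S where "S = {t \<in> {1..l}. real t > \<gamma> * L}"
  have fS: "finite S" by (simp add: S_def)
  have "rexp X q (\<lambda>W. real (card {i\<in>I. real (card (frag I f W i)) > \<gamma> * L})) \<le>
     rexp X q (\<lambda>W. \<Sum>t\<in>S. real (card {i\<in>I. card (frag I f W i) = t}))"
  proof (rule rexp_mono)
    fix W
    have "{i\<in>I. real (card (frag I f W i)) > \<gamma> * L} \<subseteq> (\<Union>t\<in>S. {i\<in>I. card (frag I f W i) = t})"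
    proof
      fix i assume "i \<in> {i\<in>I. real (card (frag I f W i)) > \<gamma> * L}"
      then have i: "i \<in> I" "real (card (frag I f W i)) > \<gamma> * L" by auto
      have "card (frag I f W i) \<le> card (f i)"
        using frag(1)[OF i(1)] I(2)[OF i(1)] X by (meson card_mono finite_subset)
      moreover have "0 \<le> \<gamma> * L" using \<gamma> L by simp
      then have "real (card (frag I f W i)) > 0" using i by linarith
      ultimately have "card (frag I f W i) \<in> S" using i l_ge[OF i(1)] unfolding S_def by auto
      then show "i \<in> (\<Union>t\<in>S. {i\<in>I. card (frag I f W i) = t})" using i by auto
    qed
    then have "card {i\<in>I. real (card (frag I f W i)) > \<gamma> * L} \<le> card (\<Union>t\<in>S. {i\<in>I. card (frag I f W i) = t})"
      using I fS by (intro card_mono) auto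
    also have "\<dots> \<le> (\<Sum>t\<in>S. card {i\<in>I. card (frag I f W i) = t})" by (rule card_UN_le[OF fS])
    finally show "real (card {i\<in>I. real (card (frag I f W i)) > \<gamma> * L}) \<le> (\<Sum>t\<in>S. real (card {i\<in>I. card (frag I f W i) = t}))"
      unfolding of_nat_sum[symmetric] of_nat_le_iff .
  qed (use q in auto)
  also have "\<dots> = (\<Sum>t\<in>S. rexp X q (\<lambda>W. real (card {i\<in>I. card (frag I f W i) = t})))"
    by (rule rexp_sum)
  also have "\<dots> \<le> (\<Sum>t\<in>S. M * x ^ t)"
  proof (rule sum_mono)
    fix t assume t: "t \<in> S"
    have "rexp X q (\<lambda>W. real (card {i\<in>I. card (frag I f W i) = t})) \<le> M * real (l choose t) * (s / q) ^ t"
      by (rule frag_expectation[OF X I l_ge spread M s q])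
    also have "\<dots> = M * (real (l choose t) * (s / q) ^ t)" by simp
    also have "\<dots> \<le> M * x ^ t"
    proof (rule mult_left_mono[OF _ M])
      have t0: "real t > 0" "real t > \<gamma> * L" using t by (auto simp: S_def)
      have "real (l choose t) * (real t / exp 1) ^ t \<le> real l ^ t" by (rule binomial_le_pow_exp)
      also have "\<dots> \<le> (real t / \<gamma>) ^ t"
        using t0 lL \<gamma> by (intro power_mono) (auto simp: field_simps intro: order_trans[OF mult_left_mono[OF lL]])
      finally have "real (l choose t) * (real t / exp 1) ^ t * (exp 1 / real t) ^ t \<le> (real t / \<gamma>) ^ t * (exp 1 / real t) ^ t"
        by (rule mult_right_mono) simp
      then have "real (l choose t) \<le> (exp 1 / \<gamma>) ^ t"
        using t0 by (simp add: power_mult_distrib[symmetric] mult.assoc)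
      then have "real (l choose t) * (s / q) ^ t \<le> (exp 1 / \<gamma>) ^ t * (s / q) ^ t"
        using s q by (intro mult_right_mono) auto
      then show "real (l choose t) * (s / q) ^ t \<le> x ^ t"
        by (simp add: x(1) power_mult_distrib[symmetric] mult_ac)
    qed
    finally show "rexp X q (\<lambda>W. real (card {i\<in>I. card (frag I f W i) = t})) \<le> M * x ^ t" .
  qed
  also have "\<dots> \<le> (\<Sum>t\<in>{1..l}. M * x ^ t)"
    unfolding S_def using M x0 by (intro sum_mono2) auto
  also have "\<dots> = M * x * (\<Sum>t<l. x ^ t)"
  proof -
    have "(\<Sum>t\<in>{1..l}. M * x ^ t) = (\<Sum>t<l. M * x ^ Suc t)"
      by (rule sum.reindex_bij_witness[of _ Suc "\<lambda>t. t - 1"]) auto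
    then show ?thesis by (simp add: sum_distrib_left mult_ac)
  qed
  also have "\<dots> \<le> M * x * 2"
  proof (rule mult_left_mono)
    have "(\<Sum>t<l. x ^ t) \<le> (\<Sum>t<l. (1/2) ^ t)" using x0 x by (intro sum_mono power_mono) auto
    also have "\<dots> \<le> 2" by (simp add: geometric_sum)
    finally show "(\<Sum>t<l. x ^ t) \<le> 2" .
  qed (use M x0 in auto)
  finally show ?thesis by (simp add: mult_ac)
qed

section \<open>Iterated covering and amplification\<close>

lemma rexp_union_power:
  assumes "finite X"
  shows "rexp X a (\<lambda>W. rexp X (1 - (1 - b) ^ r) (\<lambda>W'. f (W \<union> W'))) = rexp X (1 - (1 - a) * (1 - b) ^ r) f"
  unfolding rexp_union[OF assms] by (simp add: algebra_simps)

text \<open>A round replaces the members by their fragments and discards those with fragments larger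
  than \<open>\<gamma> * L\<close>. Fragments are subsets, so the spread bound survives with the
  same \<open>M\<close>, which is not renormalised to the shrinking index set. Once the size bound
  drops below 1, any surviving member is empty, that is, fully covered. Each round loses at most
  \<open>2 * x * M\<close> members in expectation.\<close>

lemma spread_cover_rounds:
  fixes f :: "'i \<Rightarrow> 'a set"
  assumes X: "finite X" and M: "0 \<le> M" and s: "0 \<le> s" and q: "0 < q" "q \<le> 1"
    and \<gamma>: "0 < \<gamma>" and x: "x = exp 1 * (s / q) / \<gamma>" "x \<le> 1 / 2"
    and I: "finite I" "\<And>i. i \<in> I \<Longrightarrow> f i \<subseteq> X"
    and l: "\<And>i. i \<in> I \<Longrightarrow> real (card (f i)) \<le> L"
    and spread: "\<And>U. U \<subseteq> X \<Longrightarrow> real (card {i\<in>I. U \<subseteq> f i}) \<le> M * s ^ card U"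
    and L: "L * \<gamma> ^ r < 1"
  shows "real (card I) * rexp X (1 - (1 - q) ^ r) (\<lambda>W. of_bool (\<forall>i\<in>I. \<not> f i \<subseteq> W)) \<le> real r * (2 * x * M)"
  using I l spread L
proof (induction r arbitrary: I f L)
  case 0
  show ?case
  proof (cases "I = {}")
    case False
    then obtain i where i: "i \<in> I" by auto
    have "real (card (f i)) < 1" using "0.prems"(3)[OF i] "0.prems"(5) by simp
    then have "f i = {}" using "0.prems"(2)[OF i] X by (auto simp: finite_subset)
    then have "(\<lambda>W. of_bool (\<forall>i\<in>I. \<not> f i \<subseteq> W)) = (\<lambda>_. 0 :: real)" using i by (intro ext) auto
    then show ?thesis using X by (simp only: rexp_const)
  qed simp
next
  case (Suc r)
  note prems = Suc.prems
  let ?p = "1 - (1 - q) ^ r"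
  have p: "0 \<le> ?p" "?p \<le> 1" using q by (auto simp: power_le_one)
  let ?fail = "\<lambda>W'. of_bool (\<forall>i\<in>I. \<not> f i \<subseteq> W') :: real"
  have eq: "rexp X (1 - (1 - q) ^ Suc r) ?fail = rexp X q (\<lambda>W. rexp X ?p (\<lambda>W'. ?fail (W \<union> W')))"
    unfolding rexp_union_power[OF X, where f = ?fail] by simp
  have pt: "real (card I) * rexp X ?p (\<lambda>W'. ?fail (W \<union> W')) \<le>
     real (card {i\<in>I. real (card (frag I f W i)) > \<gamma> * L}) + real r * (2 * x * M)"
    if W: "W \<subseteq> X" for W
  proof -
    define J where "J = {i\<in>I. real (card (frag I f W i)) \<le> \<gamma> * L}"
    define B where "B = {i\<in>I. real (card (frag I f W i)) > \<gamma> * L}"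
    have JB: "I = B \<union> J" "B \<inter> J = {}" by (auto simp: J_def B_def)
    have card: "card I = card B + card J" using prems(1) JB by (metis card_Un_disjoint finite_Un)
    have J: "J \<subseteq> I" by (auto simp: J_def)
    let ?F = "\<lambda>W'. of_bool (\<forall>i\<in>J. \<not> frag I f W i \<subseteq> W') :: real"
    have IH: "real (card J) * rexp X ?p ?F \<le> real r * (2 * x * M)"
    proof (rule Suc.IH)
      show "finite J" using J prems(1) by (rule finite_subset)
      show "frag I f W i \<subseteq> X" if "i \<in> J" for i using frag(1)[of i I f W] prems(2) J that by blast
      show "real (card (frag I f W i)) \<le> \<gamma> * L" if "i \<in> J" for i using that by (auto simp: J_def)
      show "real (card {i\<in>J. U \<subseteq> frag I f W i}) \<le> M * s ^ card U" if U: "U \<subseteq> X" for U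
      proof -
        have "card {i\<in>J. U \<subseteq> frag I f W i} \<le> card {i\<in>I. U \<subseteq> f i}"
          using prems(1) J frag(1)[of _ I f W] by (intro card_mono) fastforce+
        then show ?thesis using prems(4)[OF U] by linarith
      qed
      show "\<gamma> * L * \<gamma> ^ r < 1" using prems(5) by (simp add: mult_ac)
    qed
    have fF: "?fail (W \<union> W') \<le> ?F W'" for W'
    proof -
      have "\<exists>j\<in>I. f j \<subseteq> W \<union> W'" if i: "i \<in> J" "frag I f W i \<subseteq> W'" for i
        using frag(3)[of i I f W] i J by blast
      then show ?thesis by auto
    qed
    have a: "rexp X ?p (\<lambda>W'. ?fail (W \<union> W')) \<le> 1"
    proof -
      have "rexp X ?p (\<lambda>W'. ?fail (W \<union> W')) \<le> rexp X ?p (\<lambda>_. 1)" using p by (intro rexp_mono) auto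
      then show ?thesis using X by (simp add: rexp_const)
    qed
    have b: "rexp X ?p (\<lambda>W'. ?fail (W \<union> W')) \<le> rexp X ?p ?F" using p fF by (intro rexp_mono) auto
    \<comment> \<open>A discarded member is charged the trivial failure probability 1, so only the
      expected number of discarded members enters.\<close>
    have "real (card I) * rexp X ?p (\<lambda>W'. ?fail (W \<union> W')) = real (card B) * rexp X ?p (\<lambda>W'. ?fail (W \<union> W'))
       + real (card J) * rexp X ?p (\<lambda>W'. ?fail (W \<union> W'))" by (simp add: card algebra_simps)
    also have "\<dots> \<le> real (card B) * 1 + real (card J) * rexp X ?p ?F"
      using a b by (intro add_mono mult_left_mono) auto
    also have "\<dots> \<le> real (card B) + real r * (2 * x * M)" using IH by simp
    finally show ?thesis unfolding B_def .
  qed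
  have "real (card I) * rexp X (1 - (1 - q) ^ Suc r) ?fail
      = rexp X q (\<lambda>W. real (card I) * rexp X ?p (\<lambda>W'. ?fail (W \<union> W')))"
    unfolding eq rexp_cmult ..
  also have "\<dots> \<le> rexp X q (\<lambda>W. real (card {i\<in>I. real (card (frag I f W i)) > \<gamma> * L}) + real r * (2 * x * M))"
    using pt q by (intro rexp_mono) auto
  also have "\<dots> = rexp X q (\<lambda>W. real (card {i\<in>I. real (card (frag I f W i)) > \<gamma> * L})) + real r * (2 * x * M)"
    using X by (simp add: rexp_add rexp_const)
  also have "\<dots> \<le> 2 * x * M + real r * (2 * x * M)"
    using frag_tail[OF X prems(1,2,3,4) M s q \<gamma> x] by simp
  finally show ?case by (simp add: algebra_simps)
qed

text \<open>If a decreasing property holds for a union of \<open>n\<close> independent sets, it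
  holds for each of them, and independence multiplies the probabilities.\<close>

lemma rexp_decreasing_power:
  fixes P :: "'a set \<Rightarrow> bool"
  assumes X: "finite X" and q: "0 \<le> q" "q \<le> 1"
    and P: "\<And>W W'. W \<subseteq> W' \<Longrightarrow> P W' \<Longrightarrow> P W"
  shows "rexp X (1 - (1 - q) ^ n) (\<lambda>W. of_bool (P W)) \<le> rexp X q (\<lambda>W. of_bool (P W)) ^ n"
proof (induction n)
  case 0
  have "rexp X 0 (\<lambda>W. of_bool (P W)) \<le> rexp X 0 (\<lambda>_. 1)" by (intro rexp_mono) auto
  then show ?case using X by (simp add: rexp_const)
next
  case (Suc n)
  let ?p = "1 - (1 - q) ^ n"
  let ?E = "\<lambda>p. rexp X p (\<lambda>W. of_bool (P W))"
  have p: "0 \<le> ?p" "?p \<le> 1" using q by (auto simp: power_le_one)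
  have "?E (1 - (1 - q) ^ Suc n) = rexp X q (\<lambda>W. rexp X ?p (\<lambda>W'. of_bool (P (W \<union> W'))))"
    unfolding rexp_union_power[OF X, where f = "\<lambda>W. of_bool (P W)"] by simp
  also have "\<dots> \<le> rexp X q (\<lambda>W. rexp X ?p (\<lambda>W'. of_bool (P W) * of_bool (P W')))"
    using q p P by (intro rexp_mono) (auto simp: of_bool_def dest: P[rotated])
  also have "\<dots> = ?E ?p * ?E q"
    unfolding rexp_cmult by (simp add: mult.commute[of _ "?E ?p"] rexp_cmult)
  also have "\<dots> \<le> ?E q ^ n * ?E q"
    using Suc.IH q by (intro mult_right_mono rexp_nonneg) auto
  finally show ?case by (simp add: mult_ac)
qed

text \<open>Repeating the cover rounds \<^term>\<open>n\<close> times turns a polynomially small failure probability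
  into a superpolynomially small one.\<close>

lemma spread_cover:
  fixes f :: "'i \<Rightarrow> 'a set"
  assumes X: "finite X" and s: "0 \<le> s" and q: "0 < q" "q \<le> 1"
    and \<gamma>: "0 < \<gamma>" and x: "x = exp 1 * (s / q) / \<gamma>" "x \<le> 1 / 2"
    and I: "finite I" "I \<noteq> {}" "\<And>i. i \<in> I \<Longrightarrow> f i \<subseteq> X"
    and l: "\<And>i. i \<in> I \<Longrightarrow> real (card (f i)) \<le> L"
    and spread: "\<And>U. U \<subseteq> X \<Longrightarrow> real (card {i\<in>I. U \<subseteq> f i}) \<le> real (card I) * s ^ card U"
    and L: "L * \<gamma> ^ r < 1"
    and p: "real (r * n) * q \<le> p" "p \<le> 1"
  shows "rexp X p (\<lambda>W. of_bool (\<forall>i\<in>I. \<not> f i \<subseteq> W)) \<le> (2 * real r * x) ^ n"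
proof -
  let ?P = "\<lambda>W. \<forall>i\<in>I. \<not> f i \<subseteq> W"
  have mono: "\<And>W W'. W \<subseteq> W' \<Longrightarrow> ?P W' \<Longrightarrow> ?P W" by blast
  have qr: "0 \<le> 1 - (1 - q) ^ r" "1 - (1 - q) ^ r \<le> 1" using q by (auto simp: power_le_one)
  have "real (card I) * rexp X (1 - (1 - q) ^ r) (\<lambda>W. of_bool (?P W)) \<le> real r * (2 * x * real (card I))"
    using spread_cover_rounds[OF X _ s q \<gamma> x I(1,3) l spread L] by simp
  also have "\<dots> = real (card I) * (2 * real r * x)" by simp
  finally have one: "rexp X (1 - (1 - q) ^ r) (\<lambda>W. of_bool (?P W)) \<le> 2 * real r * x"
    using I by (simp add: card_gt_0_iff)
  \<comment> \<open>By Bernoulli's inequality, \<open>r * n\<close> rounds of density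
    \<open>q\<close> together have density at most \<open>r * n * q\<close>.\<close>
  have bern: "1 - (1 - q) ^ (r * n) \<le> p"
    using Bernoulli_inequality[of "- q" "r * n"] q p by simp
  have "rexp X (1 - (1 - q) ^ (r * n)) (\<lambda>W. - 1 * of_bool (?P W)) \<le> rexp X p (\<lambda>W. - 1 * of_bool (?P W))"
    using bern p q mono by (intro rexp_mono_prob[OF X]) (auto simp: power_le_one of_bool_def)
  then have "rexp X p (\<lambda>W. of_bool (?P W)) \<le> rexp X (1 - (1 - q) ^ (r * n)) (\<lambda>W. of_bool (?P W))"
    unfolding rexp_cmult by simp
  also have "(1 - q) ^ (r * n) = (1 - (1 - (1 - q) ^ r)) ^ n" by (simp add: power_mult)
  also have "rexp X (1 - (1 - (1 - (1 - q) ^ r)) ^ n) (\<lambda>W. of_bool (?P W)) \<le>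
     rexp X (1 - (1 - q) ^ r) (\<lambda>W. of_bool (?P W)) ^ n"
    using rexp_decreasing_power[OF X qr, of ?P] mono by blast
  also have "\<dots> \<le> (2 * real r * x) ^ n"
    using one qr by (intro power_mono rexp_nonneg) auto
  finally show ?thesis .
qed

section \<open>Random factors are spread\<close>

text \<open>The falling factorial \<open>m! / (m - u)!\<close> is \<open>u!\<close> times a binomial
  coefficient, hence at least \<open>(u / e)^u (m / u)^u = (m / e)^u\<close>.\<close>

lemma fact_diff_le:
  assumes "u \<le> m" "0 < m"
  shows "(fact (m - u) :: real) \<le> fact m * (exp 1 / real m) ^ u"
proof -
  have "(real u / exp 1) ^ u * (real m / real u) ^ u \<le> fact u * real (m choose u)"
    using fact_ge_power[of u] binomial_ge_n_over_k_pow_k[OF assms(1), where 'a = real]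
    by (intro mult_mono) auto
  moreover have "(real u / exp 1) ^ u * (real m / real u) ^ u = (real m / exp 1) ^ u"
    by (cases "u = 0") (auto simp: power_mult_distrib[symmetric])
  ultimately have "(real m / exp 1) ^ u \<le> fact u * real (m choose u)" by simp
  then have "(fact (m - u) :: real) * (real m / exp 1) ^ u \<le> fact (m - u) * (fact u * real (m choose u))"
    by (intro mult_left_mono) auto
  also have "\<dots> = fact m"
    using binomial_fact[OF assms(1), where 'a = real] by simp
  finally have "(fact (m - u) :: real) * (real m / exp 1) ^ u * (exp 1 / real m) ^ u \<le> fact m * (exp 1 / real m) ^ u"
    by (intro mult_right_mono) auto
  then show ?thesis using assms by (simp add: mult.assoc power_mult_distrib[symmetric])
qed

definition injections :: "'a set \<Rightarrow> nat \<Rightarrow> ('a \<Rightarrow> nat) set" where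
  "injections A m = {g \<in> A \<rightarrow>\<^sub>E {..<m}. inj_on g A}"

lemma prod_diff_fact: "(\<Prod>i\<in>{0..<n}. n - i) = (fact n :: nat)"
  by (simp add: fact_prod_rev)

lemma finite_injections: "finite A \<Longrightarrow> finite (injections A m)"
  unfolding injections_def by (rule finite_subset[OF _ finite_PiE[of A "\<lambda>_. {..<m}"]]) auto

lemma card_injections:
  assumes "finite A" "card A = m"
  shows "card (injections A m) = fact m"
  unfolding injections_def using card_inj_on_subset_funcset[OF assms(1) finite_lessThan order_refl, of m] assms
  by (simp add: prod_diff_fact)

text \<open>If some injection extends the prescription \<open>a\<close>, then \<open>a\<close> takes
  \<open>card S\<close> distinct values on \<open>S\<close>, and off \<open>S\<close> every
  extension is an injection into the remaining \<open>m - card S\<close> values. Otherwise the count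
  is 0.\<close>

lemma card_injections_extending:
  assumes A: "finite A" "card A = m" and S: "S \<subseteq> A"
  shows "card {g \<in> injections A m. \<forall>x\<in>S. g x = a x} \<le> fact (m - card S)"
proof (cases "{g \<in> injections A m. \<forall>x\<in>S. g x = a x} = {}")
  case False
  then obtain g0 where g0: "g0 \<in> injections A m" "\<forall>x\<in>S. g0 x = a x" by auto
  have inj_a: "inj_on a S" using g0 S unfolding injections_def inj_on_def by (auto simp: subset_iff)
  have aS: "a ` S \<subseteq> {..<m}"
  proof
    fix z assume "z \<in> a ` S"
    then obtain x where x: "x \<in> S" "z = g0 x" using g0(2) by auto
    then have "x \<in> A" using S by auto
    then show "z \<in> {..<m}" using g0(1) x by (auto simp: injections_def)
  qed
  have cS: "card S \<le> m" using A S card_mono by blast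
  define C where "C = {..<m} - a ` S"
  have C: "finite C" "card C = m - card S"
    unfolding C_def using aS by (auto simp: card_Diff_subset card_image[OF inj_a] finite_subset[OF S A(1)])
  have AS: "finite (A - S)" "card (A - S) = m - card S"
    using A S by (auto simp: card_Diff_subset finite_subset)
  have "card {g \<in> injections A m. \<forall>x\<in>S. g x = a x} \<le> card {f \<in> (A - S) \<rightarrow>\<^sub>E C. inj_on f (A - S)}"
  proof (rule card_inj_on_le)
    show "inj_on (\<lambda>g. restrict g (A - S)) {g \<in> injections A m. \<forall>x\<in>S. g x = a x}"
    proof (rule inj_onI)
      fix g h assume g: "g \<in> {g \<in> injections A m. \<forall>x\<in>S. g x = a x}"
        and h: "h \<in> {g \<in> injections A m. \<forall>x\<in>S. g x = a x}"
        and eq: "restrict g (A - S) = restrict h (A - S)"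
      have "g x = h x" if "x \<in> A" for x
      proof (cases "x \<in> S")
        case False
        then show ?thesis using fun_cong[OF eq, of x] that by simp
      qed (use g h in auto)
      moreover have "g \<in> extensional A" "h \<in> extensional A" using g h by (auto simp: injections_def PiE_def)
      ultimately show "g = h" by (auto intro: extensionalityI)
    qed
    show "(\<lambda>g. restrict g (A - S)) ` {g \<in> injections A m. \<forall>x\<in>S. g x = a x} \<subseteq> {f \<in> (A - S) \<rightarrow>\<^sub>E C. inj_on f (A - S)}"
    proof
      fix f assume "f \<in> (\<lambda>g. restrict g (A - S)) ` {g \<in> injections A m. \<forall>x\<in>S. g x = a x}"
      then obtain g where f: "f = restrict g (A - S)" and g: "g \<in> injections A m" "\<forall>x\<in>S. g x = a x" by auto
      have inj: "inj_on g A" using g by (simp add: injections_def)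
      have gA: "g x < m" if "x \<in> A" for x using g that by (auto simp: injections_def)
      have "g x \<in> C" if x: "x \<in> A - S" for x
      proof -
        have "g x \<notin> a ` S"
        proof
          assume "g x \<in> a ` S"
          then obtain y where y: "y \<in> S" "g x = g y" using g(2) by auto
          then show False using inj_onD[OF inj y(2)] x S by auto
        qed
        then show ?thesis using gA x by (auto simp: C_def)
      qed
      then show "f \<in> {f \<in> (A - S) \<rightarrow>\<^sub>E C. inj_on f (A - S)}"
        unfolding f using inj by (auto simp: inj_on_def)
    qed
    show "finite {f \<in> (A - S) \<rightarrow>\<^sub>E C. inj_on f (A - S)}"
      by (rule finite_subset[OF _ finite_PiE[OF AS(1) C(1)]]) auto
  qed
  also have "\<dots> = fact (m - card S)"
    using card_inj_on_subset_funcset[OF AS(1) C(1) order_refl] unfolding AS(2) C(2) prod_diff_fact by simp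
  finally show ?thesis .
next
  case True
  show ?thesis unfolding True by simp
qed

text \<open>\<open>\<delta>\<close> bounds the density of every vertex set with at least two
  elements, and at singletons the bound says that there are no edges. The collapsed multigraph will
  satisfy this with some \<open>\<delta> < m(H)\<close>.\<close>

locale sparse_mgraph =
  fixes K :: "('v, 'e) mgraph" and \<delta> :: real
  assumes fin: "finite (verts K)" "finite (edges K)"
    and ne: "verts K \<noteq> {}"
    and ends: "\<And>e. e \<in> edges K \<Longrightarrow> ends K e \<subseteq> verts K" "\<And>e. e \<in> edges K \<Longrightarrow> card (ends K e) = 2"
    and \<delta>: "0 < \<delta>"
    and sparse: "\<And>S. S \<subseteq> verts K \<Longrightarrow> S \<noteq> {} \<Longrightarrow>
      real (card {e \<in> edges K. ends K e \<subseteq> S}) \<le> \<delta> * (real (card S) - 1)"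
begin

text \<open>A transversal is a function choosing a vertex from each part; the potential edges of the copy
  of \<^term>\<open>K\<close> on it are \<open>copy_edges\<close>. A factor is a set of transversals, and a labelling is a factor
  together with an enumeration of its members: it maps each vertex to the index of its transversal.\<close>

definition copy_edges :: "('v \<Rightarrow> nat) \<Rightarrow> ('e \<times> ('v \<times> nat) set) set" where
  "copy_edges \<phi> = (\<lambda>e. (e, (\<lambda>y. (y, \<phi> y)) ` ends K e)) ` edges K"

definition factors :: "('e \<times> ('v \<times> nat) set) set \<Rightarrow> ('v \<Rightarrow> nat set) \<Rightarrow> ('v \<Rightarrow> nat) set set" where
  "factors W R = {P. P \<subseteq> PiE (verts K) R \<and> (\<forall>y\<in>verts K. bij_betw (\<lambda>\<phi>. \<phi> y) P (R y)) \<and>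
     (\<forall>\<phi>\<in>P. copy_edges \<phi> \<subseteq> W)}"

definition labellings :: "('v \<Rightarrow> nat set) \<Rightarrow> nat \<Rightarrow> ('v \<Rightarrow> nat \<Rightarrow> nat) set" where
  "labellings R m = PiE (verts K) (\<lambda>y. injections (R y) m)"

text \<open>The potential edges whose end-vertices carry a common label: the union of the copies of
  \<open>K\<close> on the transversals of the factor. Sampling labellings instead of factors repeats
  each factor equally often and makes all counts products of factorials.\<close>

definition label_edges :: "('v \<Rightarrow> nat set) \<Rightarrow> ('v \<Rightarrow> nat \<Rightarrow> nat) \<Rightarrow> ('e \<times> ('v \<times> nat) set) set" where
  "label_edges R l = {(e, s). e \<in> edges K \<and> s \<subseteq> Sigma (verts K) R \<and> bij_betw fst s (ends K e) \<and>
     (\<exists>j. \<forall>z\<in>s. l (fst z) (snd z) = j)}"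

section \<open>Spread of a uniformly random labelling\<close>

lemma ends_ne: "e \<in> edges K \<Longrightarrow> ends K e \<noteq> {}"
  using ends(2)[of e] by auto

lemma labelling_inj:
  assumes "l \<in> labellings R m" "y \<in> verts K" "x \<in> R y" "x' \<in> R y" "l y x = l y x'"
  shows "x = x'"
proof -
  have "l y \<in> injections (R y) m" using assms(1,2) unfolding labellings_def by auto
  then have "inj_on (l y) (R y)" unfolding injections_def by simp
  then show ?thesis using assms(3-5) by (simp add: inj_on_eq_iff)
qed

lemma labelling_less:
  assumes "l \<in> labellings R m" "y \<in> verts K" "x \<in> R y"
  shows "l y x < m"
proof -
  have "l y \<in> injections (R y) m" using assms unfolding labellings_def by auto
  then show ?thesis using assms(3) unfolding injections_def by auto
qed

text \<open>A part has at most one vertex of each label, so an edge is determined by the underlying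
  edge of \<open>K\<close> and the common label of its ends.\<close>

lemma card_label_edges_le:
  assumes l: "l \<in> labellings R m"
  shows "finite (label_edges R l)" "card (label_edges R l) \<le> card (edges K) * m"
proof -
  let ?g = "\<lambda>(e, j). (e, {(y, x). y \<in> ends K e \<and> x \<in> R y \<and> l y x = j})"
  have sub: "label_edges R l \<subseteq> ?g ` (edges K \<times> {..<m})"
  proof
    fix z assume "z \<in> label_edges R l"
    then obtain e s j where z: "z = (e, s)" and e: "e \<in> edges K" "s \<subseteq> Sigma (verts K) R"
      and b: "bij_betw fst s (ends K e)" and j: "\<forall>z\<in>s. l (fst z) (snd z) = j"
      unfolding label_edges_def by blast
    have im: "fst ` s = ends K e" using b by (rule bij_betw_imp_surj_on)
    have s: "s = {(y, x). y \<in> ends K e \<and> x \<in> R y \<and> l y x = j}"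
    proof (intro equalityI subsetI)
      fix w assume "w \<in> s"
      then have "fst w \<in> ends K e" "w \<in> Sigma (verts K) R" "l (fst w) (snd w) = j"
        unfolding im[symmetric] using e(2) j by auto
      then show "w \<in> {(y, x). y \<in> ends K e \<and> x \<in> R y \<and> l y x = j}" by (cases w) auto
    next
      fix w assume "w \<in> {(y, x). y \<in> ends K e \<and> x \<in> R y \<and> l y x = j}"
      then obtain y x where w: "w = (y, x)" "y \<in> ends K e" "x \<in> R y" "l y x = j" by auto
      then have "y \<in> fst ` s" using im by simp
      then obtain x' where x': "(y, x') \<in> s" by auto
      then have "x' \<in> R y" "l y x' = j" "y \<in> verts K" using e(2) j by auto
      then have "x = x'" using labelling_inj[OF l] w by auto
      then show "w \<in> s" using x' w by simp
    qed
    have "s \<noteq> {}" using im ends_ne[OF e(1)] by blast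
    then obtain w where w: "w \<in> s" by (meson ex_in_conv)
    then have "w \<in> Sigma (verts K) R" "l (fst w) (snd w) = j" using e(2) j by auto
    then have "j < m" using labelling_less[OF l, of "fst w" "snd w"] by (cases w) auto
    then have "(e, j) \<in> edges K \<times> {..<m}" using e by auto
    moreover have "z = ?g (e, j)" using z s by simp
    ultimately show "z \<in> ?g ` (edges K \<times> {..<m})" by (rule rev_image_eqI)
  qed
  then show "finite (label_edges R l)" using fin by (auto intro: finite_subset)
  have "card (label_edges R l) \<le> card (?g ` (edges K \<times> {..<m}))"
    using sub fin by (intro card_mono) auto
  also have "\<dots> \<le> card (edges K \<times> {..<m})" using fin by (intro card_image_le) auto
  finally show "card (label_edges R l) \<le> card (edges K) * m" using fin by (simp add: card_cartesian_product)
qed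

lemma card_labellings:
  assumes "\<And>y. y \<in> verts K \<Longrightarrow> finite (R y)" "\<And>y. y \<in> verts K \<Longrightarrow> card (R y) = m"
  shows "card (labellings R m) = (\<Prod>y\<in>verts K. fact m)"
  unfolding labellings_def using fin assms by (simp add: card_PiE card_injections)

lemma finite_labellings:
  assumes "\<And>y. y \<in> verts K \<Longrightarrow> finite (R y)"
  shows "finite (labellings R m)"
  unfolding labellings_def using fin(1) finite_injections[OF assms] by (rule finite_PiE)

text \<open>A labelling whose edges include \<open>U\<close> is constant on the components of
  \<open>U\<close>. With \<open>v\<close> vertices in \<open>c\<close> components there are at most
  \<open>m^c\<close> choices of component labels, and each leaves a fraction of at most
  \<open>(e / m)^v\<close> of all labellings. Sparsity within each component gives
  \<open>card U \<le> \<delta> (v - c)\<close>, which converts the saving \<open>m^(v - c)\<close>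
  into a power of \<open>card U\<close>.\<close>

lemma label_edges_spread:
  assumes R: "\<And>y. y \<in> verts K \<Longrightarrow> finite (R y)" "\<And>y. y \<in> verts K \<Longrightarrow> card (R y) = m"
    and m: "exp 2 \<le> real m" and U: "finite U"
  shows "real (card {l \<in> labellings R m. U \<subseteq> label_edges R l}) \<le>
    real (card (labellings R m)) * ((exp 2 / real m) powr (1 / \<delta>)) ^ card U"
proof (cases "{l \<in> labellings R m. U \<subseteq> label_edges R l} = {}")
  case True
  show ?thesis unfolding True by simp
next
  case False
  \<comment> \<open>One labelling compatible with \<open>U\<close> shows that each component of
    \<open>U\<close> meets every part at most once, so components project injectively into
    \<open>K\<close>, where \<open>sparse\<close> applies.\<close>
  then obtain l0 where l0: "l0 \<in> labellings R m" "U \<subseteq> label_edges R l0" by auto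
  have m0: "0 < m" using m by (metis exp_gt_zero gr0I not_le of_nat_0)
  have UE: "e \<in> edges K" "s \<subseteq> Sigma (verts K) R" "bij_betw fst s (ends K e)" "card s = 2" "finite s"
    if "(e, s) \<in> U" for e s
  proof -
    show 1: "e \<in> edges K" "s \<subseteq> Sigma (verts K) R" "bij_betw fst s (ends K e)"
      using that l0 unfolding label_edges_def by auto
    show "card s = 2" using bij_betw_same_card[OF 1(3)] ends(2)[OF 1(1)] by simp
    then show "finite s" using card.infinite by fastforce
  qed
  have sU: "s \<in> snd ` U" if "(e, s) \<in> U" for e s
    using that by (rule rev_image_eqI) simp
  define S0 where "S0 = \<Union> (snd ` U)"
  have S0: "finite S0" "S0 \<subseteq> Sigma (verts K) R"
    using U UE(2,5) unfolding S0_def by (auto simp: subset_iff split_paired_all)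
  \<comment> \<open>Vertices are related if they lie in a common edge of \<open>U\<close>; the
    classes of the transitive closure are the components of \<open>U\<close>, none of them a single
    vertex.\<close>
  define rel where "rel = (\<Union>s\<in>snd ` U. s \<times> s)"
  define r where "r = rel\<^sup>+"
  have rel_S0: "rel \<subseteq> S0 \<times> S0" unfolding rel_def S0_def by auto
  then have r_S0: "r \<subseteq> S0 \<times> S0" unfolding r_def by (rule trancl_subset_Sigma)
  have eq: "equiv S0 r"
  proof (rule equivI)
    show "r \<subseteq> S0 \<times> S0" by (rule r_S0)
    show "refl_on S0 r" unfolding refl_on_def r_def using r_S0 by (auto simp: rel_def S0_def)
    have "sym rel" unfolding rel_def sym_def by auto
    then show "sym r" unfolding r_def by (rule sym_trancl)
    show "trans r" unfolding r_def by (rule trans_trancl)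
  qed
  define lab where "lab l z = l (fst z) (snd z)" for l :: "'v \<Rightarrow> nat \<Rightarrow> nat" and z
  have const: "lab l a = lab l b" if "U \<subseteq> label_edges R l" "(a, b) \<in> r" for l a b
  proof -
    have *: "lab l a = lab l b" if ab: "(a, b) \<in> rel" for a b
    proof -
      obtain z where z: "z \<in> U" "a \<in> snd z" "b \<in> snd z" using ab unfolding rel_def by blast
      obtain e s where s: "(e, s) \<in> U" "a \<in> s" "b \<in> s" using z by (cases z) auto
      then have "(e, s) \<in> label_edges R l" using \<open>U \<subseteq> label_edges R l\<close> by auto
      then show ?thesis using s unfolding label_edges_def lab_def by auto
    qed
    show ?thesis using that(2) unfolding r_def
    proof (induction rule: trancl_induct)
      case (base y)
      then show ?case by (rule *)
    next
      case (step y z)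
      then show ?case using *[of y z] by simp
    qed
  qed
  define Q where "Q = S0 // r"
  have Q: "finite Q" unfolding Q_def quotient_def using S0 by auto
  have UQ: "\<Union> Q = S0" unfolding Q_def by (rule Union_quotient[OF eq])
  have disj: "pairwise disjnt Q"
  proof (rule pairwiseI)
    fix C D assume "C \<in> Q" "D \<in> Q" "C \<noteq> D"
    then show "disjnt C D" using quotient_disj[OF eq, of C D] by (auto simp: Q_def disjnt_def)
  qed
  have Csub: "C \<subseteq> S0" if "C \<in> Q" for C using UQ that by (metis Union_upper)
  have Cfin: "finite C" if "C \<in> Q" for C using Csub[OF that] S0(1) by (rule finite_subset)
  have Uclass: "\<exists>C\<in>Q. s \<subseteq> C" if s: "(e, s) \<in> U" for e s
  proof -
    have "s \<noteq> {}" using UE(4)[OF s] by auto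
    then obtain a where a: "a \<in> s" by auto
    have "s \<times> s \<subseteq> rel" unfolding rel_def using sU[OF s] by (rule UN_upper)
    then have "{a} \<times> s \<subseteq> rel" using a by auto
    then have "s \<subseteq> r `` {a}" unfolding r_def by auto
    moreover have "a \<in> S0" unfolding S0_def using sU[OF s] a by (rule UnionI)
    then have "r `` {a} \<in> Q" unfolding Q_def by (rule quotientI)
    ultimately show ?thesis by (intro bexI[of _ "r `` {a}"])
  qed
  have Cge2: "2 \<le> card C" if C: "C \<in> Q" for C
  proof -
    obtain a where a: "C = r `` {a}" "a \<in> S0" using C unfolding Q_def by (rule quotientE)
    then obtain e s where s: "(e, s) \<in> U" "a \<in> s" unfolding S0_def by (auto simp: split_paired_all)
    have "s \<times> s \<subseteq> rel" unfolding rel_def using sU[OF s(1)] by (rule UN_upper)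
    then have "{a} \<times> s \<subseteq> rel" using s(2) by auto
    then have "s \<subseteq> C" unfolding a(1) r_def by auto
    then have "card s \<le> card C" by (rule card_mono[OF Cfin[OF C]])
    then show ?thesis using UE(4)[OF s(1)] by simp
  qed
  define v where "v = card S0"
  define c where "c = card Q"
  have vsum: "v = (\<Sum>C\<in>Q. card C)"
    unfolding v_def UQ[symmetric] using disj Cfin by (intro card_Union_disjoint) auto
  have v2c: "2 * c \<le> v"
    unfolding vsum c_def using sum_mono[of Q "\<lambda>_. 2" card] Cge2 by simp
  have cardU: "real (card U) \<le> \<delta> * real (v - c)"
  proof -
    define UC where "UC C = {z \<in> U. snd z \<subseteq> C}" for C
    have "U \<subseteq> (\<Union>C\<in>Q. UC C)"
    proof
      fix z assume "z \<in> U"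
      then show "z \<in> (\<Union>C\<in>Q. UC C)" using Uclass[of "fst z" "snd z"] unfolding UC_def by auto
    qed
    then have "card U \<le> card (\<Union>C\<in>Q. UC C)" using Q U by (intro card_mono) (auto simp: UC_def)
    also have "\<dots> \<le> (\<Sum>C\<in>Q. card (UC C))" by (rule card_UN_le[OF Q])
    finally have "real (card U) \<le> (\<Sum>C\<in>Q. real (card (UC C)))" unfolding of_nat_sum[symmetric] of_nat_le_iff .
    also have "\<dots> \<le> (\<Sum>C\<in>Q. \<delta> * (real (card C) - 1))"
    proof (rule sum_mono)
      fix C assume C: "C \<in> Q"
      have CV: "C \<subseteq> Sigma (verts K) R" using Csub[OF C] S0 by auto
      have lc: "lab l0 a = lab l0 b" if "a \<in> C" "b \<in> C" for a b
      proof -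
        have "(a, b) \<in> r" using quotient_eq_iff[OF eq, of C C a b] C that unfolding Q_def by simp
        then show ?thesis by (rule const[OF l0(2)])
      qed
      have injC: "inj_on fst C"
      proof (rule inj_onI)
        fix a b assume ab: "a \<in> C" "b \<in> C" "fst a = fst b"
        have "a \<in> Sigma (verts K) R" "b \<in> Sigma (verts K) R" using CV ab by auto
        then have "snd a = snd b"
          using labelling_inj[OF l0(1), of "fst a" "snd a" "snd b"] ab(3) lc[OF ab(1,2)]
          by (cases a, cases b) (auto simp: lab_def)
        then show "a = b" using ab by (simp add: prod_eq_iff)
      qed
      have inj: "inj_on fst (UC C)"
      proof (rule inj_onI)
        fix z w assume zw: "z \<in> UC C" "w \<in> UC C" "fst z = fst w"
        obtain e s s' where es: "z = (e, s)" "w = (e, s')" using zw(3) by (cases z, cases w) auto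
        have U2: "(e, s) \<in> U" "(e, s') \<in> U" "s \<subseteq> C" "s' \<subseteq> C" using zw es by (auto simp: UC_def)
        have "fst ` s = fst ` s'" using UE(3)[OF U2(1)] UE(3)[OF U2(2)] by (simp add: bij_betw_def)
        then have "s = s'" using inj_on_image_eq_iff[OF injC U2(3,4)] by simp
        then show "z = w" using es by simp
      qed
      have "fst ` UC C \<subseteq> {e \<in> edges K. ends K e \<subseteq> fst ` C}"
      proof
        fix e assume "e \<in> fst ` UC C"
        then obtain s where s: "(e, s) \<in> U" "s \<subseteq> C" unfolding UC_def by auto
        then show "e \<in> {e \<in> edges K. ends K e \<subseteq> fst ` C}"
          using UE(1,3)[OF s(1)] image_mono[OF s(2), of fst] by (auto simp: bij_betw_def)
      qed
      then have "card (fst ` UC C) \<le> card {e \<in> edges K. ends K e \<subseteq> fst ` C}"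
        using fin by (intro card_mono) auto
      then have "real (card (UC C)) \<le> real (card {e \<in> edges K. ends K e \<subseteq> fst ` C})"
        using card_image[OF inj] by simp
      also have "\<dots> \<le> \<delta> * (real (card (fst ` C)) - 1)"
        using CV Cge2[OF C] by (intro sparse) auto
      also have "card (fst ` C) = card C" by (rule card_image[OF injC])
      finally show "real (card (UC C)) \<le> \<delta> * (real (card C) - 1)" .
    qed
    also have "\<dots> = \<delta> * (real v - real c)"
      unfolding vsum c_def by (simp add: sum_distrib_left[symmetric] sum_subtractf)
    finally show ?thesis using v2c by (simp add: of_nat_diff)
  qed
  define Sy where "Sy y = {x. (y, x) \<in> S0}" for y
  have Sy: "Sy y \<subseteq> R y" for y using S0 by (auto simp: Sy_def)
  have Sym: "card (Sy y) \<le> m" if "y \<in> verts K" for y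
    using card_mono[OF R(1)[OF that] Sy] R(2)[OF that] by simp
  have S0Sig: "S0 = Sigma (verts K) Sy" using S0 by (auto simp: Sy_def)
  have Syf: "finite (Sy y)" if "y \<in> verts K" for y using Sy R(1)[OF that] finite_subset by blast
  have vSy: "v = (\<Sum>y\<in>verts K. card (Sy y))"
    unfolding v_def S0Sig using fin Syf by (simp add: card_SigmaI)
  \<comment> \<open>\<open>g\<close> assigns a label to each component; \<open>Ext g\<close>
    contains the labellings that take these values on \<open>S0\<close> and are free
    elsewhere.\<close>
  define Ext where "Ext g = PiE (verts K) (\<lambda>y. {f \<in> injections (R y) m. \<forall>x\<in>Sy y. f x = g (r `` {(y, x)})})" for g
  have "finite {f \<in> injections (R y) m. \<forall>x\<in>Sy y. f x = g (r `` {(y, x)})}" if "y \<in> verts K" for g y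
    using finite_injections[OF R(1)[OF that], of m] by (rule finite_subset[rotated]) auto
  then have finExt: "finite (Ext g)" for g
    unfolding Ext_def using fin(1) by (intro finite_PiE)
  have "{l \<in> labellings R m. U \<subseteq> label_edges R l} \<subseteq> (\<Union>g\<in>Q \<rightarrow>\<^sub>E {..<m}. Ext g)"
  proof
    fix l assume "l \<in> {l \<in> labellings R m. U \<subseteq> label_edges R l}"
    then have l: "l \<in> labellings R m" "U \<subseteq> label_edges R l" by auto
    define g where "g = (\<lambda>C\<in>Q. lab l (SOME z. z \<in> C))"
    have gC: "g C = lab l z" if "C \<in> Q" "z \<in> C" for C z
    proof -
      have "(SOME z. z \<in> C) \<in> C" using that(2) by (rule someI)
      then have "((SOME z. z \<in> C), z) \<in> r" using quotient_eq_iff[OF eq, of C C] that unfolding Q_def by auto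
      then show ?thesis using const[OF l(2)] that by (simp add: g_def)
    qed
    have "g \<in> Q \<rightarrow>\<^sub>E {..<m}"
    proof (rule PiE_I)
      fix C assume C: "C \<in> Q"
      have "C \<noteq> {}" using Cge2[OF C] by auto
      then obtain z where z: "z \<in> C" by auto
      have "z \<in> Sigma (verts K) R" using Csub[OF C] S0 z by auto
      then have "lab l z < m" using labelling_less[OF l(1), of "fst z" "snd z"] by (auto simp: lab_def)
      then show "g C \<in> {..<m}" using gC[OF C z] by simp
    qed (simp add: g_def)
    moreover have "l \<in> Ext g"
      unfolding Ext_def
    proof (rule PiE_I)
      fix y assume y: "y \<in> verts K"
      have "l y x = g (r `` {(y, x)})" if x: "x \<in> Sy y" for x
      proof -
        have xS: "(y, x) \<in> S0" using x by (simp add: Sy_def)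
        then have "r `` {(y, x)} \<in> Q" "(y, x) \<in> r `` {(y, x)}"
          unfolding Q_def using equiv_class_self[OF eq] by (auto intro: quotientI)
        then show ?thesis using gC by (simp add: lab_def)
      qed
      then show "l y \<in> {f \<in> injections (R y) m. \<forall>x\<in>Sy y. f x = g (r `` {(y, x)})}"
        using l(1) y by (auto simp: labellings_def)
    next
      fix y assume "y \<notin> verts K"
      then show "l y = undefined" using l(1) by (auto simp: labellings_def)
    qed
    ultimately show "l \<in> (\<Union>g\<in>Q \<rightarrow>\<^sub>E {..<m}. Ext g)" by blast
  qed
  then have "card {l \<in> labellings R m. U \<subseteq> label_edges R l} \<le> card (\<Union>g\<in>Q \<rightarrow>\<^sub>E {..<m}. Ext g)"
    using Q finExt by (intro card_mono) (auto intro: finite_PiE)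
  also have "\<dots> \<le> (\<Sum>g\<in>Q \<rightarrow>\<^sub>E {..<m}. card (Ext g))"
    using Q by (intro card_UN_le finite_PiE) auto
  also have "\<dots> \<le> (\<Sum>g\<in>Q \<rightarrow>\<^sub>E {..<m}. \<Prod>y\<in>verts K. fact (m - card (Sy y)))"
    unfolding Ext_def card_PiE[OF fin(1)] using R Sy
    by (intro sum_mono prod_mono conjI card_injections_extending) auto
  also have "\<dots> = m ^ c * (\<Prod>y\<in>verts K. fact (m - card (Sy y)))"
    using Q by (simp add: card_funcsetE c_def)
  finally have "real (card {l \<in> labellings R m. U \<subseteq> label_edges R l}) \<le> real (m ^ c * (\<Prod>y\<in>verts K. fact (m - card (Sy y))))"
    unfolding of_nat_le_iff .
  also have "\<dots> = real m ^ c * (\<Prod>y\<in>verts K. fact (m - card (Sy y)))" by simp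
  also have "\<dots> \<le> real m ^ c * (\<Prod>y\<in>verts K. fact m * (exp 1 / real m) ^ card (Sy y))"
    using Sym m0 by (intro mult_left_mono prod_mono conjI fact_diff_le) auto
  also have "(\<Prod>y\<in>verts K. fact m * (exp 1 / real m) ^ card (Sy y)) = (\<Prod>y\<in>verts K. fact m) * (exp 1 / real m) ^ v"
    unfolding vSy by (simp only: prod.distrib power_sum)
  also have "(\<Prod>y\<in>verts K. fact m) = real (card (labellings R m))"
    using card_labellings[OF R] by simp
  also have "real m ^ c * (real (card (labellings R m)) * (exp 1 / real m) ^ v)
      = real (card (labellings R m)) * (real m ^ c * (exp 1 / real m) ^ v)" by simp
  also have "\<dots> \<le> real (card (labellings R m)) * ((exp 2 / real m) powr (1 / \<delta>)) ^ card U"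
  proof (rule mult_left_mono)
    \<comment> \<open>Components have at least two vertices, so \<open>v \<le> 2 (v - c)\<close>;
      this is where \<open>exp 2\<close> comes from. Since \<open>exp 2 / real m\<close> is at most
      1, the exponent \<open>v - c\<close> may be lowered to
      \<open>card U / \<delta>\<close>.\<close>
    have v: "v = c + (v - c)" using v2c by simp
    have "real m ^ c * (exp 1 / real m) ^ v = exp 1 ^ v * (real m ^ c / real m ^ (c + (v - c)))"
      using v by (simp add: power_divide)
    also have "\<dots> = exp 1 ^ v / real m ^ (v - c)" using m0 by (simp add: power_add)
    also have "\<dots> \<le> exp 1 ^ (2 * (v - c)) / real m ^ (v - c)"
      using v2c by (intro divide_right_mono power_increasing) auto
    also have "(exp 1 :: real) ^ (2 * (v - c)) = exp 2 ^ (v - c)"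
      unfolding exp_of_nat_mult[symmetric] by simp
    also have "exp 2 ^ (v - c) / real m ^ (v - c) = (exp 2 / real m) ^ (v - c)"
      by (rule power_divide[symmetric])
    also have "\<dots> = (exp 2 / real m) powr real (v - c)" using m0 by (simp add: powr_realpow)
    also have "\<dots> \<le> (exp 2 / real m) powr (real (card U) / \<delta>)"
      using cardU \<delta> m m0 by (intro powr_mono') (auto simp: field_simps)
    also have "\<dots> = ((exp 2 / real m) powr (1 / \<delta>)) ^ card U"
      using m0 by (simp add: powr_powr mult.commute flip: powr_realpow)
    finally show "real m ^ c * (exp 1 / real m) ^ v \<le> \<dots>" .
  qed simp
  finally show ?thesis .
qed

section \<open>From labellings back to factors\<close>

lemma bij_fst_graph: "bij_betw fst ((\<lambda>y. (y, \<phi> y)) ` A) A"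
  by (rule bij_betw_byWitness[where f' = "\<lambda>y. (y, \<phi> y)"]) auto

lemma copy_edges_subset:
  assumes "\<phi> \<in> PiE (verts K) R" "\<And>y. y \<in> verts K \<Longrightarrow> R y \<subseteq> {..<N}"
  shows "copy_edges \<phi> \<subseteq> potential_edges K N"
proof -
  have "(\<lambda>y. (y, \<phi> y)) ` ends K e \<subseteq> (\<Union>y\<in>verts K. vpart N y)" if "e \<in> edges K" for e
  proof
    fix z assume "z \<in> (\<lambda>y. (y, \<phi> y)) ` ends K e"
    then obtain y where y: "y \<in> ends K e" "z = (y, \<phi> y)" by auto
    then have yV: "y \<in> verts K" using ends(1)[OF that] by auto
    then have "\<phi> y \<in> {..<N}" using assms(1) assms(2)[OF yV] by auto
    then show "z \<in> (\<Union>y\<in>verts K. vpart N y)" using y yV by (auto simp: vpart_def)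
  qed
  then show ?thesis unfolding copy_edges_def potential_edges_def by (auto simp: bij_fst_graph)
qed

lemma card_copy_edges: "card (copy_edges \<phi>) = card (edges K)" "finite (copy_edges \<phi>)"
  unfolding copy_edges_def using fin by (auto intro!: card_image inj_onI)

lemma finite_potential_edges: "finite (potential_edges K N)"
proof -
  have "potential_edges K N \<subseteq> edges K \<times> Pow (\<Union>y\<in>verts K. vpart N y)" unfolding potential_edges_def by auto
  moreover have "finite (edges K \<times> Pow (\<Union>y\<in>verts K. vpart N y))" using fin by (auto simp: vpart_def)
  ultimately show ?thesis by (rule finite_subset)
qed

lemma label_edges_subset:
  assumes "\<And>y. y \<in> verts K \<Longrightarrow> R y \<subseteq> {..<N}"
  shows "label_edges R l \<subseteq> potential_edges K N"
proof -
  have "Sigma (verts K) R \<subseteq> (\<Union>y\<in>verts K. vpart N y)" using assms by (auto simp: vpart_def)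
  then show ?thesis unfolding label_edges_def potential_edges_def by blast
qed

text \<open>Equal cardinalities make each \<open>l y\<close> a bijection onto \<open>{..<m}\<close>;
  inverting all of them at \<open>j\<close> yields the transversal of the vertices labelled
  \<open>j\<close>.\<close>

lemma factors_of_labelling:
  assumes R: "\<And>y. y \<in> verts K \<Longrightarrow> finite (R y)" "\<And>y. y \<in> verts K \<Longrightarrow> card (R y) = m"
    and l: "l \<in> labellings R m" "label_edges R l \<subseteq> W"
  shows "factors W R \<noteq> {}"
proof -
  define \<phi> where "\<phi> j = (\<lambda>y\<in>verts K. inv_into (R y) (l y) j)" for j
  have bl: "bij_betw (l y) (R y) {..<m}" if y: "y \<in> verts K" for y
  proof -
    have "l y \<in> injections (R y) m" using l y by (auto simp: labellings_def)
    then have i: "inj_on (l y) (R y)" "l y ` R y \<subseteq> {..<m}" by (auto simp: injections_def)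
    then have "l y ` R y = {..<m}" using R(2)[OF y] by (intro card_subset_eq) (auto simp: card_image)
    then show ?thesis using i by (simp add: bij_betw_def)
  qed
  have b: "bij_betw (\<lambda>j. \<phi> j y) {..<m} (R y)" if y: "y \<in> verts K" for y
    using bij_betw_inv_into[OF bl[OF y]] y by (simp add: \<phi>_def)
  have "\<phi> ` {..<m} \<in> factors W R"
    unfolding factors_def mem_Collect_eq
  proof (intro conjI ballI)
    show "\<phi> ` {..<m} \<subseteq> PiE (verts K) R"
    proof
      fix f assume "f \<in> \<phi> ` {..<m}"
      then obtain j where j: "j < m" "f = \<phi> j" by auto
      have "\<phi> j y \<in> R y" if "y \<in> verts K" for y using bij_betwE[OF b[OF that]] j by auto
      then show "f \<in> PiE (verts K) R" unfolding j by (auto simp: \<phi>_def)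
    qed
    fix y assume y: "y \<in> verts K"
    have "inj_on (\<lambda>f. f y) (\<phi> ` {..<m})"
      using b[OF y] by (auto simp: bij_betw_def inj_on_def)
    moreover have "(\<lambda>f. f y) ` \<phi> ` {..<m} = R y"
      using b[OF y] by (auto simp: bij_betw_def image_image)
    ultimately show "bij_betw (\<lambda>f. f y) (\<phi> ` {..<m}) (R y)" by (simp add: bij_betw_def)
  next
    fix f assume "f \<in> \<phi> ` {..<m}"
    then obtain j where j: "j < m" "f = \<phi> j" by auto
    have jl: "\<phi> j y \<in> R y \<and> l y (\<phi> j y) = j" if y: "y \<in> verts K" for y
      using bij_betwE[OF b[OF y]] bij_betw_inv_into_right[OF bl[OF y], of j] j y by (auto simp: \<phi>_def)
    have "copy_edges f \<subseteq> label_edges R l"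
    proof
      fix z assume "z \<in> copy_edges f"
      then obtain e where e: "e \<in> edges K" "z = (e, (\<lambda>y. (y, f y)) ` ends K e)" unfolding copy_edges_def by auto
      have "(\<lambda>y. (y, f y)) ` ends K e \<subseteq> Sigma (verts K) R"
        using jl ends(1)[OF e(1)] j by auto
      moreover have "\<forall>z\<in>(\<lambda>y. (y, f y)) ` ends K e. l (fst z) (snd z) = j"
        using jl ends(1)[OF e(1)] j by auto
      ultimately show "z \<in> label_edges R l"
        using e bij_fst_graph[of f "ends K e"] unfolding label_edges_def by blast
    qed
    then show "copy_edges f \<subseteq> W" using l by auto
  qed
  then show ?thesis by auto
qed

end

section \<open>Greedy choice of copies\<close>

context sparse_mgraph begin

abbreviation n\<^sub>K :: nat where "n\<^sub>K \<equiv> card (verts K)"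
abbreviation e\<^sub>K :: nat where "e\<^sub>K \<equiv> card (edges K)"

definition copies :: "('e \<times> ('v \<times> nat) set) set \<Rightarrow> ('v \<Rightarrow> nat set) \<Rightarrow> ('v \<Rightarrow> nat) set" where
  "copies W R = {\<phi> \<in> PiE (verts K) R. copy_edges \<phi> \<subseteq> W}"

definition parts :: "nat \<Rightarrow> nat \<Rightarrow> ('v \<Rightarrow> nat set) \<Rightarrow> bool" where
  "parts N r R \<longleftrightarrow> (\<forall>y\<in>verts K. R y \<subseteq> {..<N} \<and> card (R y) = r)"

section \<open>Families of parts and double counting of factors\<close>

lemma parts_finite: "parts N r R \<Longrightarrow> y \<in> verts K \<Longrightarrow> finite (R y)"
  using finite_subset[of "R y" "{..<N}"] by (simp add: parts_def)

lemma parts_finite_PiE: "parts N r R \<Longrightarrow> finite (PiE (verts K) R)"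
  using fin(1) parts_finite by (rule finite_PiE)

lemma parts_card_PiE: "parts N r R \<Longrightarrow> card (PiE (verts K) R) = r ^ n\<^sub>K"
proof -
  assume "parts N r R"
  then have "(\<Prod>y\<in>verts K. card (R y)) = (\<Prod>y\<in>verts K. r)" by (intro prod.cong) (auto simp: parts_def)
  then show ?thesis using fin(1) by (simp add: card_PiE)
qed

lemma parts_delete:
  assumes "parts N (Suc r) R" "\<phi> \<in> PiE (verts K) R"
  shows "parts N r (\<lambda>y. R y - {\<phi> y})"
  unfolding parts_def
proof (intro ballI conjI)
  fix y assume y: "y \<in> verts K"
  then show "R y - {\<phi> y} \<subseteq> {..<N}" using assms(1) by (auto simp: parts_def)
  have "\<phi> y \<in> R y" using assms(2) y by auto
  then show "card (R y - {\<phi> y}) = r" using assms(1) y by (simp add: parts_def)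
qed

lemma finite_copies: "parts N r R \<Longrightarrow> finite (copies W R)"
  unfolding copies_def using parts_finite_PiE[of N r R] by simp

lemma finite_factors: "parts N r R \<Longrightarrow> finite (factors W R)"
proof -
  assume "parts N r R"
  then have "finite (Pow (PiE (verts K) R))" by (simp add: parts_finite_PiE)
  moreover have "factors W R \<subseteq> Pow (PiE (verts K) R)" by (auto simp: factors_def)
  ultimately show ?thesis by (rule rev_finite_subset)
qed

lemma card_factor:
  assumes "P \<in> factors W R" "parts N r R"
  shows "card P = r"
proof -
  obtain y where y: "y \<in> verts K" using ne by auto
  then have "bij_betw (\<lambda>\<phi>. \<phi> y) P (R y)" using assms(1) by (simp add: factors_def)
  then have "card P = card (R y)" by (rule bij_betw_same_card)
  then show ?thesis using assms(2) y by (simp add: parts_def)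
qed

text \<open>Double counting of pairs of a factor and a distinguished member: adding
  \<open>\<phi>\<close> to a factor of what remains after its removal yields such a pair
  injectively, and every factor has exactly \<open>r\<close> members.\<close>

lemma factors_recurrence:
  assumes R: "parts N r R"
  shows "(\<Sum>\<phi>\<in>copies W R. card (factors W (\<lambda>y. R y - {\<phi> y}))) \<le> r * card (factors W R)"
proof (cases r)
  case 0
  have "PiE (verts K) R = {}"
  proof -
    obtain y where y: "y \<in> verts K" using ne by auto
    then have "R y = {}" using R 0 parts_finite[OF R y] by (auto simp: parts_def)
    then show ?thesis using y by auto
  qed
  then show ?thesis by (simp add: copies_def)
next
  case (Suc r')
  let ?R = "\<lambda>\<phi> y. R y - {\<phi> y}"
  let ?A = "Sigma (copies W R) (\<lambda>\<phi>. factors W (?R \<phi>))"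
  let ?B = "Sigma (factors W R) (\<lambda>P. P)"
  have R': "parts N r' (?R \<phi>)" if "\<phi> \<in> copies W R" for \<phi>
    using parts_delete[of N r' R \<phi>] R that Suc by (auto simp: copies_def)
  have notin: "\<phi> \<notin> P" if "P \<in> factors W (?R \<phi>)" for \<phi> P
  proof
    assume "\<phi> \<in> P"
    then have "\<phi> \<in> PiE (verts K) (?R \<phi>)" using that by (auto simp: factors_def)
    then show False using ne by auto
  qed
  have "(\<Sum>\<phi>\<in>copies W R. card (factors W (?R \<phi>))) = card ?A"
    using finite_copies[OF R] finite_factors[OF R'] by (simp add: card_SigmaI)
  also have "\<dots> \<le> card ?B"
  proof (rule card_inj_on_le)
    show "inj_on (\<lambda>(\<phi>, P). (insert \<phi> P, \<phi>)) ?A"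
    proof (rule inj_onI)
      fix a b assume ab: "a \<in> ?A" "b \<in> ?A" and eq: "(\<lambda>(\<phi>, P). (insert \<phi> P, \<phi>)) a = (\<lambda>(\<phi>, P). (insert \<phi> P, \<phi>)) b"
      obtain \<phi> P P' where a: "a = (\<phi>, P)" "b = (\<phi>, P')" and i: "insert \<phi> P = insert \<phi> P'"
        using eq by (cases a, cases b) auto
      have "\<phi> \<notin> P" "\<phi> \<notin> P'" using ab a notin by auto
      then have "P = P'" using i by (simp add: insert_ident)
      then show "a = b" using a by simp
    qed
    show "(\<lambda>(\<phi>, P). (insert \<phi> P, \<phi>)) ` ?A \<subseteq> ?B"
    proof
      fix z assume "z \<in> (\<lambda>(\<phi>, P). (insert \<phi> P, \<phi>)) ` ?A"
      then obtain \<phi> P where z: "z = (insert \<phi> P, \<phi>)" and \<phi>: "\<phi> \<in> copies W R"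
        and P: "P \<in> factors W (?R \<phi>)" by auto
      have "insert \<phi> P \<in> factors W R"
        unfolding factors_def mem_Collect_eq
      proof (intro conjI ballI)
        have "P \<subseteq> PiE (verts K) (?R \<phi>)" using P by (auto simp: factors_def)
        also have "\<dots> \<subseteq> PiE (verts K) R" by (rule PiE_mono) auto
        finally show "insert \<phi> P \<subseteq> PiE (verts K) R" using \<phi> by (auto simp: copies_def)
        fix y assume y: "y \<in> verts K"
        have "bij_betw (\<lambda>\<psi>. \<psi> y) P (R y - {\<phi> y})" using P y by (auto simp: factors_def)
        then have "bij_betw (\<lambda>\<psi>. \<psi> y) (P \<union> {\<phi>}) ((R y - {\<phi> y}) \<union> {\<phi> y})"
          using notin[OF P] by (intro notIn_Un_bij_betw) auto
        moreover have "\<phi> y \<in> R y" using \<phi> y by (auto simp: copies_def)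
        then have "(R y - {\<phi> y}) \<union> {\<phi> y} = R y" by auto
        ultimately show "bij_betw (\<lambda>\<psi>. \<psi> y) (insert \<phi> P) (R y)" by simp
      next
        fix \<psi> assume "\<psi> \<in> insert \<phi> P"
        then show "copy_edges \<psi> \<subseteq> W" using \<phi> P by (auto simp: copies_def factors_def)
      qed
      then show "z \<in> ?B" using z by auto
    qed
    have "finite P" if "P \<in> factors W R" for P
      using that parts_finite_PiE[OF R] by (auto simp: factors_def intro: finite_subset)
    then show "finite ?B" using finite_factors[OF R] by auto
  qed
  also have "\<dots> = (\<Sum>P\<in>factors W R. card P)"
  proof -
    have "finite P" if "P \<in> factors W R" for P
      using that parts_finite_PiE[OF R] by (auto simp: factors_def intro: finite_subset)
    then show ?thesis using finite_factors[OF R] by (simp add: card_SigmaI)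
  qed
  also have "\<dots> = r * card (factors W R)" using card_factor[OF _ R] by simp
  finally show ?thesis .
qed

text \<open>Counts the ways to remove \<^term>\<open>j\<close> disjoint copies of \<^term>\<open>K\<close> and to leave parts of
  size \<^term>\<open>m\<close>, which are weighted by \<^term>\<open>w\<close>. A factor arises by removing its copies in any
  order, whence the division by the size of the parts.\<close>

primrec greedy :: "('e \<times> ('v \<times> nat) set) set \<Rightarrow> (('v \<Rightarrow> nat set) \<Rightarrow> real) \<Rightarrow> nat \<Rightarrow> nat \<Rightarrow> ('v \<Rightarrow> nat set) \<Rightarrow> real" where
  "greedy W w m 0 R = w R"
| "greedy W w m (Suc j) R = (\<Sum>\<phi>\<in>copies W R. greedy W w m j (\<lambda>y. R y - {\<phi> y})) / real (m + Suc j)"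

text \<open>The divisor in \<open>greedy\<close> cancels the factor \<open>r\<close> of the
  recurrence. Greedy copies use \<open>W\<close> alone, the first round, while factors are counted
  in the larger \<open>W'\<close>, which also contains the completions.\<close>

lemma greedy_le_factors:
  assumes "W \<subseteq> W'" and w: "\<And>R. parts N m R \<Longrightarrow> w R \<le> real (card (factors W' R))"
    and R: "parts N (m + j) R"
  shows "greedy W w m j R \<le> real (card (factors W' R))"
  using R
proof (induction j arbitrary: R)
  case 0
  then show ?case using w by simp
next
  case (Suc j)
  have R': "parts N (m + j) (\<lambda>y. R y - {\<phi> y})" if "\<phi> \<in> copies W R" for \<phi>
    using that Suc.prems by (intro parts_delete) (auto simp: copies_def)
  have "(\<Sum>\<phi>\<in>copies W R. greedy W w m j (\<lambda>y. R y - {\<phi> y})) \<le>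
     (\<Sum>\<phi>\<in>copies W R. real (card (factors W' (\<lambda>y. R y - {\<phi> y}))))"
    using Suc.IH[OF R'] by (intro sum_mono) auto
  also have "\<dots> \<le> (\<Sum>\<phi>\<in>copies W' R. real (card (factors W' (\<lambda>y. R y - {\<phi> y}))))"
    using finite_copies[OF Suc.prems] assms(1) by (intro sum_mono2) (auto simp: copies_def)
  also have "\<dots> \<le> real ((m + Suc j) * card (factors W' R))"
    unfolding of_nat_sum[symmetric] of_nat_le_iff by (rule factors_recurrence[OF Suc.prems])
  also have "\<dots> = real (card (factors W' R)) * real (m + Suc j)" by (simp only: of_nat_mult mult.commute)
  finally show ?case unfolding greedy.simps by (rule mult_imp_div_pos_le[rotated]) simp
qed

section \<open>Linearity in the weight and the two-round argument\<close>

lemma greedy_diff: "greedy W (\<lambda>R. w R - w' R) m j R = greedy W w m j R - greedy W w' m j R"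
  by (induction j arbitrary: R) (simp_all add: sum_subtractf diff_divide_distrib)

lemma greedy_cmult: "greedy W (\<lambda>R. c * w R) m j R = c * greedy W w m j R"
proof (induction j arbitrary: R)
  case (Suc j)
  show ?case unfolding greedy.simps Suc.IH sum_distrib_left[symmetric] times_divide_eq_right ..
qed simp

text \<open>For a fixed first round \<open>W\<close>, \<open>greedy\<close> is a linear functional
  of the weight, so an expectation over the second round passes to the weight.\<close>

lemma rexp_greedy: "rexp X q (\<lambda>W'. greedy W (w W') m j R) = greedy W (\<lambda>R. rexp X q (\<lambda>W'. w W' R)) m j R"
proof (induction j arbitrary: R)
  case (Suc j)
  have "rexp X q (\<lambda>W'. greedy W (w W') m (Suc j) R)
    = rexp X q (\<lambda>W'. (1 / real (m + Suc j)) * (\<Sum>\<phi>\<in>copies W R. greedy W (w W') m j (\<lambda>y. R y - {\<phi> y})))"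
    by simp
  also have "\<dots> = greedy W (\<lambda>R. rexp X q (\<lambda>W'. w W' R)) m (Suc j) R"
    unfolding rexp_cmult rexp_sum Suc.IH by simp
  finally show ?case .
qed simp

lemma greedy_mono:
  assumes w: "\<And>R. parts N m R \<Longrightarrow> w R \<le> w' R" and R: "parts N (m + j) R"
  shows "greedy W w m j R \<le> greedy W w' m j R"
  using R
proof (induction j arbitrary: R)
  case 0
  then show ?case using w by simp
next
  case (Suc j)
  have R': "parts N (m + j) (\<lambda>y. R y - {\<phi> y})" if "\<phi> \<in> copies W R" for \<phi>
    using that Suc.prems by (intro parts_delete) (auto simp: copies_def)
  show ?case unfolding greedy.simps using Suc.IH[OF R'] by (intro divide_right_mono sum_mono) auto
qed

lemma greedy_ge:
  assumes b: "\<And>r R. m < r \<Longrightarrow> parts N r R \<Longrightarrow> b r \<le> real (card (copies W R))"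
    and b0: "\<And>r. 0 \<le> b r" and R: "parts N (m + j) R"
  shows "(\<Prod>i=1..j. b (m + i) / real (m + i)) \<le> greedy W (\<lambda>_. 1) m j R"
  using R
proof (induction j arbitrary: R)
  case 0
  then show ?case by simp
next
  case (Suc j)
  let ?p = "\<Prod>i=1..j. b (m + i) / real (m + i)"
  have p0: "0 \<le> ?p" using b0 by (intro prod_nonneg) auto
  have R': "parts N (m + j) (\<lambda>y. R y - {\<phi> y})" if "\<phi> \<in> copies W R" for \<phi>
    using that Suc.prems by (intro parts_delete) (auto simp: copies_def)
  have "b (m + Suc j) * ?p \<le> real (card (copies W R)) * ?p"
    using b[OF _ Suc.prems] p0 by (intro mult_right_mono) auto
  also have "\<dots> = (\<Sum>\<phi>\<in>copies W R. ?p)" by simp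
  also have "\<dots> \<le> (\<Sum>\<phi>\<in>copies W R. greedy W (\<lambda>_. 1) m j (\<lambda>y. R y - {\<phi> y}))"
    using Suc.IH[OF R'] by (intro sum_mono) auto
  finally have "b (m + Suc j) * ?p / real (m + Suc j) \<le> greedy W (\<lambda>_. 1) m (Suc j) R"
    unfolding greedy.simps by (intro divide_right_mono) auto
  moreover have "(\<Prod>i=1..Suc j. b (m + i) / real (m + i)) = b (m + Suc j) * ?p / real (m + Suc j)"
    by (subst prod.nat_ivl_Suc') simp_all
  ultimately show ?case by simp
qed

text \<open>Uniformity over all families of parts is essential: the families met during the greedy
  choice depend on \<open>W\<close>, so a bound for each fixed family would not apply to
  them.\<close>

definition many_copies :: "nat \<Rightarrow> nat \<Rightarrow> real \<Rightarrow> ('e \<times> ('v \<times> nat) set) set \<Rightarrow> bool" where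
  "many_copies N m q W \<longleftrightarrow> (\<forall>r R. m < r \<and> parts N r R \<longrightarrow>
     real r ^ n\<^sub>K * q ^ e\<^sub>K / 8 \<le> real (card (copies W R)))"

text \<open>Fix a good first round, with total greedy weight \<open>?T \<ge> t\<close>. If fewer
  than \<open>t / 2\<close> factors result, then at least half of \<open>?T\<close> sits on leftover
  parts without a factor in the second round. The expectation of that weight is at most
  \<open>\<eta>' * ?T\<close>, and Markov's inequality yields \<open>2 * \<eta>'\<close>.\<close>

lemma two_round_count:
  assumes q: "0 < q" "q \<le> 1" and q': "0 \<le> q'" "q' \<le> 1"
    and \<eta>: "rexp (potential_edges K N) q (\<lambda>W. of_bool (\<not> many_copies N m q W)) \<le> \<eta>"
    and \<eta>': "\<And>R. parts N m R \<Longrightarrow> rexp (potential_edges K N) q' (\<lambda>W. of_bool (factors W R = {})) \<le> \<eta>'"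
    and R: "parts N (m + j) R"
    and t: "t = (\<Prod>i=1..j. real (m + i) ^ n\<^sub>K * q ^ e\<^sub>K / 8 / real (m + i))"
  shows "rexp (potential_edges K N) (q + q' - q * q') (\<lambda>W. of_bool (real (card (factors W R)) < t / 2)) \<le> \<eta> + 2 * \<eta>'"
proof -
  let ?X = "potential_edges K N"
  let ?bad = "\<lambda>W. of_bool (real (card (factors W R)) < t / 2) :: real"
  note X = finite_potential_edges[of N]
  have tpos: "0 < t" unfolding t using q by (intro prod_pos) auto
  have one: "rexp ?X q' (\<lambda>W'. ?bad (W \<union> W')) \<le> 2 * \<eta>'" if good: "many_copies N m q W" for W
  proof -
    let ?T = "greedy W (\<lambda>_. 1) m j R"
    have tT: "t \<le> ?T"
      unfolding t
    proof (rule greedy_ge[where b = "\<lambda>r. real r ^ n\<^sub>K * q ^ e\<^sub>K / 8", OF _ _ R])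
      show "real r ^ n\<^sub>K * q ^ e\<^sub>K / 8 \<le> real (card (copies W R))" if "m < r" "parts N r R" for r R
        using good that unfolding many_copies_def by blast
    qed (use q in simp)
    define w where "w W' R = (of_bool (factors W' R = {}) :: real)" for W' R
    \<comment> \<open>The pointwise form of Markov's inequality: the weight of the leftover families
      that cannot be completed is at least \<open>?T / 2\<close> in the bad case and nonnegative
      otherwise.\<close>
    have "?bad (W \<union> W') \<le> 2 / ?T * greedy W (w W') m j R" for W'
    proof (cases "real (card (factors (W \<union> W') R)) < t / 2")
      case True
      have "greedy W (\<lambda>R. 1 - w W' R) m j R \<le> real (card (factors (W \<union> W') R))"
      proof (rule greedy_le_factors[OF _ _ R])
        fix R assume R: "parts N m R"
        show "1 - w W' R \<le> real (card (factors (W \<union> W') R))"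
        proof (cases "factors W' R = {}")
          case False
          moreover have "factors W' R \<subseteq> factors (W \<union> W') R" by (auto simp: factors_def)
          ultimately have "0 < card (factors (W \<union> W') R)"
            using finite_factors[OF R] by (auto simp: card_gt_0_iff)
          then show ?thesis using False by (simp add: w_def)
        qed (simp add: w_def)
      qed simp
      then have "?T / 2 \<le> greedy W (w W') m j R" using True tT unfolding greedy_diff by linarith
      then show ?thesis using True tT tpos by (simp add: field_simps)
    next
      case False
      have "greedy W (\<lambda>_. 0) m j R \<le> greedy W (w W') m j R"
        by (rule greedy_mono[OF _ R]) (simp add: w_def)
      then have "0 \<le> greedy W (w W') m j R" using greedy_cmult[of W 0 "\<lambda>_. 0"] by simp
      then show ?thesis using False tT tpos by simp
    qed
    then have "rexp ?X q' (\<lambda>W'. ?bad (W \<union> W')) \<le> rexp ?X q' (\<lambda>W'. 2 / ?T * greedy W (w W') m j R)"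
      using q' by (intro rexp_mono) auto
    also have "\<dots> = 2 / ?T * greedy W (\<lambda>R. rexp ?X q' (\<lambda>W'. w W' R)) m j R"
      unfolding rexp_cmult rexp_greedy ..
    also have "\<dots> \<le> 2 / ?T * greedy W (\<lambda>R. \<eta>' * 1) m j R"
      using \<eta>' tT tpos unfolding w_def by (intro mult_left_mono greedy_mono[OF _ R]) auto
    also have "\<dots> = 2 * \<eta>'" unfolding greedy_cmult using tT tpos by simp
    finally show ?thesis .
  qed
  have le1: "rexp ?X q' (\<lambda>W'. ?bad (W \<union> W')) \<le> 1" for W
    using rexp_mono[OF q', of ?X "\<lambda>W'. ?bad (W \<union> W')" "\<lambda>_. 1"] rexp_const[OF X] by simp
  have \<eta>0: "0 \<le> \<eta>'"
  proof -
    obtain y where y: "y \<in> verts K" using ne by auto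
    then have "card (R y) \<le> card {..<N}" using R by (intro card_mono) (auto simp: parts_def)
    then have "m \<le> N" using R y by (simp add: parts_def)
    then have "parts N m (\<lambda>_. {..<m})" by (auto simp: parts_def)
    then have "rexp ?X q' (\<lambda>W. of_bool (factors W (\<lambda>_. {..<m}) = {})) \<le> \<eta>'" by (rule \<eta>')
    moreover have "0 \<le> rexp ?X q' (\<lambda>W. of_bool (factors W (\<lambda>_. {..<m}) = {}))"
      using q' by (intro rexp_nonneg) auto
    ultimately show ?thesis by linarith
  qed
  have "rexp ?X (q + q' - q * q') ?bad = rexp ?X q (\<lambda>W. rexp ?X q' (\<lambda>W'. ?bad (W \<union> W')))"
    by (rule rexp_union[OF X, symmetric])
  also have "\<dots> \<le> rexp ?X q (\<lambda>W. of_bool (\<not> many_copies N m q W) + 2 * \<eta>')"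
  proof (rule rexp_mono)
    fix W
    show "rexp ?X q' (\<lambda>W'. ?bad (W \<union> W')) \<le> of_bool (\<not> many_copies N m q W) + 2 * \<eta>'"
    proof (cases "many_copies N m q W")
      case True
      then show ?thesis using one by simp
    next
      case False
      then show ?thesis using le1[of W] \<eta>0 by simp
    qed
  qed (use q in auto)
  also have "\<dots> \<le> \<eta> + 2 * \<eta>'" using \<eta> X by (simp add: rexp_add rexp_const)
  finally show ?thesis .
qed

text \<open>Copies agreeing exactly on \<open>S\<close> share only edges spanned by
  \<open>S\<close>, at most \<open>\<delta> (card S - 1)\<close> of them by sparsity; a shared edge
  has two ends, both in \<open>S\<close>.\<close>

lemma copy_edges_overlap:
  assumes "0 < q" "q \<le> 1" "\<phi> \<in> PiE (verts K) R" "\<psi> \<in> PiE (verts K) R"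
    and ov: "copy_edges \<phi> \<inter> copy_edges \<psi> \<noteq> {}"
  defines "S \<equiv> {y \<in> verts K. \<psi> y = \<phi> y}"
  shows "2 \<le> card S"
    and "q ^ card (copy_edges \<phi> \<union> copy_edges \<psi>) \<le> q ^ (2 * e\<^sub>K) * (q powr - \<delta>) ^ (card S - 1)"
proof -
  have SV: "S \<subseteq> verts K" "finite S" using fin unfolding S_def by auto
  have eqS: "ends K e \<subseteq> S"
    if e: "e \<in> edges K" and eq: "(\<lambda>y. (y, \<phi> y)) ` ends K e = (\<lambda>y. (y, \<psi> y)) ` ends K e" for e
  proof
    fix y assume y: "y \<in> ends K e"
    then have "(y, \<phi> y) \<in> (\<lambda>y. (y, \<psi> y)) ` ends K e" unfolding eq[symmetric] by auto
    then show "y \<in> S" using y ends(1)[OF e] by (auto simp: S_def)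
  qed
  have inter: "copy_edges \<phi> \<inter> copy_edges \<psi> \<subseteq> (\<lambda>e. (e, (\<lambda>y. (y, \<phi> y)) ` ends K e)) ` {e \<in> edges K. ends K e \<subseteq> S}"
    unfolding copy_edges_def using eqS by auto
  then have "{e \<in> edges K. ends K e \<subseteq> S} \<noteq> {}" using ov by auto
  then obtain e where e: "e \<in> edges K" "ends K e \<subseteq> S" by auto
  then show S2: "2 \<le> card S" using card_mono[OF SV(2) e(2)] ends(2) by simp
  define c where "c = card (copy_edges \<phi> \<inter> copy_edges \<psi>)"
  have "c \<le> card ((\<lambda>e. (e, (\<lambda>y. (y, \<phi> y)) ` ends K e)) ` {e \<in> edges K. ends K e \<subseteq> S})"
    unfolding c_def using inter fin by (intro card_mono) auto
  also have "\<dots> \<le> card {e \<in> edges K. ends K e \<subseteq> S}" using fin by (intro card_image_le) auto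
  finally have "real c \<le> \<delta> * (real (card S) - 1)"
    using sparse[OF SV(1)] S2 by fastforce
  then have c: "real c \<le> \<delta> * real (card S - 1)" using S2 by (simp add: of_nat_diff)
  have "card (copy_edges \<phi> \<union> copy_edges \<psi>) + c = 2 * e\<^sub>K"
    using card_Un_Int[of "copy_edges \<phi>" "copy_edges \<psi>"] card_copy_edges by (simp add: c_def)
  then have "q ^ (2 * e\<^sub>K) = q ^ card (copy_edges \<phi> \<union> copy_edges \<psi>) * q ^ c"
    by (simp flip: power_add)
  then have "q ^ card (copy_edges \<phi> \<union> copy_edges \<psi>) = q ^ (2 * e\<^sub>K) * q powr (- real c)"
    using assms(1) by (simp add: powr_minus powr_realpow field_simps)
  also have "\<dots> \<le> q ^ (2 * e\<^sub>K) * q powr (- (\<delta> * real (card S - 1)))"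
    using assms(1,2) c by (intro mult_left_mono powr_mono') auto
  also have "q powr (- (\<delta> * real (card S - 1))) = (q powr - \<delta>) ^ (card S - 1)"
    using assms(1) by (simp add: powr_powr flip: powr_realpow)
  finally show "q ^ card (copy_edges \<phi> \<union> copy_edges \<psi>) \<le> q ^ (2 * e\<^sub>K) * (q powr - \<delta>) ^ (card S - 1)" .
qed

lemma card_agreeing:
  assumes R: "parts N r R" and \<phi>: "\<phi> \<in> PiE (verts K) R" and S: "S \<subseteq> verts K"
  shows "card {\<psi> \<in> PiE (verts K) R. \<forall>y\<in>S. \<psi> y = \<phi> y} = r ^ (n\<^sub>K - card S)"
proof -
  have "{\<psi> \<in> PiE (verts K) R. \<forall>y\<in>S. \<psi> y = \<phi> y} = PiE (verts K) (\<lambda>y. if y \<in> S then {\<phi> y} else R y)"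
    (is "?A = ?B")
  proof (intro equalityI subsetI)
    fix \<psi> assume "\<psi> \<in> ?A"
    then show "\<psi> \<in> ?B" by (auto simp: PiE_iff)
  next
    fix \<psi> assume \<psi>: "\<psi> \<in> ?B"
    have "\<psi> y \<in> R y" if y: "y \<in> verts K" for y
      using PiE_mem[OF \<psi> y] PiE_mem[OF \<phi> y] by (auto split: if_splits)
    moreover have "\<psi> y = \<phi> y" if y: "y \<in> S" for y
      using PiE_mem[OF \<psi>, of y] S y by auto
    moreover have "\<psi> \<in> extensional (verts K)" using \<psi> by (auto simp: PiE_iff)
    ultimately show "\<psi> \<in> ?A" by (auto simp: PiE_iff)
  qed
  also have "card \<dots> = (\<Prod>y\<in>verts K. if y \<in> S then 1 else r)"
    unfolding card_PiE[OF fin(1)] using R by (intro prod.cong) (auto simp: parts_def)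
  also have "\<dots> = r ^ card (verts K - S)"
    using fin by (simp add: prod.If_cases Diff_eq)
  also have "card (verts K - S) = n\<^sub>K - card S" using fin S by (simp add: card_Diff_subset finite_subset)
  finally show ?thesis .
qed

text \<open>Pairs of copies agreeing on \<open>s\<close> vertices contribute at most
  \<open>\<mu>^2 b^(s - 1) / r^s\<close> to the Janson sum, where
  \<open>b = q powr - \<delta>\<close>. Because \<open>b \<le> r\<close>, the worst case is
  \<open>s = 2\<close>, and at most \<open>2 ^ n\<^sub>K\<close> vertex sets are summed; hence
  \<open>D\<close>. Without edges all transversals are copies and the count is
  deterministic.\<close>

lemma copies_lower_tail:
  assumes R: "parts N r R" and q: "0 < q" "q \<le> 1" and r: "0 < r" "q powr - \<delta> \<le> real r"
  shows "rexp (potential_edges K N) q (\<lambda>W. of_bool (real (card (copies W R)) < real r ^ n\<^sub>K * q ^ e\<^sub>K / 8))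
     \<le> exp (- ((real r)\<^sup>2 * q powr \<delta>) / (8 * 2 ^ n\<^sub>K))"
proof (cases "edges K = {}")
  case True
  have "copies W R = PiE (verts K) R" for W using True by (auto simp: copies_def copy_edges_def)
  then have "card (copies W R) = r ^ n\<^sub>K" for W using parts_card_PiE[OF R] by simp
  moreover have "\<not> real (r ^ n\<^sub>K) < real r ^ n\<^sub>K * q ^ e\<^sub>K / 8" using True by simp
  ultimately have "(\<lambda>W. of_bool (real (card (copies W R)) < real r ^ n\<^sub>K * q ^ e\<^sub>K / 8)) = (\<lambda>_. 0 :: real)"
    by (simp only: if_False of_bool_eq)
  then show ?thesis using rexp_const[OF finite_potential_edges] by simp
next
  case False
  let ?I = "PiE (verts K) R"
  define b where "b = q powr - \<delta>"
  define D where "D = 2 ^ n\<^sub>K * b / (real r)\<^sup>2"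
  define \<mu> where "\<mu> = real r ^ n\<^sub>K * q ^ e\<^sub>K"
  have b0: "0 < b" using q by (simp add: b_def)
  have D0: "0 < D" unfolding D_def using b0 r by simp
  have \<mu>0: "0 < \<mu>" unfolding \<mu>_def using q r by simp
  let ?t = "\<lambda>\<phi> \<psi>. if copy_edges \<phi> \<inter> copy_edges \<psi> \<noteq> {} then q ^ card (copy_edges \<phi> \<union> copy_edges \<psi>) else 0"
  let ?\<S> = "{S. S \<subseteq> verts K \<and> 2 \<le> card S}"
  have f\<S>: "finite ?\<S>" using fin by auto
  have c\<S>: "card ?\<S> \<le> 2 ^ n\<^sub>K"
  proof -
    have "card ?\<S> \<le> card (Pow (verts K))" using fin by (intro card_mono) auto
    then show ?thesis using fin by (simp add: card_Pow)
  qed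
  have row: "(\<Sum>\<psi>\<in>?I. ?t \<phi> \<psi>) \<le> q ^ e\<^sub>K * D * \<mu>" if \<phi>: "\<phi> \<in> ?I" for \<phi>
  proof -
    \<comment> \<open>Summing over all \<open>S\<close> on which the two copies agree overcounts,
      but the single term of the full agreement set already dominates the left-hand side.\<close>
    have "(\<Sum>\<psi>\<in>?I. ?t \<phi> \<psi>) \<le> (\<Sum>\<psi>\<in>?I. \<Sum>S\<in>?\<S>. of_bool (\<forall>y\<in>S. \<psi> y = \<phi> y) * (q ^ (2 * e\<^sub>K) * b ^ (card S - 1)))"
    proof (rule sum_mono)
      fix \<psi> assume \<psi>: "\<psi> \<in> ?I"
      let ?g = "\<lambda>S. of_bool (\<forall>y\<in>S. \<psi> y = \<phi> y) * (q ^ (2 * e\<^sub>K) * b ^ (card S - 1))"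
      have g0: "0 \<le> ?g S" for S using q b0 by simp
      show "?t \<phi> \<psi> \<le> sum ?g ?\<S>"
      proof (cases "copy_edges \<phi> \<inter> copy_edges \<psi> \<noteq> {}")
        case True
        let ?S = "{y \<in> verts K. \<psi> y = \<phi> y}"
        note ov = copy_edges_overlap[OF q \<phi> \<psi> True]
        have "?t \<phi> \<psi> \<le> ?g ?S" using ov(2) True by (simp add: b_def)
        also have "\<dots> \<le> sum ?g ?\<S>" using f\<S> g0 ov(1) by (intro member_le_sum) auto
        finally show ?thesis .
      next
        case False
        then show ?thesis using g0 by (simp add: sum_nonneg)
      qed
    qed
    also have "\<dots> = (\<Sum>S\<in>?\<S>. \<Sum>\<psi>\<in>?I. of_bool (\<forall>y\<in>S. \<psi> y = \<phi> y) * (q ^ (2 * e\<^sub>K) * b ^ (card S - 1)))"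
      by (rule sum.swap)
    also have "\<dots> \<le> (\<Sum>S\<in>?\<S>. q ^ (2 * e\<^sub>K) * real r ^ n\<^sub>K * (b / (real r)\<^sup>2))"
    proof (rule sum_mono)
      fix S assume S: "S \<in> ?\<S>"
      have sk: "card S \<le> n\<^sub>K" using S fin by (auto intro: card_mono)
      have "(\<Sum>\<psi>\<in>?I. of_bool (\<forall>y\<in>S. \<psi> y = \<phi> y) * (q ^ (2 * e\<^sub>K) * b ^ (card S - 1)))
         = real (card {\<psi> \<in> ?I. \<forall>y\<in>S. \<psi> y = \<phi> y}) * (q ^ (2 * e\<^sub>K) * b ^ (card S - 1))"
        unfolding sum_distrib_right[symmetric] using parts_finite_PiE[OF R] by (simp add: of_bool_def sum.If_cases Int_def)
      also have "\<dots> = q ^ (2 * e\<^sub>K) * (real r ^ (n\<^sub>K - card S) * b ^ (card S - 1))"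
        using card_agreeing[OF R \<phi>] S by simp
      also have "real r ^ (n\<^sub>K - card S) * b ^ (card S - 1) \<le> real r ^ n\<^sub>K * (b / (real r)\<^sup>2)"
      proof -
        define s where "s = card S - 2"
        have "2 \<le> card S" using S by simp
        then have s: "card S = Suc (Suc s)" unfolding s_def by arith
        have e: "n\<^sub>K = (n\<^sub>K - card S) + s + 2" using sk s by simp
        have "real r ^ n\<^sub>K = real r ^ (n\<^sub>K - card S) * real r ^ s * (real r)\<^sup>2"
          unfolding power_add[symmetric] by (rule arg_cong[OF e])
        then have "real r ^ n\<^sub>K * (b / (real r)\<^sup>2) = real r ^ (n\<^sub>K - card S) * (real r ^ s * b)"
          using r by simp
        moreover have "b ^ (card S - 1) \<le> real r ^ s * b"
          using s b0 r unfolding b_def by (simp add: mult.commute mult_right_mono power_mono)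
        ultimately show ?thesis by (simp add: mult_left_mono)
      qed
      finally show "(\<Sum>\<psi>\<in>?I. of_bool (\<forall>y\<in>S. \<psi> y = \<phi> y) * (q ^ (2 * e\<^sub>K) * b ^ (card S - 1)))
        \<le> q ^ (2 * e\<^sub>K) * real r ^ n\<^sub>K * (b / (real r)\<^sup>2)"
        using q by (simp add: mult_left_mono mult.assoc)
    qed
    also have "\<dots> = real (card ?\<S>) * (q ^ (2 * e\<^sub>K) * real r ^ n\<^sub>K * (b / (real r)\<^sup>2))" by simp
    also have "\<dots> \<le> 2 ^ n\<^sub>K * (q ^ (2 * e\<^sub>K) * real r ^ n\<^sub>K * (b / (real r)\<^sup>2))"
    proof (rule mult_right_mono)
      show "real (card ?\<S>) \<le> 2 ^ n\<^sub>K" using of_nat_mono[OF c\<S>, where 'a = real] by simp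
    qed (use q b0 in auto)
    also have "q ^ (2 * e\<^sub>K) = q ^ e\<^sub>K * q ^ e\<^sub>K" by (simp add: mult_2 power_add)
    also have "2 ^ n\<^sub>K * (q ^ e\<^sub>K * q ^ e\<^sub>K * real r ^ n\<^sub>K * (b / (real r)\<^sup>2)) = q ^ e\<^sub>K * D * \<mu>"
      by (simp add: D_def \<mu>_def mult_ac)
    finally show ?thesis .
  qed
  have \<mu>sum: "\<mu> = (\<Sum>\<phi>\<in>?I. q ^ card (copy_edges \<phi>))"
    using parts_card_PiE[OF R] by (simp add: card_copy_edges \<mu>_def)
  have Delta: "(\<Sum>\<phi>\<in>?I. \<Sum>\<psi>\<in>?I. ?t \<phi> \<psi>) \<le> D * \<mu>\<^sup>2"
  proof -
    have "(\<Sum>\<phi>\<in>?I. \<Sum>\<psi>\<in>?I. ?t \<phi> \<psi>) \<le> (\<Sum>\<phi>\<in>?I. q ^ e\<^sub>K * D * \<mu>)" using row by (rule sum_mono)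
    also have "\<dots> = D * \<mu>\<^sup>2" using parts_card_PiE[OF R] by (simp add: \<mu>_def power2_eq_square mult_ac)
    finally show ?thesis .
  qed
  \<comment> \<open>The diagonal pairs alone contribute \<open>\<mu>\<close> to the Janson sum,
    since copies have edges here; comparison with \<open>D * \<mu>\<^sup>2\<close> gives the
    claim.\<close>
  have ge1: "1 \<le> D * \<mu>"
  proof -
    have "\<mu> \<le> (\<Sum>\<phi>\<in>?I. \<Sum>\<psi>\<in>?I. ?t \<phi> \<psi>)"
      unfolding \<mu>sum
    proof (rule sum_mono)
      fix \<phi> assume \<phi>: "\<phi> \<in> ?I"
      have "copy_edges \<phi> \<noteq> {}" using False by (simp add: copy_edges_def)
      then have "q ^ card (copy_edges \<phi>) = ?t \<phi> \<phi>" by simp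
      also have "\<dots> \<le> (\<Sum>\<psi>\<in>?I. ?t \<phi> \<psi>)"
        using parts_finite_PiE[OF R] \<phi> q by (intro member_le_sum) auto
      finally show "q ^ card (copy_edges \<phi>) \<le> (\<Sum>\<psi>\<in>?I. ?t \<phi> \<psi>)" .
    qed
    then have "\<mu> * 1 \<le> \<mu> * (D * \<mu>)" using Delta by (simp add: power2_eq_square mult_ac)
    then show ?thesis using \<mu>0 by (rule mult_left_le_imp_le)
  qed
  have "rexp (potential_edges K N) q (\<lambda>W. of_bool (real (card {\<phi> \<in> ?I. copy_edges \<phi> \<subseteq> W}) < \<mu> / 8)) \<le> exp (- 1 / (8 * D))"
  proof (rule janson_lower_tail[OF finite_potential_edges parts_finite_PiE[OF R] _ _ _ D0 \<mu>sum ge1 Delta])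
    show "copy_edges \<phi> \<subseteq> potential_edges K N" if "\<phi> \<in> ?I" for \<phi>
      using copy_edges_subset[OF that] R by (auto simp: parts_def)
  qed (use q in auto)
  also have "- 1 / (8 * D) = - ((real r)\<^sup>2 * q powr \<delta>) / (8 * 2 ^ n\<^sub>K)"
    using r q by (simp add: D_def b_def powr_minus field_simps)
  finally show ?thesis unfolding \<mu>_def copies_def .
qed

text \<open>A union bound over at most \<open>2 ^ (N * n\<^sub>K)\<close> families, each estimated
  by the tail at the smallest part size \<open>m\<close>, where it is weakest.\<close>

lemma many_copies_prob:
  assumes q: "0 < q" "q \<le> 1" and m: "0 < m" "q powr - \<delta> \<le> real m"
  shows "rexp (potential_edges K N) q (\<lambda>W. of_bool (\<not> many_copies N m q W)) \<le>
    2 ^ (N * n\<^sub>K) * exp (- ((real m)\<^sup>2 * q powr \<delta>) / (8 * 2 ^ n\<^sub>K))"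
proof -
  let ?X = "potential_edges K N"
  obtain y0 where y0: "y0 \<in> verts K" using ne by auto
  define \<R> where "\<R> = {R \<in> PiE (verts K) (\<lambda>_. Pow {..<N}). m < card (R y0) \<and> parts N (card (R y0)) R}"
  have f: "finite (PiE (verts K) (\<lambda>_. Pow {..<N}))" using fin by (intro finite_PiE) auto
  then have f\<R>: "finite \<R>" unfolding \<R>_def by auto
  have "card \<R> \<le> card (PiE (verts K) (\<lambda>_. Pow {..<N}))"
    unfolding \<R>_def using f by (intro card_mono) auto
  also have "\<dots> = 2 ^ (N * n\<^sub>K)" using fin by (simp add: card_PiE card_Pow power_mult)
  finally have c\<R>: "card \<R> \<le> 2 ^ (N * n\<^sub>K)" .
  define bad where "bad R W = (of_bool (real (card (copies W R)) < real (card (R y0)) ^ n\<^sub>K * q ^ e\<^sub>K / 8) :: real)" for R W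
  have "rexp ?X q (\<lambda>W. of_bool (\<not> many_copies N m q W)) \<le> rexp ?X q (\<lambda>W. \<Sum>R\<in>\<R>. bad R W)"
  proof (rule rexp_mono)
    fix W
    have nn: "0 \<le> bad R W" for R by (simp add: bad_def)
    show "of_bool (\<not> many_copies N m q W) \<le> (\<Sum>R\<in>\<R>. bad R W)"
    proof (cases "many_copies N m q W")
      case True
      then show ?thesis using nn by (simp add: sum_nonneg)
    next
      case False
      then obtain r R where R: "m < r" "parts N r R" "real (card (copies W R)) < real r ^ n\<^sub>K * q ^ e\<^sub>K / 8"
        by (auto simp: many_copies_def not_le)
      \<comment> \<open>Values outside \<open>verts K\<close> do not affect the copies; restricting
        places the family in the finite set of the union bound.\<close>
      define R' where "R' = restrict R (verts K)"
      have r: "card (R' y0) = r" using R y0 by (auto simp: R'_def parts_def)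
      have "R' \<in> \<R>" unfolding \<R>_def using R r by (auto simp: R'_def parts_def)
      moreover have "PiE (verts K) R' = PiE (verts K) R" by (rule PiE_cong) (simp add: R'_def)
      then have "copies W R' = copies W R" by (simp add: copies_def)
      then have "bad R' W = 1" using R r by (simp add: bad_def)
      ultimately have "1 \<le> (\<Sum>R\<in>\<R>. bad R W)" using member_le_sum[of R' \<R> "\<lambda>R. bad R W"] f\<R> nn by auto
      then show ?thesis using False by simp
    qed
  qed (use q in auto)
  also have "\<dots> = (\<Sum>R\<in>\<R>. rexp ?X q (bad R))" by (simp add: rexp_sum)
  also have "\<dots> \<le> (\<Sum>R\<in>\<R>. exp (- ((real m)\<^sup>2 * q powr \<delta>) / (8 * 2 ^ n\<^sub>K)))"
  proof (rule sum_mono)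
    fix R assume "R \<in> \<R>"
    then have R: "m < card (R y0)" "parts N (card (R y0)) R" by (auto simp: \<R>_def)
    have "rexp ?X q (bad R) \<le> exp (- ((real (card (R y0)))\<^sup>2 * q powr \<delta>) / (8 * 2 ^ n\<^sub>K))"
      unfolding bad_def using R m by (intro copies_lower_tail q) auto
    also have "\<dots> \<le> exp (- ((real m)\<^sup>2 * q powr \<delta>) / (8 * 2 ^ n\<^sub>K))"
    proof -
      have "(real m)\<^sup>2 * q powr \<delta> \<le> (real (card (R y0)))\<^sup>2 * q powr \<delta>"
        using R by (intro mult_right_mono power_mono) auto
      then show ?thesis by (simp add: divide_right_mono)
    qed
    finally show "rexp ?X q (bad R) \<le> \<dots>" .
  qed
  also have "\<dots> = real (card \<R>) * exp (- ((real m)\<^sup>2 * q powr \<delta>) / (8 * 2 ^ n\<^sub>K))" by simp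
  also have "\<dots> \<le> 2 ^ (N * n\<^sub>K) * exp (- ((real m)\<^sup>2 * q powr \<delta>) / (8 * 2 ^ n\<^sub>K))"
  proof (rule mult_right_mono)
    show "real (card \<R>) \<le> 2 ^ (N * n\<^sub>K)" using of_nat_mono[OF c\<R>, where 'a = real] by simp
  qed simp
  finally show ?thesis .
qed

text \<open>The spread cover applied to the edge sets of labellings, which have at most
  \<open>e\<^sub>K * m\<close> elements. Fragments thus vanish once \<open>\<gamma> ^ r\<close>
  falls below the reciprocal of that size.\<close>

lemma factor_exists_prob:
  assumes R: "parts N m R" and m: "exp 2 \<le> real m" and q: "0 < q" "q \<le> 1"
    and \<gamma>: "0 < \<gamma>" and x: "x = exp 1 * ((exp 2 / real m) powr (1 / \<delta>) / q) / \<gamma>" "x \<le> 1 / 2"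
    and L: "real (e\<^sub>K * m) * \<gamma> ^ r < 1"
    and p: "real (r * n) * q \<le> p" "p \<le> 1"
  shows "rexp (potential_edges K N) p (\<lambda>W. of_bool (factors W R = {})) \<le> (2 * real r * x) ^ n"
proof -
  let ?X = "potential_edges K N"
  let ?I = "labellings R m"
  have R': "\<And>y. y \<in> verts K \<Longrightarrow> finite (R y)" "\<And>y. y \<in> verts K \<Longrightarrow> card (R y) = m"
    using R parts_finite[OF R] by (auto simp: parts_def)
  have "0 \<le> real (r * n) * q" using q by simp
  then have p0: "0 \<le> p" using p by linarith
  have "card ?I \<noteq> 0" using card_labellings[OF R'] by simp
  then have ne: "?I \<noteq> {}" by auto
  have "rexp ?X p (\<lambda>W. of_bool (factors W R = {})) \<le> rexp ?X p (\<lambda>W. of_bool (\<forall>l\<in>?I. \<not> label_edges R l \<subseteq> W))"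
    using p0 p factors_of_labelling[OF R'] by (intro rexp_mono) auto
  also have "\<dots> \<le> (2 * real r * x) ^ n"
  proof (rule spread_cover[OF finite_potential_edges _ q \<gamma> x _ ne _ _ _ L p])
    show "0 \<le> (exp 2 / real m) powr (1 / \<delta>)" by simp
    show "finite ?I" using R' by (intro finite_labellings)
    show "label_edges R l \<subseteq> ?X" for l using R by (intro label_edges_subset) (auto simp: parts_def)
    show "real (card (label_edges R l)) \<le> real (e\<^sub>K * m)" if "l \<in> ?I" for l
      using card_label_edges_le[OF that] of_nat_le_iff by blast
    show "real (card {l \<in> ?I. U \<subseteq> label_edges R l}) \<le> real (card ?I) * ((exp 2 / real m) powr (1 / \<delta>)) ^ card U"
      if "U \<subseteq> ?X" for U
      using finite_subset[OF that finite_potential_edges] by (intro label_edges_spread[OF R' m])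
  qed
  finally show ?thesis .
qed

end

section \<open>Asymptotics\<close>

text \<open>The product is \<open>N! / m!\<close>. The leftover size is tuned so that
  \<open>m! \<le> N^m \<le> exp (N + ln N) \<le> exp (2 N)\<close>, and
  \<open>N! \<ge> (N / e)^N\<close> costs one more factor \<open>exp (- N)\<close>.\<close>

lemma fact_quotient_ge:
  assumes "1 \<le> ln (real N)" "real m \<le> real N / ln (real N) + 1" "m \<le> N"
  shows "(\<Prod>i=1..N - m. real (m + i)) \<ge> real N ^ N * exp (- 3 * real N)"
proof -
  have N0: "0 < N" using assms(1) by (cases N) auto
  have "fact N = (fact m :: real) * (\<Prod>i=1..N - m. real (m + i))"
  proof -
    have "fact (m + j) = (fact m :: real) * (\<Prod>i=1..j. real (m + i))" for j
      by (induction j) (simp_all add: algebra_simps)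
    from this[of "N - m"] show ?thesis using assms(3) by simp
  qed
  moreover have "(fact m :: real) \<le> exp (2 * real N)"
  proof -
    have "(fact m :: real) \<le> real m ^ m" using fact_le_power[of m, where 'a = real] by simp
    also have "\<dots> \<le> real N ^ m" using assms(3) by (intro power_mono) auto
    also have "\<dots> = exp (real m * ln (real N))" using N0 by (simp add: exp_of_nat_mult)
    also have "\<dots> \<le> exp ((real N / ln (real N) + 1) * ln (real N))"
      using assms by (intro iffD2[OF exp_le_cancel_iff] mult_right_mono) auto
    also have "(real N / ln (real N) + 1) * ln (real N) = real N + ln (real N)"
      using assms(1) by (simp add: field_simps)
    also have "\<dots> \<le> 2 * real N" using ln_le_minus_one[of "real N"] N0 by simp
    finally show ?thesis by simp
  qed
  ultimately have "fact N \<le> exp (2 * real N) * (\<Prod>i=1..N - m. real (m + i))"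
    by (simp add: mult_right_mono prod_nonneg)
  moreover have "(real N / exp 1) ^ N \<le> fact N" by (rule fact_ge_power)
  moreover have "(real N / exp 1) ^ N = real N ^ N * exp (- real N)"
    by (simp add: power_divide exp_minus exp_of_nat_mult[symmetric] field_simps)
  ultimately have "real N ^ N * exp (- real N) \<le> exp (2 * real N) * (\<Prod>i=1..N - m. real (m + i))" by linarith
  then have "exp (- 2 * real N) * (real N ^ N * exp (- real N)) \<le> exp (- 2 * real N) * (exp (2 * real N) * (\<Prod>i=1..N - m. real (m + i)))"
    by (intro mult_left_mono) auto
  moreover have "exp (- 2 * real N) * (real N ^ N * exp (- real N)) = real N ^ N * exp (- 3 * real N)"
    by (simp add: mult_ac flip: exp_add)
  moreover have "exp (- 2 * real N) * (exp (2 * real N) * (\<Prod>i=1..N - m. real (m + i))) = (\<Prod>i=1..N - m. real (m + i))"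
    by (simp flip: exp_add mult.assoc)
  ultimately show ?thesis by linarith
qed

context sparse_mgraph begin

lemma n\<^sub>K_pos: "0 < n\<^sub>K"
  using ne fin by (simp add: card_gt_0_iff)

text \<open>Per unit of \<open>N\<close>, the exponent pays 3 for each of the
  \<open>n\<^sub>K - 1\<close> factorial quotients, \<open>e\<^sub>K\<close> for the powers of 2
  lost by \<open>q = p / 2\<close>, 3 for the factor \<open>1 / 8\<close> and 1 for the final
  halving.\<close>

lemma greedy_product_ge:
  assumes N: "1 \<le> ln (real N)" "real m \<le> real N / ln (real N) + 1" "m \<le> N"
    and q: "0 \<le> q" "q \<le> 1 / 2"
  shows "(real N ^ (n\<^sub>K - 1) * (2 * q) ^ e\<^sub>K) ^ N * exp (- (real (3 * n\<^sub>K + e\<^sub>K + 4) * real N))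
     \<le> (\<Prod>i=1..N - m. real (m + i) ^ n\<^sub>K * q ^ e\<^sub>K / 8 / real (m + i)) / 2"
proof -
  define k where "k = n\<^sub>K - 1"
  have k: "n\<^sub>K = Suc k" using n\<^sub>K_pos by (simp add: k_def)
  have N1: "1 \<le> real N" using N(1) by (cases N) auto
  define P where "P = (\<Prod>i=1..N - m. real (m + i))"
  define c where "c = q ^ e\<^sub>K / 8"
  have c: "0 \<le> c" "c \<le> 1" using q by (auto simp: c_def intro!: order_trans[OF power_le_one])
  have "(\<Prod>i=1..N - m. real (m + i) ^ n\<^sub>K * q ^ e\<^sub>K / 8 / real (m + i)) = (\<Prod>i=1..N - m. real (m + i) ^ k * c)"
  proof (intro prod.cong refl)
    have *: "z ^ n\<^sub>K * q ^ e\<^sub>K / 8 / z = z ^ k * c" if "0 < z" for z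
      using that by (simp add: k c_def)
    show "real (m + i) ^ n\<^sub>K * q ^ e\<^sub>K / 8 / real (m + i) = real (m + i) ^ k * c" if "i \<in> {1..N - m}" for i
      using that by (intro *) simp
  qed
  also have "\<dots> = P ^ k * c ^ (N - m)"
    by (simp add: prod.distrib prod_power_distrib P_def)
  also have "\<dots> \<ge> (real N ^ N * exp (- 3 * real N)) ^ k * c ^ N"
    unfolding P_def using fact_quotient_ge[OF N] c by (intro mult_mono power_mono power_decreasing) (auto simp: prod_nonneg)
  finally have ge: "(real N ^ N * exp (- 3 * real N)) ^ k * c ^ N \<le> (\<Prod>i=1..N - m. real (m + i) ^ n\<^sub>K * q ^ e\<^sub>K / 8 / real (m + i))" .
  have exp2: "(2::real) \<le> exp 1" using exp_ge_add_one_self[of 1] by simp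
  have A: "(2 :: real) ^ e\<^sub>K * exp (- real e\<^sub>K) \<le> 1"
  proof -
    have "(2 :: real) ^ e\<^sub>K \<le> exp 1 ^ e\<^sub>K" using exp2 by (intro power_mono) auto
    also have "\<dots> = exp (real e\<^sub>K)" by (simp add: exp_of_nat_mult[symmetric])
    finally have "(2 :: real) ^ e\<^sub>K * exp (- real e\<^sub>K) \<le> exp (real e\<^sub>K) * exp (- real e\<^sub>K)" by (intro mult_right_mono) auto
    then show ?thesis by (simp flip: exp_add)
  qed
  have B: "exp (- 3 :: real) \<le> 1 / 8"
  proof -
    have "(2 :: real) ^ 3 \<le> exp 1 ^ 3" using exp2 by (intro power_mono) auto
    then have "8 \<le> exp (3 :: real)" by (simp add: exp_of_nat_mult[symmetric])
    then show ?thesis by (simp add: exp_minus field_simps)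
  qed
  have D: "exp (- real N) \<le> 1 / 2"
  proof -
    have "2 \<le> exp (real N)" using exp_ge_add_one_self[of "real N"] N1 by linarith
    then show ?thesis by (simp add: exp_minus field_simps)
  qed
  have cc: "(2 * q) ^ e\<^sub>K * exp (- real (e\<^sub>K + 3)) \<le> c"
  proof -
    have "(2 * q) ^ e\<^sub>K * exp (- real (e\<^sub>K + 3)) = q ^ e\<^sub>K * ((2 ^ e\<^sub>K * exp (- real e\<^sub>K)) * exp (- 3))"
      by (simp add: power_mult_distrib mult_ac exp_diff exp_minus field_simps exp_add)
    also have "\<dots> \<le> q ^ e\<^sub>K * (1 * (1 / 8))" using A B q by (intro mult_left_mono mult_mono) auto
    finally show ?thesis by (simp add: c_def)
  qed
  have "(real N ^ k * (2 * q) ^ e\<^sub>K) ^ N * exp (- (real (3 * n\<^sub>K + e\<^sub>K + 4) * real N))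
    \<le> (real N ^ k * (2 * q) ^ e\<^sub>K) ^ N * exp (- (3 * real k + real (e\<^sub>K + 3) + 1) * real N)"
    using q by (intro mult_left_mono) (auto simp: k algebra_simps)
  also have "\<dots> = (real N ^ N * exp (- 3 * real N)) ^ k * ((2 * q) ^ e\<^sub>K * exp (- real (e\<^sub>K + 3))) ^ N * exp (- real N)"
  proof -
    have "exp (- (3 * real k + real (e\<^sub>K + 3) + 1) * real N) = exp (- 3 * real N) ^ k * exp (- real (e\<^sub>K + 3)) ^ N * exp (- real N)"
      unfolding exp_of_nat_mult[symmetric] exp_add[symmetric] by (simp add: algebra_simps)
    moreover have "(real N ^ k) ^ N = (real N ^ N) ^ k" by (simp add: power_mult[symmetric] mult.commute)
    ultimately show ?thesis by (simp add: power_mult_distrib mult_ac)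
  qed
  also have "\<dots> \<le> (real N ^ N * exp (- 3 * real N)) ^ k * c ^ N * (1 / 2)"
    using cc D c q by (intro mult_mono mult_nonneg_nonneg power_mono) auto
  also have "\<dots> \<le> (\<Prod>i=1..N - m. real (m + i) ^ n\<^sub>K * q ^ e\<^sub>K / 8 / real (m + i)) / 2"
    using ge by simp
  finally show ?thesis by (simp add: k)
qed

text \<open>The room comes from \<open>\<alpha> * \<delta> < 1\<close>: the Janson exponent, of
  order at least \<open>N^(2 - \<alpha>\<delta>) / (ln N)^2\<close>, beats the \<open>O(N)\<close>
  of the union bound, and the spread, about \<open>m^(-1/\<delta>)\<close>, is polynomially smaller
  than \<open>p\<close>. The second round dictates the final bound.\<close>

lemma factor_count:
  assumes \<alpha>: "0 < \<alpha>" "\<alpha> * \<delta> < 1" and a: "0 < a"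
  shows "\<exists>c>0. \<exists>N0. \<forall>N\<ge>N0. \<forall>p. a * real N powr - \<alpha> \<le> p \<and> p \<le> 1 \<longrightarrow>
    rexp (potential_edges K N) p (\<lambda>W. of_bool (real (card (factors W (\<lambda>_. {..<N}))) <
      (real N ^ (n\<^sub>K - 1) * p ^ e\<^sub>K) ^ N * exp (- (real (3 * n\<^sub>K + e\<^sub>K + 4) * real N))))
    \<le> exp (- c * (ln (real N))\<^sup>2)"
proof -
  \<comment> \<open>The exponent gap is split into four parts: up to logarithms, spread over round
    density is \<open>N^(-4 \<eta>)\<close>, and the shrinking factor
    \<open>\<gamma> = N^(-\<eta>)\<close> costs one \<open>\<eta>\<close>. What is left absorbs
    logarithms and constants with the failure bound \<open>N^(-\<eta> / 2)\<close>.\<close>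
  define \<eta> where "\<eta> = (1 / \<delta> - \<alpha>) / 4"
  define A where "A = 1 / \<delta>"
  have "4 * \<eta> = A - \<alpha>" by (simp add: A_def \<eta>_def)
  then have A: "0 < A" "\<alpha> = A - 4 * \<eta>" using \<delta> by (auto simp: A_def)
  have \<eta>: "0 < \<eta>" using \<alpha> \<delta> by (simp add: \<eta>_def field_simps)
  \<comment> \<open>So many rounds make \<open>\<gamma> ^ r \<le> N^(-2)\<close>, which outweighs
    the linear size of a factor.\<close>
  define r where "r = nat \<lceil>2 / \<eta>\<rceil>"
  have r: "2 / \<eta> \<le> real r" using \<eta> by (simp add: r_def)
  have r0: "0 < r" using \<eta> by (simp add: r_def)
  define \<kappa> where "\<kappa> = (a / 2) powr \<delta>"
  have \<kappa>: "0 < \<kappa>" using a by (simp add: \<kappa>_def)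
  \<comment> \<open>\<open>ln 2\<close> per vertex of \<open>K\<close> cancels the union bound; the
    extra 1 leaves the failure bound \<open>exp (- N)\<close>.\<close>
  define k where "k = real n\<^sub>K * ln 2 + 1"
  have a\<delta>: "0 < \<alpha> * \<delta>" using \<alpha> \<delta> by simp
  have "eventually (\<lambda>N. real N / ln (real N) + 1 \<le> real N) at_top" by real_asymp
  moreover have "eventually (\<lambda>N. exp 2 \<le> real N / ln (real N)) at_top" by real_asymp
  moreover have "eventually (\<lambda>N. 1 \<le> ln (real N)) at_top" by real_asymp
  moreover have "eventually (\<lambda>N. real e\<^sub>K < real N) at_top" by real_asymp
  moreover have "eventually (\<lambda>N. exp (- real N) + 2 * exp (- (\<eta> / 2) * (ln (real N))\<^sup>2) \<le> exp (- (\<eta> / 4) * (ln (real N))\<^sup>2)) at_top"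
    using \<eta> by real_asymp
  moreover have "eventually (\<lambda>N. (1 / \<kappa>) * real N powr (\<alpha> * \<delta>) \<le> real N / ln (real N)) at_top"
  proof -
    define b where "b = \<alpha> * \<delta>"
    show ?thesis using a\<delta> \<alpha>(2) \<kappa> unfolding b_def[symmetric] by real_asymp
  qed
  moreover have "eventually (\<lambda>N. real N * k \<le> (real N / ln (real N))\<^sup>2 * ((\<kappa> / (8 * 2 ^ n\<^sub>K)) * real N powr (- (\<alpha> * \<delta>)))) at_top"
  proof -
    define b c where "b = \<alpha> * \<delta>" and "c = \<kappa> / (8 * 2 ^ n\<^sub>K)"
    have "0 < c" using \<kappa> by (simp add: c_def)
    then show ?thesis using a\<delta> \<alpha>(2) unfolding b_def[symmetric] c_def[symmetric] by real_asymp
  qed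
  moreover have "eventually (\<lambda>N. 2 * real r * exp 1 * ((exp 2 * ln (real N) / real N) powr A *
      (real r * (ln (real N) + 1) * (2 / a) * real N powr (A - 4 * \<eta>))) * real N powr \<eta> \<le> real N powr (- \<eta> / 2)) at_top"
    using \<eta> A(1) a by real_asymp
  ultimately have "eventually (\<lambda>N. real N / ln (real N) + 1 \<le> real N \<and> exp 2 \<le> real N / ln (real N) \<and> 1 \<le> ln (real N)
     \<and> real e\<^sub>K < real N
     \<and> exp (- real N) + 2 * exp (- (\<eta> / 2) * (ln (real N))\<^sup>2) \<le> exp (- (\<eta> / 4) * (ln (real N))\<^sup>2)
     \<and> (1 / \<kappa>) * real N powr (\<alpha> * \<delta>) \<le> real N / ln (real N)
     \<and> real N * k \<le> (real N / ln (real N))\<^sup>2 * ((\<kappa> / (8 * 2 ^ n\<^sub>K)) * real N powr (- (\<alpha> * \<delta>)))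
     \<and> 2 * real r * exp 1 * ((exp 2 * ln (real N) / real N) powr A *
      (real r * (ln (real N) + 1) * (2 / a) * real N powr (A - 4 * \<eta>))) * real N powr \<eta> \<le> real N powr (- \<eta> / 2)) at_top"
    by eventually_elim simp
  then obtain N0 where N0: "\<And>N. N0 \<le> N \<Longrightarrow> real N / ln (real N) + 1 \<le> real N \<and> exp 2 \<le> real N / ln (real N) \<and> 1 \<le> ln (real N)
     \<and> real e\<^sub>K < real N
     \<and> exp (- real N) + 2 * exp (- (\<eta> / 2) * (ln (real N))\<^sup>2) \<le> exp (- (\<eta> / 4) * (ln (real N))\<^sup>2)
     \<and> (1 / \<kappa>) * real N powr (\<alpha> * \<delta>) \<le> real N / ln (real N)
     \<and> real N * k \<le> (real N / ln (real N))\<^sup>2 * ((\<kappa> / (8 * 2 ^ n\<^sub>K)) * real N powr (- (\<alpha> * \<delta>)))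
     \<and> 2 * real r * exp 1 * ((exp 2 * ln (real N) / real N) powr A *
      (real r * (ln (real N) + 1) * (2 / a) * real N powr (A - 4 * \<eta>))) * real N powr \<eta> \<le> real N powr (- \<eta> / 2)"
    unfolding eventually_at_top_linorder by blast
  have "rexp (potential_edges K N) p (\<lambda>W. of_bool (real (card (factors W (\<lambda>_. {..<N}))) <
      (real N ^ (n\<^sub>K - 1) * p ^ e\<^sub>K) ^ N * exp (- (real (3 * n\<^sub>K + e\<^sub>K + 4) * real N))))
    \<le> exp (- (\<eta> / 4) * (ln (real N))\<^sup>2)"
    if N: "N0 \<le> N" and p: "a * real N powr - \<alpha> \<le> p" "p \<le> 1" for N p
  proof -
    let ?X = "potential_edges K N"
    note big = N0[OF N]
    have lnN: "1 \<le> ln (real N)" using big by simp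
    have N1: "1 \<le> real N" using lnN by (cases N) auto
    have Npos: "0 < real N" using N1 by linarith
    define q where "q = p / 2"
    have p0: "0 < p" using p(1) a Npos by (smt (verit) mult_pos_pos powr_gt_zero)
    have q: "0 < q" "q \<le> 1 / 2" "q \<le> 1" using p0 p by (auto simp: q_def)
    have qge: "a / 2 * real N powr - \<alpha> \<le> q" using p by (simp add: q_def)
    define m where "m = nat \<lceil>real N / ln (real N)\<rceil>"
    have NlnN: "0 < real N / ln (real N)" using Npos lnN by (intro divide_pos_pos) linarith+
    have m: "real N / ln (real N) \<le> real m" "real m \<le> real N / ln (real N) + 1"
      using NlnN unfolding m_def by linarith+
    have mN: "m \<le> N" using m big by linarith
    have m0: "0 < m" using m NlnN by (cases m) auto
    have me: "exp 2 \<le> real m" using m big by linarith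
    have q\<delta>: "\<kappa> * real N powr (- (\<alpha> * \<delta>)) \<le> q powr \<delta>"
    proof -
      have "(a / 2 * real N powr - \<alpha>) powr \<delta> = (a / 2) powr \<delta> * (real N powr - \<alpha>) powr \<delta>"
        by (rule powr_mult)
      then have "\<kappa> * real N powr (- (\<alpha> * \<delta>)) = (a / 2 * real N powr - \<alpha>) powr \<delta>"
        by (simp add: \<kappa>_def powr_powr)
      also have "\<dots> \<le> q powr \<delta>" using qge \<delta> a by (intro powr_mono2) auto
      finally show ?thesis .
    qed
    have qm: "q powr - \<delta> \<le> real m"
    proof -
      have "q powr - \<delta> = 1 / q powr \<delta>" by (simp add: powr_minus_divide)
      also have "\<dots> \<le> 1 / (\<kappa> * real N powr (- (\<alpha> * \<delta>)))"
        using q\<delta> \<kappa> Npos by (intro frac_le) simp_all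
      also have "\<dots> = (1 / \<kappa>) * real N powr (\<alpha> * \<delta>)" by (simp add: powr_minus_divide)
      also have "\<dots> \<le> real m" using big m by linarith
      finally show ?thesis .
    qed
    have round1: "rexp ?X q (\<lambda>W. of_bool (\<not> many_copies N m q W)) \<le> exp (- real N)"
    proof -
      have "real N * k \<le> (real m)\<^sup>2 * q powr \<delta> / (8 * 2 ^ n\<^sub>K)"
      proof -
        have "real N * k \<le> (real N / ln (real N))\<^sup>2 * ((\<kappa> / (8 * 2 ^ n\<^sub>K)) * real N powr (- (\<alpha> * \<delta>)))"
          using big by blast
        also have "\<dots> = (real N / ln (real N))\<^sup>2 * (\<kappa> * real N powr (- (\<alpha> * \<delta>))) / (8 * 2 ^ n\<^sub>K)" by simp
        also have "\<dots> \<le> (real m)\<^sup>2 * q powr \<delta> / (8 * 2 ^ n\<^sub>K)"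
          using q\<delta> m NlnN \<kappa> by (intro divide_right_mono mult_mono power_mono) auto
        finally show ?thesis .
      qed
      then have "exp (- ((real m)\<^sup>2 * q powr \<delta>) / (8 * 2 ^ n\<^sub>K)) \<le> exp (- (real N * k))" by simp
      then have "2 ^ (N * n\<^sub>K) * exp (- ((real m)\<^sup>2 * q powr \<delta>) / (8 * 2 ^ n\<^sub>K)) \<le> 2 ^ (N * n\<^sub>K) * exp (- (real N * k))"
        by (rule mult_left_mono) simp
      also have "\<dots> = exp (- real N)"
      proof -
        have two: "(2 :: real) ^ (N * n\<^sub>K) = exp (real (N * n\<^sub>K) * ln 2)" unfolding exp_of_nat_mult by simp
        show ?thesis unfolding two exp_add[symmetric] by (simp add: k_def algebra_simps)
      qed
      finally show ?thesis using many_copies_prob[OF q(1,3) m0 qm, of N] by linarith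
    qed
    define n where "n = nat \<lceil>ln (real N)\<rceil>"
    have n: "ln (real N) \<le> real n" "real n \<le> ln (real N) + 1" using lnN unfolding n_def by linarith+
    have n0: "0 < n" using n lnN by (cases n) auto
    \<comment> \<open>The density \<open>q\<close> of the second round is shared among
      \<open>n\<close> repetitions of \<open>r\<close> cover rounds; as \<open>n\<close> is about
      \<open>ln N\<close>, the loss is only logarithmic.\<close>
    define q1 where "q1 = q / real (r * n)"
    have rn: "1 \<le> real (r * n)" using r0 n0 by (simp add: Suc_le_eq flip: of_nat_mult)
    have q1: "0 < q1" "q1 \<le> 1" "real (r * n) * q1 \<le> q"
      using q rn by (auto simp: q1_def divide_le_eq)
    define \<gamma> where "\<gamma> = real N powr - \<eta>"
    have \<gamma>: "0 < \<gamma>" using Npos by (simp add: \<gamma>_def)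
    define x where "x = exp 1 * ((exp 2 / real m) powr (1 / \<delta>) / q1) / \<gamma>"
    have xbound: "2 * real r * x \<le> real N powr (- \<eta> / 2)"
    proof -
      have "(exp 2 / real m) powr (1 / \<delta>) \<le> (exp 2 * ln (real N) / real N) powr A"
      proof -
        have "exp 2 / real m \<le> exp 2 / (real N / ln (real N))"
          using m(1) NlnN by (intro frac_le) auto
        then show ?thesis unfolding A_def using \<delta> by (intro powr_mono2) auto
      qed
      moreover have "1 / q1 \<le> real r * (ln (real N) + 1) * (2 / a) * real N powr (A - 4 * \<eta>)"
      proof -
        have "1 / q1 = real r * real n * (1 / q)" by (simp add: q1_def)
        also have "1 / q \<le> 1 / (a / 2 * real N powr - \<alpha>)"
          using qge a Npos by (intro frac_le) auto
        also have "1 / (a / 2 * real N powr - \<alpha>) = (2 / a) * real N powr (A - 4 * \<eta>)"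
          by (simp add: A(2) powr_minus_divide flip: A(2))
        finally have "1 / q1 \<le> real r * real n * ((2 / a) * real N powr (A - 4 * \<eta>))"
          by (simp add: mult_left_mono)
        also have "\<dots> \<le> real r * (ln (real N) + 1) * ((2 / a) * real N powr (A - 4 * \<eta>))"
          using n a by (intro mult_right_mono mult_left_mono) auto
        finally show ?thesis by (simp only: mult.assoc)
      qed
      ultimately have "(exp 2 / real m) powr (1 / \<delta>) * (1 / q1) \<le> (exp 2 * ln (real N) / real N) powr A *
         (real r * (ln (real N) + 1) * (2 / a) * real N powr (A - 4 * \<eta>))"
        using q1 by (intro mult_mono) auto
      then have "2 * real r * exp 1 * ((exp 2 / real m) powr (1 / \<delta>) * (1 / q1)) * real N powr \<eta> \<le>
        2 * real r * exp 1 * ((exp 2 * ln (real N) / real N) powr A *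
         (real r * (ln (real N) + 1) * (2 / a) * real N powr (A - 4 * \<eta>))) * real N powr \<eta>"
        by (intro mult_right_mono mult_left_mono) auto
      also have "\<dots> \<le> real N powr (- \<eta> / 2)" using big by blast
      also have "2 * real r * exp 1 * ((exp 2 / real m) powr (1 / \<delta>) * (1 / q1)) * real N powr \<eta> = 2 * real r * x"
        by (simp add: x_def \<gamma>_def powr_minus_divide)
      finally show ?thesis .
    qed
    have x0: "0 \<le> x" using q1 \<gamma> by (simp add: x_def)
    have "real N powr (- \<eta> / 2) \<le> 1" using N1 \<eta> powr_mono[of "- \<eta> / 2" 0 "real N"] by simp
    then have "2 * real r * x \<le> 1" using xbound by linarith
    moreover have "2 * x \<le> 2 * real r * x" using r0 x0 by (simp add: mult_le_cancel_right1 Suc_leI)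
    ultimately have x12: "x \<le> 1 / 2" by linarith
    have L: "real (e\<^sub>K * m) * \<gamma> ^ r < 1"
    proof -
      have "\<gamma> ^ r = real N powr (- \<eta> * real r)" using Npos by (simp add: \<gamma>_def powr_powr flip: powr_realpow)
      also have "\<dots> \<le> real N powr - 2" using r \<eta> N1 by (intro powr_mono) (auto simp: field_simps)
      also have "\<dots> = 1 / (real N)\<^sup>2" using Npos by (simp add: powr_minus_divide)
      finally have "real (e\<^sub>K * m) * \<gamma> ^ r \<le> real (e\<^sub>K * N) * (1 / (real N)\<^sup>2)"
        using mN \<gamma> by (intro mult_mono) (auto simp: mult_left_mono)
      also have "\<dots> = real e\<^sub>K / real N" using Npos by (simp add: power2_eq_square)
      also have "\<dots> < 1" using big Npos by simp
      finally show ?thesis .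
    qed
    have round2: "rexp ?X q (\<lambda>W. of_bool (factors W R = {})) \<le> exp (- (\<eta> / 2) * (ln (real N))\<^sup>2)"
      if R: "parts N m R" for R
    proof -
      have "rexp ?X q (\<lambda>W. of_bool (factors W R = {})) \<le> (2 * real r * x) ^ n"
        by (rule factor_exists_prob[OF R me q1(1,2) \<gamma> x_def x12 L q1(3) q(3)])
      also have "\<dots> \<le> (real N powr (- \<eta> / 2)) ^ n" using xbound x0 by (intro power_mono) auto
      also have "\<dots> = exp (- (\<eta> / 2 * ln (real N)) * real n)"
        using Npos by (simp add: powr_def exp_of_nat_mult[symmetric] mult_ac)
      also have "\<dots> \<le> exp (- (\<eta> / 2 * ln (real N)) * ln (real N))"
        using n \<eta> lnN by (simp add: mult_left_mono)
      finally show ?thesis by (simp add: power2_eq_square mult_ac)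
    qed
    have RN: "parts N (m + (N - m)) (\<lambda>_. {..<N})" using mN by (simp add: parts_def)
    define t where "t = (\<Prod>i=1..N - m. real (m + i) ^ n\<^sub>K * q ^ e\<^sub>K / 8 / real (m + i))"
    let ?T = "(real N ^ (n\<^sub>K - 1) * p ^ e\<^sub>K) ^ N * exp (- (real (3 * n\<^sub>K + e\<^sub>K + 4) * real N))"
    have tT: "?T \<le> t / 2"
      using greedy_product_ge[OF lnN m(2) mN, of q] q by (simp add: t_def q_def)
    let ?bad = "\<lambda>W. of_bool (real (card (factors W (\<lambda>_. {..<N}))) < t / 2) :: real"
    \<comment> \<open>Two independent rounds of density \<open>p / 2\<close> have joint density at
      most \<open>p\<close>, and having few factors is a decreasing event.\<close>
    have qq: "0 \<le> q + q - q * q" "q + q - q * q \<le> p"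
      using q mult_left_mono[of q 1 q] by (auto simp: q_def)
    have "rexp ?X p (\<lambda>W. of_bool (real (card (factors W (\<lambda>_. {..<N}))) < ?T)) \<le> rexp ?X p ?bad"
      using tT p0 p by (intro rexp_mono) auto
    also have "\<dots> \<le> rexp ?X (q + q - q * q) ?bad"
    proof -
      have "- 1 * ?bad W \<le> - 1 * ?bad W'" if "W \<subseteq> W'" "W' \<subseteq> ?X" for W W'
      proof -
        have "factors W (\<lambda>_. {..<N}) \<subseteq> factors W' (\<lambda>_. {..<N})"
          using that(1) unfolding factors_def by blast
        then have "card (factors W (\<lambda>_. {..<N})) \<le> card (factors W' (\<lambda>_. {..<N}))"
          using finite_factors[OF RN] by (intro card_mono) auto
        then show ?thesis by auto
      qed
      then have "rexp ?X (q + q - q * q) (\<lambda>W. - 1 * ?bad W) \<le> rexp ?X p (\<lambda>W. - 1 * ?bad W)"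
        using qq p by (intro rexp_mono_prob finite_potential_edges) auto
      then show ?thesis unfolding rexp_cmult by simp
    qed
    also have "\<dots> \<le> exp (- real N) + 2 * exp (- (\<eta> / 2) * (ln (real N))\<^sup>2)"
      using q by (intro two_round_count[OF q(1,3) _ _ round1 round2 RN t_def]) auto
    also have "\<dots> \<le> exp (- (\<eta> / 4) * (ln (real N))\<^sup>2)" using big by blast
    finally show ?thesis .
  qed
  then show ?thesis using \<eta> by (intro exI[of _ "\<eta> / 4"] conjI exI[of _ N0]) auto
qed

end

section \<open>The random multigraph and the collapsing process\<close>

text \<open>The bridge to the random multigraph: almost surely a sample is the indicator of a subset
  of \<open>X\<close>, with the weight of that subset in \<open>rexp\<close>.\<close>

lemma prob_Pi_bernoulli:
  assumes X: "finite X" and p: "0 \<le> p" "p \<le> 1"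
  shows "measure_pmf.prob (Pi_pmf X False (\<lambda>_. bernoulli_pmf p)) {r. P {x \<in> X. r x}} = rexp X p (\<lambda>W. of_bool (P W))"
proof -
  let ?M = "Pi_pmf X False (\<lambda>_. bernoulli_pmf p)"
  let ?F = "\<lambda>W x. x \<in> W"
  have inj: "inj_on ?F A" for A :: "'a set set" by (auto simp: inj_on_def fun_eq_iff)
  have fib: "{x \<in> X. ?F W x} = W" if "W \<in> Pow X" for W using that by auto
  have pm: "pmf ?M (?F W) = p ^ card W * (1 - p) ^ card (X - W)" if W: "W \<in> Pow X" for W
  proof -
    have "pmf ?M (?F W) = (\<Prod>x\<in>X. pmf (bernoulli_pmf p) (x \<in> W))"
      using W X by (subst pmf_Pi') auto
    also have "\<dots> = (\<Prod>x\<in>X. if x \<in> W then p else 1 - p)"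
      using p by (intro prod.cong) auto
    also have "\<dots> = p ^ card (X \<inter> W) * (1 - p) ^ card (X - W)"
      using X by (simp add: prod.If_cases Diff_eq Int_def Compl_eq)
    also have "X \<inter> W = W" using W by auto
    finally show ?thesis .
  qed
  have sub: "set_pmf ?M \<subseteq> ?F ` Pow X"
  proof
    fix r assume "r \<in> set_pmf ?M"
    then have "\<forall>x. x \<notin> X \<longrightarrow> r x = False" using set_Pi_pmf_subset[OF X, of False "\<lambda>_. bernoulli_pmf p"] by auto
    then have "r x = (x \<in> {x \<in> X. r x})" for x by (cases "x \<in> X") auto
    then have "r = ?F {x \<in> X. r x}" by (rule ext)
    then show "r \<in> ?F ` Pow X" by (rule image_eqI) auto
  qed
  let ?B = "{W \<in> Pow X. P W}"
  have "measure_pmf.prob ?M {r. P {x \<in> X. r x}} = measure_pmf.prob ?M (?F ` ?B)"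
  proof (rule measure_prob_cong_0)
    fix r assume "r \<in> {r. P {x \<in> X. r x}} - ?F ` ?B"
    then have "r \<notin> ?F ` Pow X" using fib by auto
    then show "pmf ?M r = 0" using sub by (auto simp: set_pmf_iff)
  next
    fix r assume r: "r \<in> ?F ` ?B - {r. P {x \<in> X. r x}}"
    then obtain W where W: "W \<in> Pow X" "P W" "r = ?F W" by auto
    then show "pmf ?M r = 0" using r fib[OF W(1)] by auto
  qed
  also have "\<dots> = (\<Sum>W\<in>?B. pmf ?M (?F W))"
    using X by (subst measure_measure_pmf_finite) (auto simp: sum.reindex[OF inj])
  also have "\<dots> = (\<Sum>W\<in>?B. p ^ card W * (1 - p) ^ card (X - W))"
    using pm by (intro sum.cong) auto
  also have "\<dots> = (\<Sum>W\<in>Pow X. if P W then p ^ card W * (1 - p) ^ card (X - W) else 0)"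
    by (rule sum.inter_filter) (use X in simp)
  also have "\<dots> = rexp X p (\<lambda>W. of_bool (P W))"
    unfolding rexp_def by (intro sum.cong) auto
  finally show ?thesis .
qed

context sparse_mgraph begin

text \<open>A transversal is recovered from the vertex set of its copy, so distinct factors yield
  distinct collections of subgraphs.\<close>

lemma card_factors_le_num_factors:
  assumes W: "W \<subseteq> potential_edges K N"
  shows "card (factors W (\<lambda>_. {..<N})) \<le>
    num_factors K (vpart N) \<lparr>verts = (\<Union>y\<in>verts K. vpart N y), edges = W, ends = snd\<rparr>"
proof -
  let ?G = "\<lparr>verts = (\<Union>y\<in>verts K. vpart N y), edges = W, ends = snd\<rparr>"
  define cp where "cp \<phi> = \<lparr>verts = (\<lambda>y. (y, \<phi> y)) ` verts K, edges = copy_edges \<phi>, ends = snd\<rparr>" for \<phi> :: "'v \<Rightarrow> nat"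
  have cp_sel: "verts (cp \<phi>) = (\<lambda>y. (y, \<phi> y)) ` verts K" "edges (cp \<phi>) = copy_edges \<phi>" "ends (cp \<phi>) = snd" for \<phi>
    by (simp_all add: cp_def)
  have eqI: "\<phi> = \<psi>" if "\<phi> \<in> PiE (verts K) (\<lambda>_. {..<N})" "\<psi> \<in> PiE (verts K) (\<lambda>_. {..<N})" "verts (cp \<phi>) = verts (cp \<psi>)" for \<phi> \<psi>
  proof (rule PiE_ext[OF that(1,2)])
    fix y assume "y \<in> verts K"
    then have "(y, \<phi> y) \<in> verts (cp \<psi>)" unfolding that(3)[symmetric] by (simp add: cp_sel)
    then show "\<phi> y = \<psi> y" by (auto simp: cp_sel)
  qed
  have inj: "inj_on cp (PiE (verts K) (\<lambda>_. {..<N}))"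
    by (rule inj_onI) (rule eqI, auto)
  have "card (factors W (\<lambda>_. {..<N})) \<le> card {\<C>. partite_factor K (vpart N) ?G \<C>}"
  proof (rule card_inj_on_le)
    show "inj_on (image cp) (factors W (\<lambda>_. {..<N}))"
      by (rule inj_on_subset[OF inj_on_image_Pow[OF inj]]) (auto simp: factors_def)
    show "(`) cp ` factors W (\<lambda>_. {..<N}) \<subseteq> {\<C>. partite_factor K (vpart N) ?G \<C>}"
    proof
      fix \<C> assume "\<C> \<in> (`) cp ` factors W (\<lambda>_. {..<N})"
      then obtain P where \<C>: "\<C> = cp ` P" and P: "P \<subseteq> PiE (verts K) (\<lambda>_. {..<N})"
        "\<And>y. y \<in> verts K \<Longrightarrow> bij_betw (\<lambda>\<phi>. \<phi> y) P {..<N}" "\<And>\<phi>. \<phi> \<in> P \<Longrightarrow> copy_edges \<phi> \<subseteq> W"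
        unfolding factors_def by blast
      have lt: "\<phi> y < N" if "\<phi> \<in> P" "y \<in> verts K" for \<phi> y
        using P(1) that by blast
      have copy: "partite_copy K (vpart N) ?G (cp \<phi>)" if \<phi>: "\<phi> \<in> P" for \<phi>
        unfolding partite_copy_def
      proof (intro conjI exI)
        show "subgraph (cp \<phi>) ?G"
          unfolding subgraph_def cp_sel
        proof (intro conjI ballI)
          show "(\<lambda>y. (y, \<phi> y)) ` verts K \<subseteq> verts ?G" using lt[OF \<phi>] by (auto simp: vpart_def)
          show "copy_edges \<phi> \<subseteq> edges ?G" using P(3)[OF \<phi>] by simp
          show "snd = ends ?G" by simp
          fix z assume "z \<in> copy_edges \<phi>"
          then obtain e where "e \<in> edges K" "z = (e, (\<lambda>y. (y, \<phi> y)) ` ends K e)" by (auto simp: copy_edges_def)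
          then show "snd z \<subseteq> (\<lambda>y. (y, \<phi> y)) ` verts K" using ends(1)[of e] by auto
        qed
        show "mgraph_iso (\<lambda>y. (y, \<phi> y)) (\<lambda>e. (e, (\<lambda>y. (y, \<phi> y)) ` ends K e)) K (cp \<phi>)"
          unfolding mgraph_iso_def cp_sel copy_edges_def by (auto simp: bij_betw_def inj_on_def)
        show "\<forall>y\<in>verts K. (y, \<phi> y) \<in> vpart N y" using lt[OF \<phi>] by (auto simp: vpart_def)
      qed
      moreover have "disjoint_family_on verts (cp ` P)"
        unfolding disjoint_family_on_def
      proof (intro ballI impI)
        fix F F' assume F: "F \<in> cp ` P" "F' \<in> cp ` P" "F \<noteq> F'"
        then obtain \<phi> \<psi> where \<phi>: "\<phi> \<in> P" "\<psi> \<in> P" "F = cp \<phi>" "F' = cp \<psi>" by auto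
        have "\<phi> = \<psi>" if y: "y \<in> verts K" "\<phi> y = \<psi> y" for y
          using P(2)[OF y(1)] \<phi>(1,2) y(2) by (auto simp: bij_betw_def dest: inj_onD)
        then show "verts F \<inter> verts F' = {}" using F(3) \<phi> by (auto simp: cp_sel)
      qed
      moreover have "(\<Union>F\<in>cp ` P. verts F) = verts ?G"
      proof (intro equalityI subsetI)
        fix z assume "z \<in> (\<Union>F\<in>cp ` P. verts F)"
        then show "z \<in> verts ?G" using lt by (auto simp: cp_sel vpart_def)
      next
        fix z assume "z \<in> verts ?G"
        then obtain y x where z: "z = (y, x)" "y \<in> verts K" "x \<in> {..<N}" by (auto simp: vpart_def)
        have "x \<in> (\<lambda>\<phi>. \<phi> y) ` P" using P(2)[OF z(2)] z(3) by (simp add: bij_betw_def)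
        then obtain \<phi> where "\<phi> \<in> P" "x = \<phi> y" by auto
        then show "z \<in> (\<Union>F\<in>cp ` P. verts F)" using z by (auto simp: cp_sel)
      qed
      ultimately have "partite_factor K (vpart N) ?G \<C>" unfolding \<C> partite_factor_def by blast
      then show "\<C> \<in> {\<C>. partite_factor K (vpart N) ?G \<C>}" by simp
    qed
    have finG: "finite (verts ?G)" "finite W" using fin finite_subset[OF W finite_potential_edges] by (auto simp: vpart_def)
    \<comment> \<open>The target must be finite, since an infinite set has \<open>card\<close> 0. A
      subgraph is determined by its vertices and edges because \<open>ends\<close> is
      inherited.\<close>
    have "{F. subgraph F ?G} \<subseteq> (\<lambda>(a, b). \<lparr>verts = a, edges = b, ends = snd\<rparr>) ` (Pow (verts ?G) \<times> Pow W)"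
    proof
      fix F assume "F \<in> {F. subgraph F ?G}"
      then have F: "verts F \<in> Pow (verts ?G)" "edges F \<in> Pow W" "ends F = snd" by (auto simp: subgraph_def)
      have "F = (\<lambda>(a, b). \<lparr>verts = a, edges = b, ends = snd\<rparr>) (verts F, edges F)"
        using F(3) by (simp add: mgraph.equality)
      then show "F \<in> (\<lambda>(a, b). \<lparr>verts = a, edges = b, ends = snd\<rparr>) ` (Pow (verts ?G) \<times> Pow W)"
        using F by (intro image_eqI) auto
    qed
    then have "finite {F. subgraph F ?G}" by (rule finite_subset) (use finG in auto)
    moreover have "{\<C>. partite_factor K (vpart N) ?G \<C>} \<subseteq> Pow {F. subgraph F ?G}"
      by (auto simp: partite_factor_def partite_copy_def)
    ultimately show "finite {\<C>. partite_factor K (vpart N) ?G \<C>}" by (meson finite_Pow_iff finite_subset)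
  qed
  then show ?thesis by (simp add: num_factors_def)
qed

lemma prob_num_factors_ge:
  assumes p: "0 \<le> p" "p \<le> 1"
  shows "1 - rexp (potential_edges K N) p (\<lambda>W. of_bool (real (card (factors W (\<lambda>_. {..<N}))) < T))
    \<le> measure_pmf.prob (random_mgraph K N p) {G. T \<le> real (num_factors K (vpart N) G)}"
proof -
  let ?X = "potential_edges K N"
  let ?G = "\<lambda>W. \<lparr>verts = (\<Union>y\<in>verts K. vpart N y), edges = W, ends = snd\<rparr>"
  have "1 - rexp ?X p (\<lambda>W. of_bool (real (card (factors W (\<lambda>_. {..<N}))) < T))
      = rexp ?X p (\<lambda>W. 1 - of_bool (real (card (factors W (\<lambda>_. {..<N}))) < T))"
    unfolding rexp_diff by (simp add: rexp_const[OF finite_potential_edges])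
  also have "\<dots> \<le> rexp ?X p (\<lambda>W. of_bool (T \<le> real (num_factors K (vpart N) (?G W))))"
  proof (rule rexp_mono[OF p])
    fix W assume "W \<subseteq> ?X"
    from card_factors_le_num_factors[OF this]
    have "real (card (factors W (\<lambda>_. {..<N}))) \<le> real (num_factors K (vpart N) (?G W))" by simp
    then show "1 - of_bool (real (card (factors W (\<lambda>_. {..<N}))) < T) \<le> (of_bool (T \<le> real (num_factors K (vpart N) (?G W))) :: real)"
      by auto
  qed
  also have "\<dots> = measure_pmf.prob (Pi_pmf ?X False (\<lambda>_. bernoulli_pmf p))
      {r. T \<le> real (num_factors K (vpart N) (?G {x \<in> ?X. r x}))}"
    by (rule prob_Pi_bernoulli[OF finite_potential_edges p, symmetric])
  also have "\<dots> = measure_pmf.prob (random_mgraph K N p) {G. T \<le> real (num_factors K (vpart N) G)}"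
    unfolding random_mgraph_def by (simp add: vimage_def)
  finally show ?thesis .
qed

end

text \<open>The invariant of the collapsing process; applied to singletons, it excludes loops.\<close>

definition density_bounded :: "real \<Rightarrow> ('v, 'e) mgraph \<Rightarrow> bool" where
  "density_bounded d G \<longleftrightarrow> finite (verts G) \<and> finite (edges G) \<and> verts G \<noteq> {} \<and>
     (\<forall>e\<in>edges G. ends G e \<subseteq> verts G \<and> card (ends G e) = 2) \<and>
     (\<forall>F. subgraph F G \<longrightarrow> verts F \<noteq> {} \<longrightarrow> real (card (edges F)) \<le> d * (real (card (verts F)) - 1))"

section \<open>Densities along the collapsing process\<close>

lemma finite_densities:
  assumes "finite (verts G)" "finite (edges G)"
  shows "finite {density F | F. subgraph F G \<and> P F}"
proof -
  have "{F. subgraph F G} \<subseteq> (\<lambda>(a, b). \<lparr>verts = a, edges = b, ends = ends G\<rparr>) ` (Pow (verts G) \<times> Pow (edges G))"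
  proof
    fix F assume "F \<in> {F. subgraph F G}"
    then have F: "verts F \<in> Pow (verts G)" "edges F \<in> Pow (edges G)" "ends F = ends G" by (auto simp: subgraph_def)
    have "F = (\<lambda>(a, b). \<lparr>verts = a, edges = b, ends = ends G\<rparr>) (verts F, edges F)"
      using F(3) by (simp add: mgraph.equality)
    then show "F \<in> (\<lambda>(a, b). \<lparr>verts = a, edges = b, ends = ends G\<rparr>) ` (Pow (verts G) \<times> Pow (edges G))"
      using F by (intro image_eqI) auto
  qed
  then have "finite {F. subgraph F G}" by (rule finite_subset) (use assms in auto)
  then have "finite (density ` {F. subgraph F G})" by simp
  then show ?thesis by (rule finite_subset[rotated]) auto
qed

lemma simple_graph_finite:
  assumes "simple_graph H"
  shows "finite (verts H)" "finite (edges H)"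
proof -
  show v: "finite (verts H)" using assms by (simp add: simple_graph_def)
  have "ends H ` edges H \<subseteq> Pow (verts H)" using assms by (auto simp: simple_graph_def)
  then have "finite (ends H ` edges H)" using v by (auto intro: finite_subset)
  then show "finite (edges H)" using assms by (auto simp: simple_graph_def dest: finite_imageD)
qed

lemma subgraph_edgeless:
  assumes "finite (verts G)" "\<forall>e\<in>edges G. card (ends G e) = 2" "subgraph F G" "card (verts F) \<le> 1"
  shows "edges F = {}"
proof (rule equals0I)
  fix e assume e: "e \<in> edges F"
  then have "ends G e \<subseteq> verts F" "card (ends G e) = 2" using assms(2,3) unfolding subgraph_def by (metis, blast)
  moreover have "finite (verts F)" using assms(1,3) by (auto simp: subgraph_def intro: finite_subset)
  ultimately have "2 \<le> card (verts F)" by (metis card_mono)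
  then show False using assms(4) by simp
qed

text \<open>The witness \<open>v\<close> lies in \<open>H\<close> itself, so
  \<open>0 \<le> density H \<le> m(v,H) < m(H)\<close>. With fewer than two vertices both maxima
  range over the empty set and cannot differ.\<close>

lemma non_vertex_balanced_pos:
  assumes H: "simple_graph H" "non_vertex_balanced H"
  shows "0 < max_density H"
proof -
  note f = simple_graph_finite[OF H(1)]
  obtain v where v: "v \<in> verts H" "max_density_at v H < max_density H"
    using H(2) by (auto simp: non_vertex_balanced_def)
  show ?thesis
  proof (cases "2 \<le> card (verts H)")
    case True
    have HH: "subgraph H H" using H(1) by (auto simp: subgraph_def simple_graph_def)
    have "density H \<le> max_density_at v H"
      unfolding max_density_at_def using finite_densities[OF f] HH True v(1) by (intro Max_ge) auto
    moreover have "0 \<le> density H" using True by (simp add: density_def)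
    ultimately show ?thesis using v(2) by linarith
  next
    case False
    have "card (verts F) \<le> card (verts H)" if "subgraph F H" for F
      using that f by (auto simp: subgraph_def intro: card_mono)
    then have "\<not> (subgraph F H \<and> 2 \<le> card (verts F))" for F using False le_trans by blast
    then have "max_density_at v H = max_density H" unfolding max_density_def max_density_at_def
      by (intro arg_cong[where f = Max]) blast
    then show ?thesis using v by simp
  qed
qed

lemma density_bounded_simple_graph:
  assumes H: "simple_graph H" "verts H \<noteq> {}"
  shows "density_bounded (max_density H) H"
  unfolding density_bounded_def
proof (intro conjI allI impI)
  note f = simple_graph_finite[OF H(1)]
  show "finite (verts H)" "finite (edges H)" "verts H \<noteq> {}" using f H by auto
  show "\<forall>e\<in>edges H. ends H e \<subseteq> verts H \<and> card (ends H e) = 2" using H by (simp add: simple_graph_def)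
  then have two: "\<forall>e\<in>edges H. card (ends H e) = 2" by simp
  fix F assume F: "subgraph F H" "verts F \<noteq> {}"
  have "finite (verts F)" using F f by (auto simp: subgraph_def intro: finite_subset)
  then have c0: "0 < card (verts F)" using F by (simp add: card_gt_0_iff)
  show "real (card (edges F)) \<le> max_density H * (real (card (verts F)) - 1)"
  proof (cases "2 \<le> card (verts F)")
    case True
    have "density F \<le> max_density H"
      unfolding max_density_def using finite_densities[OF f] F True by (intro Max_ge) auto
    then show ?thesis using True by (simp add: density_def pos_divide_le_eq)
  next
    case False
    then have "card (verts F) = 1" using c0 by simp
    then show ?thesis using subgraph_edgeless[OF f(1) two F(1)] by simp
  qed
qed

text \<open>A subgraph through the new vertex lifts to its union with \<open>F\<close>. As
  \<open>F\<close> has exactly \<open>d (card (verts F) - 1)\<close> edges, subtracting them from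
  the bound for the union leaves the bound for the subgraph: collapsing removes
  \<open>card (verts F) - 1\<close> vertices.\<close>

lemma density_bounded_collapse:
  assumes G: "density_bounded d G" and step: "collapse_step d G G'"
  shows "density_bounded d G'"
proof -
  obtain F z where F: "subgraph F G" "2 \<le> card (verts F)" "density F = d"
    and z: "z \<notin> verts G - verts F" and G': "G' = collapse F z G"
    using step by (auto simp: collapse_step_def)
  define c where "c x = (if x \<in> verts F then z else x)" for x
  have fin: "finite (verts G)" "finite (edges G)" using G by (auto simp: density_bounded_def)
  have ends: "ends G e \<subseteq> verts G" "card (ends G e) = 2" if "e \<in> edges G" for e
    using G that by (auto simp: density_bounded_def)
  have dens: "real (card (edges F)) \<le> d * (real (card (verts F)) - 1)" if "subgraph F G" "verts F \<noteq> {}" for F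
    using G that by (auto simp: density_bounded_def)
  have FV: "verts F \<subseteq> verts G" "edges F \<subseteq> edges G" "ends F = ends G" "\<And>e. e \<in> edges F \<Longrightarrow> ends G e \<subseteq> verts F"
    using F(1) unfolding subgraph_def by (auto, metis subsetD)
  have Ff: "finite (verts F)" "finite (edges F)" using FV fin by (auto intro: finite_subset)
  have Fd: "real (card (edges F)) = d * (real (card (verts F)) - 1)"
    using F(2,3) by (auto simp: density_def)
  have neF: "verts F \<noteq> {}" using F(2) by auto
  have sel: "verts G' = insert z (verts G - verts F)" "edges G' = edges G - edges F" "ends G' = (\<lambda>e. c ` ends G e)"
    by (simp_all add: G' collapse_def c_def[abs_def])
  \<comment> \<open>\<open>F\<close> already has the extremal number of edges for its vertex set;
    one more inside it would violate the bound in \<open>G\<close>. Hence no loop arises.\<close>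
  have noloop: "\<not> ends G e \<subseteq> verts F" if e: "e \<in> edges G - edges F" for e
  proof
    assume sub: "ends G e \<subseteq> verts F"
    have "subgraph (F\<lparr>edges := insert e (edges F)\<rparr>) G"
      using FV e sub by (auto simp: subgraph_def)
    then have "real (card (insert e (edges F))) \<le> d * (real (card (verts F)) - 1)"
      using dens[of "F\<lparr>edges := insert e (edges F)\<rparr>"] neF by simp
    then show False using e Ff Fd by simp
  qed
  have ends': "ends G' e \<subseteq> verts G' \<and> card (ends G' e) = 2" if e: "e \<in> edges G'" for e
  proof
    have eG: "e \<in> edges G - edges F" using e by (simp add: sel)
    show "ends G' e \<subseteq> verts G'" using ends(1)[of e] eG by (auto simp: sel c_def)
    obtain a b where ab: "ends G e = {a, b}" "a \<noteq> b" using ends(2)[of e] eG by (auto simp: card_2_iff)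
    have abG: "a \<in> verts G" "b \<in> verts G" using ends(1)[of e] eG ab by auto
    have "\<not> (a \<in> verts F \<and> b \<in> verts F)" using noloop[OF eG] ab by auto
    then have "c a \<noteq> c b" using ab abG z by (auto simp: c_def)
    then show "card (ends G' e) = 2" using ab by (simp add: sel)
  qed
  have dens': "real (card (edges F')) \<le> d * (real (card (verts F')) - 1)"
    if F': "subgraph F' G'" "verts F' \<noteq> {}" for F'
  proof -
    have S: "verts F' \<subseteq> insert z (verts G - verts F)" "edges F' \<subseteq> edges G - edges F"
      using F'(1) by (simp_all add: subgraph_def sel)
    have S3: "c ` ends G e \<subseteq> verts F'" if "e \<in> edges F'" for e
    proof -
      have "ends G' e \<subseteq> verts F'" using F'(1) that unfolding subgraph_def by metis
      then show ?thesis by (simp add: sel)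
    qed
    have fF': "finite (verts F')" "finite (edges F')"
      using finite_subset[OF S(1)] finite_subset[OF S(2)] fin by auto
    show ?thesis
    proof (cases "z \<in> verts F'")
      case True
      define S0 where "S0 = verts F' - {z}"
      have S0: "S0 \<subseteq> verts G - verts F" "finite S0" "card (verts F') = Suc (card S0)"
        using S(1) fF' card.remove[OF fF'(1) True] by (auto simp: S0_def)
      let ?U = "\<lparr>verts = S0 \<union> verts F, edges = edges F' \<union> edges F, ends = ends G\<rparr>"
      have "ends G e \<subseteq> S0 \<union> verts F" if e: "e \<in> edges F'" for e
      proof
        fix x assume x: "x \<in> ends G e"
        show "x \<in> S0 \<union> verts F"
        proof (cases "x \<in> verts F")
          case False
          then have "x \<in> verts F'" using S3[OF e] x by (force simp: c_def)
          moreover have "x \<in> verts G" using ends(1)[of e] S(2) e x by auto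
          then have "x \<noteq> z" using False z by auto
          ultimately show ?thesis by (simp add: S0_def)
        qed simp
      qed
      then have "ends G e \<subseteq> S0 \<union> verts F" if "e \<in> edges F' \<union> edges F" for e
        using that FV(4)[of e] by blast
      moreover have "S0 \<union> verts F \<subseteq> verts G" "edges F' \<union> edges F \<subseteq> edges G"
        using S0(1) S(2) FV(1,2) by auto
      ultimately have "subgraph ?U G" by (simp add: subgraph_def)
      from dens[OF this] have "real (card (edges F' \<union> edges F)) \<le> d * (real (card (S0 \<union> verts F)) - 1)"
        using neF by simp
      moreover have "card (edges F' \<union> edges F) = card (edges F') + card (edges F)"
        using S(2) fF' Ff by (intro card_Un_disjoint) auto
      moreover have "card (S0 \<union> verts F) = card S0 + card (verts F)"
        using S0 Ff by (intro card_Un_disjoint) auto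
      ultimately show ?thesis using Fd S0(3) by (simp add: algebra_simps)
    next
      case False
      have "ends G e \<subseteq> verts F'" if e: "e \<in> edges F'" for e
      proof
        fix x assume x: "x \<in> ends G e"
        then have "c x \<in> verts F'" using S3[OF e] by auto
        then show "x \<in> verts F'" using False by (auto simp: c_def split: if_splits)
      qed
      moreover have "verts F' \<subseteq> verts G" "edges F' \<subseteq> edges G" using S False by auto
      ultimately have "subgraph \<lparr>verts = verts F', edges = edges F', ends = ends G\<rparr> G"
        by (simp add: subgraph_def)
      from dens[OF this] show ?thesis using F'(2) by simp
    qed
  qed
  show ?thesis
    unfolding density_bounded_def using ends' dens' fin by (auto simp: sel)
qed

text \<open>The invariant gives densities at most \<open>m(H)\<close>, termination excludes
  equality, and finitely many values below \<open>m(H)\<close> have a maximum below it.\<close>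

lemma collapses_to_sparse:
  assumes H: "simple_graph H" "non_vertex_balanced H" and K: "collapses_to H K"
  shows "\<exists>\<delta>>0. \<delta> < max_density H \<and> sparse_mgraph K \<delta>"
proof -
  let ?d = "max_density H"
  have d: "0 < ?d" by (rule non_vertex_balanced_pos[OF H])
  have "verts H \<noteq> {}" using H(2) by (auto simp: non_vertex_balanced_def)
  then have "density_bounded ?d H" by (rule density_bounded_simple_graph[OF H(1)])
  moreover have "(collapse_step ?d)\<^sup>*\<^sup>* H K" using K by (simp add: collapses_to_def)
  ultimately have "density_bounded ?d K"
    by (rotate_tac 1) (induction rule: rtranclp_induct, auto intro: density_bounded_collapse)
  then have fin: "finite (verts K)" "finite (edges K)" "verts K \<noteq> {}"
    and ends: "\<And>e. e \<in> edges K \<Longrightarrow> ends K e \<subseteq> verts K" "\<And>e. e \<in> edges K \<Longrightarrow> card (ends K e) = 2"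
    and dens: "\<And>F. subgraph F K \<Longrightarrow> verts F \<noteq> {} \<Longrightarrow> real (card (edges F)) \<le> ?d * (real (card (verts F)) - 1)"
    by (auto simp: density_bounded_def)
  let ?D = "{density F | F. subgraph F K \<and> 2 \<le> card (verts F)}"
  have fD: "finite ?D" by (rule finite_densities[OF fin(1,2)])
  have less: "x < ?d" if x: "x \<in> ?D" for x
  proof -
    obtain F where F: "subgraph F K" "2 \<le> card (verts F)" "x = density F" using x by blast
    have "real (card (edges F)) \<le> ?d * (real (card (verts F)) - 1)" using F by (intro dens) auto
    then have "density F \<le> ?d" using F(2) by (simp add: density_def pos_divide_le_eq)
    moreover have "density F \<noteq> ?d" using K F by (auto simp: collapses_to_def)
    ultimately show ?thesis using F by simp
  qed
  \<comment> \<open>Inserting \<open>?d / 2\<close> makes the set nonempty and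
    \<open>\<delta>\<close> positive even if \<open>K\<close> is a single vertex or has no
    edges.\<close>
  define \<delta> where "\<delta> = Max (insert (?d / 2) ?D)"
  have \<delta>: "0 < \<delta>" "\<delta> < ?d"
    unfolding \<delta>_def using fD less d by (auto simp: less_max_iff_disj Max_gr_iff)
  have "sparse_mgraph K \<delta>"
  proof
    fix S assume S: "S \<subseteq> verts K" "S \<noteq> {}"
    let ?F = "\<lparr>verts = S, edges = {e \<in> edges K. ends K e \<subseteq> S}, ends = ends K\<rparr>"
    have F: "subgraph ?F K" using S by (auto simp: subgraph_def)
    have "finite S" using S fin finite_subset by blast
    then have c0: "0 < card S" using S by (simp add: card_gt_0_iff)
    show "real (card {e \<in> edges K. ends K e \<subseteq> S}) \<le> \<delta> * (real (card S) - 1)"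
    proof (cases "2 \<le> card S")
      case True
      then have "density ?F \<in> ?D" using F by (intro CollectI exI[of _ ?F]) auto
      then have "density ?F \<le> \<delta>" unfolding \<delta>_def using fD by (intro Max_ge) auto
      then show ?thesis using True by (simp add: density_def pos_divide_le_eq)
    next
      case False
      then have "card S = 1" using c0 by simp
      moreover have "{e \<in> edges K. ends K e \<subseteq> S} = {}"
        using subgraph_edgeless[OF fin(1) _ F] ends(2) \<open>card S = 1\<close> by simp
      ultimately show ?thesis by (simp only: card.empty) simp
    qed
  qed (use fin ends \<delta> in auto)
  then show ?thesis using \<delta> by blast
qed

theorem theorem12:
  fixes H K :: "('v, 'e) mgraph" and p :: "nat \<Rightarrow> real"
    and vH k h :: nat and \<F> :: "nat filter"
  assumes "simple_graph H"
    and "non_vertex_balanced H"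
    and "collapses_to H K"
    and "vH = card (verts H)" and "k = card (verts K)" and "h = card (edges K)"
    and "\<F> = inf at_top (principal {n. vH dvd n})"
    and "\<And>n. vH dvd n \<Longrightarrow> 0 \<le> p n \<and> p n \<le> 1"
    and "p \<in> \<omega>[\<F>](\<lambda>n. real n powr (- 1 / max_density H))"
  shows "\<exists>g :: nat \<Rightarrow> real. g \<in> O[\<F>](\<lambda>n. real n) \<and>
    (\<exists>w :: nat \<Rightarrow> real. filterlim w at_top \<F> \<and>
      (\<forall>n. 0 < n \<and> vH dvd n \<longrightarrow>
        measure_pmf.prob (random_mgraph K (n div vH) (p n))
          {G. real (num_factors K (vpart (n div vH)) G)
                \<ge> (real n ^ (k - 1) * p n ^ h) ^ (n div vH) * exp (- g n)}
        \<ge> 1 - real n powr (- w n)))"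
proof -
  let ?d = "max_density H"
  have d: "0 < ?d" by (rule non_vertex_balanced_pos[OF assms(1,2)])
  obtain \<delta> where \<delta>_less: "0 < \<delta>" "\<delta> < ?d" and sp: "sparse_mgraph K \<delta>"
    using collapses_to_sparse[OF assms(1-3)] by auto
  interpret sparse_mgraph K \<delta> by (rule sp)
  have "verts H \<noteq> {}" using assms(2) by (auto simp: non_vertex_balanced_def)
  then have vH: "0 < vH" using simple_graph_finite[OF assms(1)] assms(4) by (simp add: card_gt_0_iff)
  define \<alpha> where "\<alpha> = 1 / ?d"
  have \<alpha>: "0 < \<alpha>" "\<alpha> * \<delta> < 1" using d \<delta>_less by (auto simp: \<alpha>_def)
  \<comment> \<open>With \<open>n = vH * N\<close> this makes \<open>n powr - \<alpha>\<close> equal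
    to \<open>a * N powr - \<alpha>\<close>.\<close>
  define a where "a = real vH powr - \<alpha>"
  have a: "0 < a" using vH by (simp add: a_def)
  obtain c N0 where c: "0 < c" and N0: "\<And>N p. N0 \<le> N \<Longrightarrow> a * real N powr - \<alpha> \<le> p \<Longrightarrow> p \<le> 1 \<Longrightarrow>
    rexp (potential_edges K N) p (\<lambda>W. of_bool (real (card (factors W (\<lambda>_. {..<N}))) <
      (real N ^ (k - 1) * p ^ h) ^ N * exp (- (real (3 * k + h + 4) * real N))))
    \<le> exp (- c * (ln (real N))\<^sup>2)"
    using factor_count[OF \<alpha> a] unfolding assms(5,6) by metis
  have "eventually (\<lambda>n. 1 * norm (real n powr (- 1 / ?d)) \<le> norm (p n)) \<F>"
    using landau_omega.smallD[OF assms(9), of 1] by simp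
  then obtain n1 where n1: "\<And>n. n1 \<le> n \<Longrightarrow> vH dvd n \<Longrightarrow> real n powr - \<alpha> \<le> \<bar>p n\<bar>"
    unfolding assms(7) eventually_inf_principal eventually_at_top_linorder by (auto simp: \<alpha>_def)
  \<comment> \<open>The extra logarithm pays for stating the bound with \<open>n ^ (k - 1)\<close>
    although the parts have size \<open>n / vH\<close>.\<close>
  define C where "C = real (3 * k + h + 4) + real (k - 1) * ln (real vH)"
  define g where "g n = C * real (n div vH)" for n
  define n0 where "n0 = max 2 (max n1 (vH * N0))"
  \<comment> \<open>Chosen so that \<open>n powr (- w n)\<close> equals
    \<open>exp (- c * (ln N)\<^sup>2)\<close>. Below \<open>n0\<close> the value 0 turns the claimed
    lower bound into the trivial 0; \<open>n0 \<ge> 2\<close> keeps \<open>ln n\<close>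
    positive.\<close>
  define w where "w n = (if n0 \<le> n then c * (ln (real n / real vH))\<^sup>2 / ln (real n) else 0)" for n
  have "g \<in> O(\<lambda>n. real n)"
  proof (rule bigoI[where c = "\<bar>C\<bar>"], rule always_eventually, rule allI)
    fix n
    show "norm (g n) \<le> \<bar>C\<bar> * norm (real n)" by (simp add: g_def abs_mult mult_left_mono)
  qed
  then have g: "g \<in> O[\<F>](\<lambda>n. real n)"
    unfolding assms(7) by (rule landau_o.big.filter_mono[rotated]) simp
  have "filterlim (\<lambda>n. c * (ln (real n / real vH))\<^sup>2 / ln (real n)) at_top at_top"
    using c vH by real_asymp
  moreover have "eventually (\<lambda>n. c * (ln (real n / real vH))\<^sup>2 / ln (real n) = w n) at_top"
    using eventually_ge_at_top[of n0] by eventually_elim (simp add: w_def)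
  ultimately have "filterlim w at_top at_top" using filterlim_cong[OF refl refl] by fast
  then have w: "filterlim w at_top \<F>" unfolding assms(7) by (rule filterlim_mono) simp_all
  have "1 - real n powr (- w n) \<le> measure_pmf.prob (random_mgraph K (n div vH) (p n))
      {G. (real n ^ (k - 1) * p n ^ h) ^ (n div vH) * exp (- g n) \<le> real (num_factors K (vpart (n div vH)) G)}"
    if n: "0 < n" "vH dvd n" for n
  proof (cases "n0 \<le> n")
    case False
    then show ?thesis using n by (simp add: w_def)
  next
    case True
    define N where "N = n div vH"
    have nN: "n = vH * N" using n by (simp add: N_def)
    have rN: "real N = real n / real vH" using vH by (simp add: nN)
    have N: "N0 \<le> N" using True vH by (simp add: n0_def nN)
    have N1: "1 \<le> real N" using n nN by (cases N) auto
    have p: "0 \<le> p n" "p n \<le> 1" using assms(8)[OF n(2)] by auto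
    have "real n powr - \<alpha> = a * real N powr - \<alpha>"
      by (simp add: a_def nN powr_mult)
    then have pa: "a * real N powr - \<alpha> \<le> p n" using n1[of n] True n p by (simp add: n0_def)
    have eq: "(real n ^ (k - 1) * p n ^ h) ^ N * exp (- g n)
        = (real N ^ (k - 1) * p n ^ h) ^ N * exp (- (real (3 * k + h + 4) * real N))"
    proof -
      have "exp (- g n) = exp (- (real (3 * k + h + 4) * real N)) * (1 / (real vH ^ (k - 1)) ^ N)"
      proof -
        have "(real vH ^ (k - 1)) ^ N = exp (real N * (real (k - 1) * ln (real vH)))"
          using vH by (simp add: exp_of_nat_mult)
        then show ?thesis
          by (simp add: g_def C_def N_def[symmetric] exp_minus[symmetric] exp_add[symmetric] algebra_simps inverse_eq_divide[symmetric])
      qed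
      moreover have "(real n ^ (k - 1) * p n ^ h) ^ N = (real vH ^ (k - 1)) ^ N * (real N ^ (k - 1) * p n ^ h) ^ N"
        unfolding power_mult_distrib[symmetric] by (simp add: nN power_mult_distrib mult_ac)
      ultimately show ?thesis using vH by simp
    qed
    have n2: "2 \<le> n" using True by (simp add: n0_def)
    then have "0 < ln (real n)" by simp
    then have wn: "exp (- c * (ln (real N))\<^sup>2) = real n powr (- w n)"
      using True n by (simp add: powr_def w_def rN)
    have "1 - real n powr (- w n) \<le> 1 - rexp (potential_edges K N) (p n) (\<lambda>W. of_bool (real (card (factors W (\<lambda>_. {..<N}))) <
        (real N ^ (k - 1) * p n ^ h) ^ N * exp (- (real (3 * k + h + 4) * real N))))"
      using N0[OF N pa p(2)] wn by linarith
    also have "\<dots> \<le> measure_pmf.prob (random_mgraph K N (p n))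
        {G. (real N ^ (k - 1) * p n ^ h) ^ N * exp (- (real (3 * k + h + 4) * real N)) \<le> real (num_factors K (vpart N) G)}"
      by (rule prob_num_factors_ge[OF p])
    finally show ?thesis unfolding N_def[symmetric] eq .
  qed
  then show ?thesis using g w by blast
qed

end
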